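(* Let $X_1,\ldots,X_N$ be i.i.d. random variables with mean $\mu$ and finite variance $\sigma^2>0$, and let $\widehat\mu_N=\mathrm{med}\left(\bar X_J,\ J\in\mathcal A_N^{(m)}\right)$ be the permutation-invariant median of means estimator (see context). Assume that $\sqrt{\frac{N}{m}}\,g(m)\to0$ as $N/m\to\infty$ and $m\to\infty$. Then $$\sqrt N\left(\widehat\mu_N-\mu\right)\xrightarrow{d}\mathcal N(0,\sigma^2)$$ as $N/m\to\infty$ and $m\to\infty$.
   Context: For $2\le m<N$, $\mathcal A_N^{(m)}=\{J\subset\{1,\ldots,N\}:|J|=m\}$, and for $J\in\mathcal A_N^{(m)}$, $\bar X_J=\frac1m\sum_{j\in J}X_j$. The estimator $\widehat\mu_N$ is the median of the collection of all $\binom Nm$ averages $\bar X_J$, $J\in\mathcal A_N^{(m)}$; a median is a minimizer over $z\in\mathbb R$ of $\sum_{J\in\mathcal A_N^{(m)}}|\bar X_J-z|$. The function $g$ is $$g(m)=\frac{1}{\sqrt m}\,\mathbb E\left[\left(\frac{X_1-\mu}{\sigma}\right)^2\min\left(\left|\frac{X_1-\mu}{\sigma}\right|,\sqrt m\right)\right].$$ Here $m=m_N$ is allowed to depend on $N$, the distribution of $X_1$ is fixed, and $\xrightarrow{d}$ denotes convergence in distribution. *)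

theory Defs
  imports "HOL-Probability.Probability"
begin

definition m_subsets :: "nat \<Rightarrow> nat \<Rightarrow> nat set set" where
  "m_subsets N m = {J. J \<subseteq> {1..N} \<and> card J = m}"

definition block_mean :: "nat \<Rightarrow> (nat \<Rightarrow> real) \<Rightarrow> nat set \<Rightarrow> real" where
  "block_mean m x J = (1 / real m) * (\<Sum>j\<in>J. x j)"

text \<open>Medians need not be unique: every minimizer of the sum of absolute deviations counts as one.\<close>

definition is_median :: "'i set \<Rightarrow> ('i \<Rightarrow> real) \<Rightarrow> real \<Rightarrow> bool" where
  "is_median A a z \<longleftrightarrow> is_arg_min (\<lambda>z. \<Sum>J\<in>A. \<bar>a J - z\<bar>) (\<lambda>_. True) z"

definition is_pi_mom :: "nat \<Rightarrow> nat \<Rightarrow> (nat \<Rightarrow> real) \<Rightarrow> real \<Rightarrow> bool" where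
  "is_pi_mom N m x z \<longleftrightarrow> is_median (m_subsets N m) (block_mean m x) z"

text \<open>
  \<open>is_pi_mom N m x z\<close> says that \<open>z\<close> is a value of the permutation-invariant median of means
  for the data \<open>x 1, \<dots>, x N\<close>. The function below is the paper's \<open>g(m)\<close> for an
  observation \<open>Y\<close> on \<open>M\<close> with mean \<open>\<mu>\<close> and standard deviation \<open>\<sigma>\<close>.
\<close>

definition g_fun :: "'a measure \<Rightarrow> ('a \<Rightarrow> real) \<Rightarrow> real \<Rightarrow> real \<Rightarrow> nat \<Rightarrow> real" where
  "g_fun M Y \<mu> \<sigma> m =
     (1 / sqrt (real m)) *
     (\<integral>\<omega>. ((Y \<omega> - \<mu>) / \<sigma>)\<^sup>2 * min \<bar>(Y \<omega> - \<mu>) / \<sigma>\<bar> (sqrt (real m)) \<partial>M)"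

end

(*
Write S_J for the sum over the block J of the standardized observations, k = N/m, and let U be the
fraction of blocks with S_J at or below the level corresponding to mu + t / sqrt N. A median of the
block averages is at most mu + t / sqrt N if U > 1/2 and only if U >= 1/2, so it suffices that
sqrt k (U - 1/2) and (t / sigma - Z) / sqrt (2 pi) differ by o(1) in probability, where Z is the
standardized sum of all observations.

A Berry-Esseen bound with error O(g(n)) (characteristic functions and Esseen smoothing) gives the
mean of U up to o(1 / sqrt k). For the fluctuations, R = sqrt k (U - E U) + Z / sqrt (2 pi) satisfies
E R^2 = k Var U + 2 sqrt k E[U Z] / sqrt (2 pi) + 1 / (2 pi). By exchangeability
sqrt k E[U Z] = E[S 1(S <= x)] with S a normalized block sum and x -> 0, which tends to
-1 / sqrt (2 pi). Two blocks sharing j observations have covariance about j / (2 pi m), up to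
O(g(m)^2), by Berry-Esseen for the sums over their non-shared parts; since the mean overlap is m^2 / N,
limsup k Var U <= 1 / (2 pi). Hence E R^2 -> 0.
*)
theory Submission
  imports Defs
begin

text \<open>Only a finite variance is available, so the error is measured by the truncated moment g
  instead of a third absolute moment. Since g(n) is at least a constant over sqrt n, errors of order
  1 / n are absorbed into it. Smoothing uses the Fejer kernel because its characteristic function
  has compact support: beyond the cutoff frequency 1 / (2 g(n)) the transforms vanish, so lattice
  laws are covered too. The assumption on sqrt k g(m) is spent twice: linearly, to keep the bias of
  U below its fluctuations, and squared, to make the covariance error k g(m)^2 vanish. As R^2 is
  nonnegative, upper bounds for k Var U and sqrt k E[U Z] suffice. This one-sidedness permits crude
  estimates given the overlap, and lets the unbounded truncated mean be replaced by a bounded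
  continuous majorant. Pairs whose overlap exceeds a fixed fraction of m escape the normal
  comparison; a Chebyshev-type bound through the second moment of the overlap shows that their total
  contribution is o(1 / k).\<close>

section \<open>The Fejer kernel\<close>

text \<open>\<open>Si x - (1 - cos x) / x\<close> is an antiderivative on the positive half-line and
  runs from 0 to pi / 2; evenness of the integrand doubles this.\<close>

lemma has_bochner_integral_one_minus_cos:
  "has_bochner_integral lborel (\<lambda>x. (1 - cos x) / x\<^sup>2) (pi :: real)"
proof -
  let ?F = "\<lambda>x. Si x - (1 - cos x) / x" and ?f = "\<lambda>x::real. (1 - cos x) / x\<^sup>2"
  have deriv: "(?F has_real_derivative ?f x) (at x)" if "x > 0" for x
    using that
    by (auto intro!: derivative_eq_intros DERIV_Si simp: field_simps power2_eq_square)
  have cont: "isCont ?f x" if "x > 0" for x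
    using that by (auto intro!: continuous_intros)
  have "((\<lambda>x::real. (1 - cos x) / x) \<longlongrightarrow> 0) (at_right 0)"
    by real_asymp
  moreover have "(Si \<longlongrightarrow> Si 0) (at_right 0)"
    using isCont_Si[of 0] by (auto simp: isCont_def intro: filterlim_at_split[THEN iffD1, THEN conjunct2])
  moreover have "Si 0 = 0"
    using Si_neg[of 0] by simp
  ultimately have lim0: "(?F \<longlongrightarrow> 0) (at_right 0)"
    using tendsto_diff by fastforce
  have "((\<lambda>x::real. (1 - cos x) / x) \<longlongrightarrow> 0) at_top"
    by real_asymp
  then have liminf: "(?F \<longlongrightarrow> pi / 2) at_top"
    using tendsto_diff[OF Si_at_top] by fastforce
  note FTC = interval_integral_FTC_nonneg[of 0 \<infinity> ?F ?f 0 "pi / 2"]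
  have int: "set_integrable lborel (einterval 0 \<infinity>) ?f"
    and val: "(LBINT x=0..\<infinity>. ?f x) = pi / 2 - 0"
    by (rule FTC; use deriv cont lim0 liminf in 
        \<open>auto simp: zero_ereal_def ereal_tendsto_simps\<close>)+
  have ei: "einterval 0 \<infinity> = {0<..}"
    by (auto simp: einterval_def zero_ereal_def)
  \<comment> \<open>The integrand is 0 at 0 by division by zero, so the open and the closed
    half-line give the same function.\<close>
  have eq: "(\<lambda>x. indicator {0<..} x *\<^sub>R ?f x) = (\<lambda>x. indicator {0..} x *\<^sub>R ?f x)"
    by (auto simp: indicator_def fun_eq_iff)
  have "has_bochner_integral lborel (\<lambda>x. indicator {0..} x *\<^sub>R ?f x) (pi / 2)"
    using int val
    unfolding interval_lebesgue_integral_0_infty set_integrable_def set_lebesgue_integral_def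
      ei eq has_bochner_integral_iff by simp
  from has_bochner_integral_even_function[OF this] show ?thesis
    by simp
qed

lemma has_bochner_integral_one_minus_cos_scaled:
  fixes a :: real
  shows "has_bochner_integral lborel (\<lambda>x. (1 - cos (a * x)) / x\<^sup>2) (pi * \<bar>a\<bar>)"
proof (cases "a = 0")
  case False
  have "has_bochner_integral lborel (\<lambda>x. (1 - cos (0 + a * x)) / (0 + a * x)\<^sup>2) (pi /\<^sub>R \<bar>a\<bar>)"
    using lborel_has_bochner_integral_real_affine_iff[OF False, of "\<lambda>x. (1 - cos x) / x\<^sup>2" pi 0]
      has_bochner_integral_one_minus_cos by simp
  from has_bochner_integral_mult_right[where c = "a\<^sup>2", OF this] show ?thesis
    using False by (simp add: power_mult_distrib power2_eq_square divide_simps abs_if mult.commute split: if_splits)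
qed (simp add: has_bochner_integral_zero)

text \<open>At \<open>0\<close> the value is \<open>0\<close> by division by zero, on a null set.\<close>

definition fejer_density :: "real \<Rightarrow> real" where
  "fejer_density x = (1 - cos x) / (pi * x\<^sup>2)"

definition fejer :: "real measure" where
  "fejer = density lborel (\<lambda>x. ennreal (fejer_density x))"

lemma fejer_density_measurable [measurable]: "fejer_density \<in> borel_measurable borel"
  unfolding fejer_density_def by measurable

lemma fejer_density_nonneg: "fejer_density x \<ge> 0"
  unfolding fejer_density_def by simp

lemma has_bochner_integral_fejer: "has_bochner_integral lborel fejer_density 1"
  using has_bochner_integral_divide[OF has_bochner_integral_one_minus_cos, of pi]
  unfolding fejer_density_def by (simp add: mult.commute)

lemma real_distribution_fejer: "real_distribution fejer"
proof -
  have "prob_space fejer"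
  proof
    have "emeasure fejer (space fejer) = (\<integral>\<^sup>+x. ennreal (fejer_density x) \<partial>lborel)"
      unfolding fejer_def by (subst emeasure_density) auto
    also have "\<dots> = 1"
      using has_bochner_integral_fejer
      by (subst nn_integral_eq_integral)
        (auto simp: has_bochner_integral_iff fejer_density_nonneg)
    finally show "emeasure fejer (space fejer) = 1" .
  qed
  then show ?thesis
    by (simp add: real_distribution_def real_distribution_axioms_def fejer_def)
qed

lemma fejer_singleton: "measure fejer {x} = 0"
proof -
  have "emeasure fejer {x} = 0"
    unfolding fejer_def
    using AE_lborel_singleton[of x]
    by (subst emeasure_density) (auto intro!: nn_integral_0_iff_AE[THEN iffD2] elim!: eventually_mono simp: indicator_def)
  then show ?thesis by (simp add: measure_def)
qed

text \<open>By product-to-sum, (1 - cos x) cos (t x) is a combination of the functions 1 - cos (a x)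
  with a = 1 + t, 1 - t and t, whose integrals are known; the sine part vanishes by oddness.\<close>

lemma char_fejer: "char fejer t = of_real (max 0 (1 - \<bar>t\<bar>))"
proof -
  interpret real_distribution fejer by (rule real_distribution_fejer)
  have cos_int: "has_bochner_integral lborel (\<lambda>x. fejer_density x * cos (t * x)) (max 0 (1 - \<bar>t\<bar>))"
  proof -
    let ?g = "\<lambda>a x::real. (1 - cos (a * x)) / x\<^sup>2"
    have "has_bochner_integral lborel
        (\<lambda>x. (?g (1 + t) x / 2 + ?g (1 - t) x / 2 - ?g t x) / pi)
        ((pi * \<bar>1 + t\<bar> / 2 + pi * \<bar>1 - t\<bar> / 2 - pi * \<bar>t\<bar>) / pi)"
      by (intro has_bochner_integral_divide has_bochner_integral_diff has_bochner_integral_add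
          has_bochner_integral_one_minus_cos_scaled)
    also have "(\<lambda>x. (?g (1 + t) x / 2 + ?g (1 - t) x / 2 - ?g t x) / pi)
        = (\<lambda>x. fejer_density x * cos (t * x))"
    proof
      fix x
      have "cos ((1 + t) * x) + cos ((1 - t) * x) = 2 * cos x * cos (t * x)"
        by (simp add: distrib_right left_diff_distrib cos_add cos_diff)
      then have *: "cos ((1 + t) * x) = 2 * cos x * cos (t * x) - cos ((1 - t) * x)"
        by simp
      show "(?g (1 + t) x / 2 + ?g (1 - t) x / 2 - ?g t x) / pi = fejer_density x * cos (t * x)"
        unfolding fejer_density_def * by (cases "x = 0") (simp_all add: field_simps)
    qed
    also have "(pi * \<bar>1 + t\<bar> / 2 + pi * \<bar>1 - t\<bar> / 2 - pi * \<bar>t\<bar>) / pi = max 0 (1 - \<bar>t\<bar>)"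
      by (simp add: field_simps abs_if max_def)
    finally show ?thesis .
  qed
  have sin_int: "has_bochner_integral lborel (\<lambda>x. fejer_density x * sin (t * x)) 0"
  proof -
    have "integrable lborel (\<lambda>x. fejer_density x * sin (t * x))"
      by (rule Bochner_Integration.integrable_bound[of lborel fejer_density])
        (use has_bochner_integral_fejer in \<open>auto simp: has_bochner_integral_iff abs_mult fejer_density_nonneg
           intro!: AE_I2 mult_left_le\<close>)
    moreover have "(\<integral>x. fejer_density x * sin (t * x) \<partial>lborel) = 0"
      using lborel_integral_real_affine[of "-1" "\<lambda>x. fejer_density x * sin (t * x)" 0]
      by (simp add: fejer_density_def)
    ultimately show ?thesis by (simp add: has_bochner_integral_iff)
  qed
  have "char fejer t = (CLINT x|lborel. fejer_density x *\<^sub>R iexp (t * x))"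
    unfolding char_def fejer_def
    by (subst integral_density) (auto simp: fejer_density_nonneg)
  also have "\<dots> = (CLINT x|lborel. of_real (fejer_density x * cos (t * x)) + \<i> * of_real (fejer_density x * sin (t * x)))"
    by (intro Bochner_Integration.integral_cong refl)
      (simp add: complex_eq_iff Re_exp Im_exp)
  also have "\<dots> = of_real (max 0 (1 - \<bar>t\<bar>))"
    using cos_int sin_int unfolding has_bochner_integral_iff
    by (subst Bochner_Integration.integral_add) (auto intro!: integrable_of_real simp flip: of_real_mult)
  finally show ?thesis .
qed

lemma fejer_tail:
  assumes "A > 0"
  shows "measure fejer {x. \<bar>x\<bar> > A} \<le> 4 / (pi * A)"
proof -
  have half: "(\<integral>\<^sup>+x. ennreal (2 / (pi * x\<^sup>2)) * indicator {A..} x \<partial>lborel) = ennreal (2 / (pi * A))"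
  proof -
    have "(\<integral>\<^sup>+x. ennreal (2 / (pi * x\<^sup>2)) * indicator {A..} x \<partial>lborel) = ennreal (0 - (- (2 / (pi * A))))"
    proof (rule nn_integral_FTC_atLeast)
      show "((\<lambda>x. - (2 / (pi * x))) \<longlongrightarrow> 0) at_top"
        by real_asymp
      show "((\<lambda>x. - (2 / (pi * x))) has_real_derivative 2 / (pi * x\<^sup>2)) (at x)" if "A \<le> x" for x
        using that assms by (auto intro!: derivative_eq_intros simp: power2_eq_square divide_simps)
    qed auto
    then show ?thesis by simp
  qed
  have half': "(\<integral>\<^sup>+x. ennreal (2 / (pi * x\<^sup>2)) * indicator {..-A} x \<partial>lborel) = ennreal (2 / (pi * A))"
    using nn_integral_real_affine[of "\<lambda>x. ennreal (2 / (pi * x\<^sup>2)) * indicator {..-A} x" "-1" 0] half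
    by (simp add: indicator_def)
  have "emeasure fejer {x. \<bar>x\<bar> > A} = (\<integral>\<^sup>+x. ennreal (fejer_density x) * indicator {x. \<bar>x\<bar> > A} x \<partial>lborel)"
    unfolding fejer_def by (subst emeasure_density) auto
  also have "\<dots> \<le> (\<integral>\<^sup>+x. ennreal (2 / (pi * x\<^sup>2)) * indicator {A..} x + ennreal (2 / (pi * x\<^sup>2)) * indicator {..-A} x \<partial>lborel)"
  proof (intro nn_integral_mono)
    fix x :: real
    have "1 - cos x \<le> 2" using cos_ge_minus_one[of x] by linarith
    then have "fejer_density x \<le> 2 / (pi * x\<^sup>2)"
      unfolding fejer_density_def by (intro divide_right_mono) auto
    then show "ennreal (fejer_density x) * indicator {x. \<bar>x\<bar> > A} x
        \<le> ennreal (2 / (pi * x\<^sup>2)) * indicator {A..} x + ennreal (2 / (pi * x\<^sup>2)) * indicator {..-A} x"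
      by (auto simp: indicator_def ennreal_leI add_increasing2)
  qed
  also have "\<dots> = ennreal (2 / (pi * A)) + ennreal (2 / (pi * A))"
    by (subst nn_integral_add) (auto simp: half half')
  also have "\<dots> = ennreal (4 / (pi * A))"
    using assms by (simp flip: ennreal_plus)
  finally show ?thesis
    unfolding measure_def using assms by (simp add: enn2real_leI)
qed

section \<open>Smoothing inequality\<close>

text \<open>Convolution with the Fejer law shrunk by T. The parameter divides so that T becomes the
  cutoff frequency: the characteristic function is multiplied by a triangle supported on
  [-T, T].\<close>

definition fejer_smooth :: "real \<Rightarrow> real measure \<Rightarrow> real measure" where
  "fejer_smooth T F = distr (F \<Otimes>\<^sub>M fejer) borel (\<lambda>(x, y). x + y / T)"

lemma sets_fejer [measurable_cong, simp]: "sets fejer = sets borel"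
  by (simp add: fejer_def)

context
  fixes F :: "real measure" and T :: real
  assumes F: "real_distribution F" and T: "T > 0"
begin

interpretation F: real_distribution F by (rule F)
interpretation K: real_distribution fejer by (rule real_distribution_fejer)
interpretation P: pair_prob_space F fejer ..

lemma fejer_smooth_meas [measurable]: "(\<lambda>(x, y). x + y / T) \<in> borel_measurable (F \<Otimes>\<^sub>M fejer)"
  using F.sets_M by measurable

lemma real_distribution_fejer_smooth: "real_distribution (fejer_smooth T F)"
  unfolding fejer_smooth_def by (rule P.real_distribution_distr) (rule fejer_smooth_meas)

lemma char_fejer_smooth:
  "char (fejer_smooth T F) t = char F t * of_real (max 0 (1 - \<bar>t / T\<bar>))"
proof -
  have "char (fejer_smooth T F) t = (CLINT z|F \<Otimes>\<^sub>M fejer. iexp (t * fst z) * iexp (t / T * snd z))"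
    unfolding fejer_smooth_def char_def
    by (subst integral_distr)
      (auto simp: case_prod_unfold distrib_left exp_add[symmetric] intro!: Bochner_Integration.integral_cong)
  also have "\<dots> = (CLINT x|F. CLINT y|fejer. iexp (t * x) * iexp (t / T * y))"
  proof (subst P.integral_fst'[symmetric])
    show "integrable (F \<Otimes>\<^sub>M fejer) (\<lambda>z. iexp (t * fst z) * iexp (t / T * snd z))"
      by (rule P.P.integrable_const_bound[of _ 1]) (auto simp: norm_mult)
  qed simp
  also have "\<dots> = char F t * char fejer (t / T)"
    unfolding char_def by simp
  finally show ?thesis by (simp add: char_fejer)
qed

lemma cdf_fejer_smooth:
  "cdf (fejer_smooth T F) b = (\<integral>y. cdf F (b - y / T) \<partial>fejer)"
proof -
  have "cdf (fejer_smooth T F) b = measure (F \<Otimes>\<^sub>M fejer) {z \<in> space (F \<Otimes>\<^sub>M fejer). fst z + snd z / T \<le> b}"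
    unfolding fejer_smooth_def cdf_def
    by (subst measure_distr) (auto simp: case_prod_unfold intro!: arg_cong[of _ _ "measure _"])
  also have "\<dots> = (\<integral>z. indicator {z. fst z + snd z / T \<le> b} z \<partial>(F \<Otimes>\<^sub>M fejer))"
    by (subst Bochner_Integration.integral_indicator) (auto intro!: arg_cong[of _ _ "measure _"])
  also have "\<dots> = (\<integral>y. \<integral>x. indicator {z. fst z + snd z / T \<le> b} (x, y) \<partial>F \<partial>fejer)"
    using P.integral_snd[of "\<lambda>x y. indicator {z. fst z + snd z / T \<le> b} (x, y) :: real"]
    by (simp add: P.P.integrable_const_bound[of _ 1])
  also have "\<dots> = (\<integral>y. cdf F (b - y / T) \<partial>fejer)"
  proof (intro Bochner_Integration.integral_cong refl)
    fix y
    have "(\<integral>x. indicator {z. fst z + snd z / T \<le> b} (x, y) \<partial>F) = (\<integral>x. (indicator {..b - y / T} x :: real) \<partial>F)"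
      by (intro Bochner_Integration.integral_cong) (auto simp: indicator_def)
    then show "(\<integral>x. indicator {z. fst z + snd z / T \<le> b} (x, y) \<partial>F) = cdf F (b - y / T)"
      by (simp add: cdf_def)
  qed
  finally show ?thesis .
qed

text \<open>F may have atoms, but the smoothed law has none, so Levy inversion applies to it at
  every pair of endpoints.\<close>

lemma fejer_smooth_singleton: "measure (fejer_smooth T F) {a} = 0"
proof -
  have "emeasure (fejer_smooth T F) {a} = emeasure (F \<Otimes>\<^sub>M fejer) {z \<in> space (F \<Otimes>\<^sub>M fejer). fst z + snd z / T = a}"
    unfolding fejer_smooth_def
    by (subst emeasure_distr) (auto simp: case_prod_unfold intro!: arg_cong[of _ _ "emeasure _"])
  also have "\<dots> = (\<integral>\<^sup>+x. emeasure fejer (Pair x -` {z \<in> space (F \<Otimes>\<^sub>M fejer). fst z + snd z / T = a}) \<partial>F)"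
    by (rule K.emeasure_pair_measure_alt) measurable
  also have "\<dots> = (\<integral>\<^sup>+x. emeasure fejer {(a - x) * T} \<partial>F)"
    using T by (intro nn_integral_cong arg_cong[of _ _ "emeasure fejer"]) (auto simp: space_pair_measure field_simps)
  also have "\<dots> = 0"
    by (simp add: K.emeasure_eq_measure fejer_singleton)
  finally show ?thesis by (simp add: measure_def)
qed

end

lemma norm_indicator_mult_le:
  fixes k d :: complex
  shows "cmod (indicator A t *\<^sub>R (k * (of_real w * d))) \<le> cmod k * (\<bar>w\<bar> * cmod d)"
  by (cases "t \<in> A") (simp_all add: norm_mult)

text \<open>Levy inversion for both smoothed laws. The inversion kernel is at most 2 / |t|, which is
  why the assumed bound carries a factor |t|; the prefactor 1 / (2 pi) then leaves 1 / pi.\<close>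

lemma fejer_smooth_cdf_diff_le:
  fixes h :: "real \<Rightarrow> real"
  assumes F: "real_distribution F" and G: "real_distribution G" and T: "T > 0"
    and h: "integrable lborel h" "\<And>t. h t \<ge> 0"
    and bound: "\<And>t. \<bar>t\<bar> \<le> T \<Longrightarrow> cmod (char F t - char G t) \<le> \<bar>t\<bar> * h t"
  shows "\<bar>cdf (fejer_smooth T F) b - cdf (fejer_smooth T G) b\<bar> \<le> (\<integral>t. h t \<partial>lborel) / pi"
proof -
  let ?F = "fejer_smooth T F" and ?G = "fejer_smooth T G"
  interpret F: real_distribution F by (rule F)
  interpret G: real_distribution G by (rule G)
  interpret F': real_distribution ?F by (rule real_distribution_fejer_smooth[OF F T])
  interpret G': real_distribution ?G by (rule real_distribution_fejer_smooth[OF G T])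
  let ?k = "\<lambda>a t. (iexp (-(t * a)) - iexp (-(t * b))) / (\<i> * t)"
  \<comment> \<open>The bound b - a on the kernel gives integrability of each integrand, so that the
    two integrals may be subtracted; it grows with the interval, so the estimate itself uses the
    bound 2 / |t|.\<close>
  have k_int: "integrable lborel (\<lambda>t. indicator {-S<..<S} t *\<^sub>R (?k a t * char H t))"
    if "a < b" "S \<ge> 0" "real_distribution H" for a S H
  proof -
    interpret H: real_distribution H by fact
    have "cmod (?k a t * char H t) \<le> b - a" if "t \<noteq> 0" for t
    proof -
      have "cmod (?k a t) \<le> b - a"
        using Levy_Inversion_aux2[of "-b" "-a" t] that \<open>a < b\<close> by simp
      then have "cmod (?k a t * char H t) \<le> (b - a) * 1"
        unfolding norm_mult using H.cmod_char_le_1[of t] \<open>a < b\<close> by (intro mult_mono) auto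
      then show ?thesis by simp
    qed
    then show ?thesis
      using that
      by (intro integrableI_bounded_set_indicator[where B="b - a"] conjI impI)
        (auto intro!: AE_I [of _ _ "{0}"])
  qed
  have main: "\<bar>measure ?F {a<..b} - measure ?G {a<..b}\<bar> \<le> (\<integral>t. h t \<partial>lborel) / pi" if "a < b" for a
  proof -
    let ?I = "\<lambda>S H. 1 / (2 * pi) * (CLBINT t=-S..S. ?k a t * char H t)"
    have lim: "(\<lambda>S. ?I (real S) ?F - ?I (real S) ?G) \<longlonglongrightarrow>
        of_real (measure ?F {a<..b}) - of_real (measure ?G {a<..b})"
    proof (intro tendsto_diff)
      show "(\<lambda>S. ?I (real S) ?F) \<longlonglongrightarrow> of_real (measure ?F {a<..b})"
        using F'.Levy_Inversion[of a b] that fejer_smooth_singleton[OF F T] by simp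
      show "(\<lambda>S. ?I (real S) ?G) \<longlonglongrightarrow> of_real (measure ?G {a<..b})"
        using G'.Levy_Inversion[of a b] that fejer_smooth_singleton[OF G T] by simp
    qed
    have "cmod (?I S ?F - ?I S ?G) \<le> (\<integral>t. h t \<partial>lborel) / pi" if "S \<ge> 0" for S :: real
    proof -
      let ?J = "\<lambda>H t. indicator {-S<..<S} t *\<^sub>R (?k a t * char H t)"
      have "?I S ?F - ?I S ?G = 1 / (2 * pi) * ((CLBINT t. ?J ?F t) - (CLBINT t. ?J ?G t))"
        using that
        by (simp add: interval_lebesgue_integral_def set_lebesgue_integral_def right_diff_distrib)
      also have "(CLBINT t. ?J ?F t) - (CLBINT t. ?J ?G t) = (CLBINT t. ?J ?F t - ?J ?G t)"
        using k_int[OF \<open>a < b\<close> that F'.real_distribution_axioms] k_int[OF \<open>a < b\<close> that G'.real_distribution_axioms]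
        by (rule Bochner_Integration.integral_diff[symmetric])
      finally have eq: "cmod (?I S ?F - ?I S ?G) = 1 / (2 * pi) * cmod (CLBINT t. ?J ?F t - ?J ?G t)"
        by (simp add: norm_mult norm_divide)
      have "cmod (CLBINT t. ?J ?F t - ?J ?G t) \<le> (\<integral>t. 2 * h t \<partial>lborel)"
      proof (rule Bochner_Integration.integral_norm_bound_integral)
        show "integrable lborel (\<lambda>t. ?J ?F t - ?J ?G t)"
          using k_int[OF \<open>a < b\<close> that F'.real_distribution_axioms] k_int[OF \<open>a < b\<close> that G'.real_distribution_axioms]
          by (rule Bochner_Integration.integrable_diff)
        show "integrable lborel (\<lambda>t. 2 * h t)"
          using h by simp
        fix t
        let ?w = "max 0 (1 - \<bar>t / T\<bar>)"
        show "cmod (?J ?F t - ?J ?G t) \<le> 2 * h t"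
        \<comment> \<open>At 0 the kernel is 0 by division by zero, and beyond T the triangle factor
          is 0.\<close>
        proof (cases "t = 0 \<or> \<bar>t\<bar> > T")
          case True
          have "?w = 0" if "\<bar>t\<bar> > T" using that T by (auto simp: max_def abs_if field_simps split: if_splits)
          then have "?J ?F t = 0" "?J ?G t = 0"
            using True by (auto simp: char_fejer_smooth[OF F T] char_fejer_smooth[OF G T])
          then show ?thesis using h(2)[of t] by (simp only: diff_zero norm_zero mult_nonneg_nonneg zero_le_numeral)
        next
          case False
          have "?J ?F t - ?J ?G t = indicator {-S<..<S} t *\<^sub>R (?k a t * (?w * (char F t - char G t)))"
            by (simp add: char_fejer_smooth[OF F T] char_fejer_smooth[OF G T] algebra_simps)
          also have "cmod \<dots> \<le> cmod (?k a t) * (\<bar>?w\<bar> * cmod (char F t - char G t))"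
            by (rule norm_indicator_mult_le)
          also have "\<dots> \<le> (2 / \<bar>t\<bar>) * (1 * (\<bar>t\<bar> * h t))"
          proof (intro mult_mono)
            have "cmod (iexp (-(t * a)) - iexp (-(t * b))) \<le> 1 + 1"
              by (rule order_trans[OF norm_triangle_ineq4]) simp
            then show "cmod (?k a t) \<le> 2 / \<bar>t\<bar>"
              using False by (auto simp: norm_divide norm_mult intro!: divide_right_mono)
            show "\<bar>?w\<bar> \<le> 1" by (simp add: max_def)
            show "cmod (char F t - char G t) \<le> \<bar>t\<bar> * h t"
              using bound False by simp
          qed (use h in \<open>auto intro!: mult_nonneg_nonneg\<close>)
          also have "\<dots> = 2 * h t" using False by simp
          finally show ?thesis .
        qed
      qed
      then have "1 / (2 * pi) * cmod (CLBINT t. ?J ?F t - ?J ?G t) \<le> 1 / (2 * pi) * (\<integral>t. 2 * h t \<partial>lborel)"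
        by (rule mult_left_mono) simp
      then show ?thesis unfolding eq by simp
    qed
    then have "cmod (of_real (measure ?F {a<..b}) - of_real (measure ?G {a<..b})) \<le> (\<integral>t. h t \<partial>lborel) / pi"
      by (intro LIMSEQ_le_const2[OF tendsto_norm[OF lim]]) auto
    then show ?thesis
      unfolding of_real_diff[symmetric] norm_of_real .
  qed
  \<comment> \<open>The interval bound is free of a, so letting a tend to minus infinity turns
    interval masses into distribution functions.\<close>
  have lim: "((\<lambda>a. \<bar>(cdf ?F b - cdf ?F a) - (cdf ?G b - cdf ?G a)\<bar>) \<longlongrightarrow> \<bar>(cdf ?F b - 0) - (cdf ?G b - 0)\<bar>) at_bot"
    by (intro tendsto_rabs tendsto_diff tendsto_const F'.cdf_lim_at_bot G'.cdf_lim_at_bot)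
  have "\<forall>\<^sub>F a in at_bot. \<bar>(cdf ?F b - cdf ?F a) - (cdf ?G b - cdf ?G a)\<bar> \<le> (\<integral>t. h t \<partial>lborel) / pi"
    using eventually_gt_at_bot[of b]
    by (rule eventually_mono) (metis main F'.cdf_diff_eq G'.cdf_diff_eq)
  from tendsto_upperbound[OF lim this] show ?thesis by simp
qed

text \<open>The supremum \<delta> of the difference reappears on the right only through the Fejer
  mass far from 0. Once that mass is small, \<delta> can be absorbed into the left side.\<close>

lemma esseen_smoothing:
  fixes L B :: real
  assumes F: "real_distribution F" and G: "real_distribution G" and T: "T > 0"
    and lip: "\<And>x y. x \<le> y \<Longrightarrow> cdf G y - cdf G x \<le> L * (y - x)"
    and B: "\<And>b. \<bar>cdf (fejer_smooth T F) b - cdf (fejer_smooth T G) b\<bar> \<le> B"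
  shows "\<bar>cdf F x - cdf G x\<bar> \<le> 2 * B + 64 * L / T"
proof -
  interpret F: real_distribution F by (rule F)
  interpret G: real_distribution G by (rule G)
  interpret K: real_distribution fejer by (rule real_distribution_fejer)
  let ?D = "\<lambda>x. cdf F x - cdf G x"
  define \<delta> where "\<delta> = (SUP x. \<bar>?D x\<bar>)"
  have D1: "\<bar>?D x\<bar> \<le> 1" for x
    using F.cdf_nonneg[of x] F.cdf_bounded_prob[of x] G.cdf_nonneg[of x] G.cdf_bounded_prob[of x] by linarith
  have bdd: "bdd_above (range (\<lambda>x. \<bar>?D x\<bar>))"
    by (rule bdd_aboveI2[of _ _ 1]) (rule D1)
  have D\<delta>: "\<bar>?D x\<bar> \<le> \<delta>" for x
    unfolding \<delta>_def by (rule cSUP_upper[OF _ bdd]) simp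
  have L0: "L \<ge> 0" using lip[of 0 1] G.cdf_nondecreasing[of 0 1] by simp
  \<comment> \<open>The cutoff 16 makes the outer mass at most 4 / (16 pi), below 1/8. The integrand
    errs there by at most 2 \<delta>, so the loss is at most \<delta> / 4.\<close>
  define p where "p = measure fejer {x. \<bar>x\<bar> > 16}"
  have p: "0 \<le> p" "p \<le> 1/8"
  proof -
    have "p \<le> 4 / (pi * 16)" unfolding p_def by (rule fejer_tail) simp
    also have "\<dots> \<le> 1/8" using pi_gt3 by (simp add: field_simps)
    finally show "p \<le> 1/8" .
  qed (simp add: p_def)
  have [measurable]: "cdf F \<in> borel_measurable borel" "cdf G \<in> borel_measurable borel"
    by (auto intro!: borel_measurable_mono monoI F.cdf_nondecreasing G.cdf_nondecreasing)
  have Fint: "integrable fejer (\<lambda>y. cdf F (b - y / T))" for b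
    using F.cdf_nonneg F.cdf_bounded_prob by (intro K.integrable_const_bound[of _ 1]) auto
  have Gint: "integrable fejer (\<lambda>y. cdf G (b - y / T))" for b
    using G.cdf_nonneg G.cdf_bounded_prob by (intro K.integrable_const_bound[of _ 1]) auto
  have diff: "cdf (fejer_smooth T F) b - cdf (fejer_smooth T G) b = (\<integral>y. ?D (b - y / T) \<partial>fejer)" for b
    using Fint Gint by (simp add: cdf_fejer_smooth[OF F T] cdf_fejer_smooth[OF G T])
  \<comment> \<open>The largest change of G over the window of length 32 / T that is reached when
    the Fejer variable stays within 16.\<close>
  define E where "E = 2 * (16 / T) * L"
  have E0: "0 \<le> E" using L0 T by (simp add: E_def)
  have ind_int: "integrable fejer (\<lambda>y. c - d * indicator {x. \<bar>x\<bar> > 16} y)" 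
    and ind_val: "(\<integral>y. c - d * indicator {x. \<bar>x\<bar> > 16} y \<partial>fejer) = c - d * p" for c d :: real
  proof -
    have i: "integrable fejer (\<lambda>y. indicator {x. \<bar>x\<bar> > 16} y :: real)"
      by (intro K.integrable_const_bound[of _ 1]) auto
    then show "integrable fejer (\<lambda>y. c - d * indicator {x. \<bar>x\<bar> > 16} y)" by simp
    show "(\<integral>y. c - d * indicator {x. \<bar>x\<bar> > 16} y \<partial>fejer) = c - d * p"
      using i K.prob_space by (simp add: p_def)
  qed
  \<comment> \<open>If \<open>F - G\<close> is large at \<open>x\<close>, monotonicity of \<open>F\<close> keeps it large on an interval to the right
      of \<open>x\<close>, whose midpoint is where the smoothed difference is evaluated; \<open>lo\<close> mirrors this.\<close>
  have up: "?D x \<le> B + E + \<delta> / 4" for x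
  proof -
    let ?b = "x + 16 / T"
    have "(?D x - E) - (?D x - E + \<delta>) * p = (\<integral>y. (?D x - E) - (?D x - E + \<delta>) * indicator {x. \<bar>x\<bar> > 16} y \<partial>fejer)"
      by (simp only: ind_val)
    also have "\<dots> \<le> (\<integral>y. ?D (?b - y / T) \<partial>fejer)"
    proof (rule integral_mono)
      fix y :: real
      show "(?D x - E) - (?D x - E + \<delta>) * indicator {x. \<bar>x\<bar> > 16} y \<le> ?D (?b - y / T)"
      proof (cases "\<bar>y\<bar> \<le> 16")
        case True
        then have yT: "y / T \<le> 16 / T" "- (16 / T) \<le> y / T"
          using T divide_right_mono[of y 16 T] divide_right_mono[of "-16" y T] by auto
        then have "x \<le> ?b - y / T" "?b - y / T \<le> x + 2 * (16 / T)"
          using yT by linarith+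
        moreover from this have "L * (?b - y / T - x) \<le> E"
          unfolding E_def mult.commute[of _ L] using L0 by (intro mult_left_mono) linarith+
        moreover have ind: "indicator {x. \<bar>x\<bar> > 16} y = (0 :: real)"
          using True by simp
        ultimately show ?thesis
          unfolding ind mult_zero_right using F.cdf_nondecreasing[of x "?b - y / T"] lip[of x "?b - y / T"]
          by linarith
      next
        case False
        then have ind: "indicator {x. \<bar>x\<bar> > 16} y = (1 :: real)"
          by simp
        show ?thesis unfolding ind mult_1_right using abs_le_D1[OF D\<delta>[of "?b - y / T"]] abs_le_D2[OF D\<delta>[of "?b - y / T"]]
          by linarith
      qed
    qed (use Fint Gint ind_int in \<open>auto intro!: Bochner_Integration.integrable_diff\<close>)
    also have "\<dots> \<le> B" using B[of ?b] by (simp add: diff)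
    finally have "(?D x - E) \<le> B + (?D x - E + \<delta>) * p" by simp
    also have "(?D x - E + \<delta>) * p \<le> (2 * \<delta>) * p"
      using abs_le_D1[OF D\<delta>[of x]] abs_le_D2[OF D\<delta>[of x]] p E0 by (intro mult_right_mono) linarith+
    also have "\<dots> \<le> 2 * \<delta> * (1/8)"
      using p D\<delta>[of x] by (intro mult_left_mono) auto
    finally show ?thesis by simp
  qed
  have lo: "- ?D x \<le> B + E + \<delta> / 4" for x
  proof -
    let ?b = "x - 16 / T"
    have "- B \<le> (\<integral>y. ?D (?b - y / T) \<partial>fejer)" using B[of ?b] by (simp add: diff)
    also have "\<dots> \<le> (\<integral>y. (?D x + E) - (?D x + E - \<delta>) * indicator {x. \<bar>x\<bar> > 16} y \<partial>fejer)"
    proof (rule integral_mono)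
      fix y :: real
      show "?D (?b - y / T) \<le> (?D x + E) - (?D x + E - \<delta>) * indicator {x. \<bar>x\<bar> > 16} y"
      proof (cases "\<bar>y\<bar> \<le> 16")
        case True
        then have yT: "y / T \<le> 16 / T" "- (16 / T) \<le> y / T"
          using T divide_right_mono[of y 16 T] divide_right_mono[of "-16" y T] by auto
        then have "?b - y / T \<le> x" "x - 2 * (16 / T) \<le> ?b - y / T"
          using yT by linarith+
        moreover from this have "L * (x - (?b - y / T)) \<le> E"
          unfolding E_def mult.commute[of _ L] using L0 by (intro mult_left_mono) linarith+
        moreover have ind: "indicator {x. \<bar>x\<bar> > 16} y = (0 :: real)"
          using True by simp
        ultimately show ?thesis
          unfolding ind mult_zero_right using F.cdf_nondecreasing[of "?b - y / T" x] lip[of "?b - y / T" x]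
          by linarith
      next
        case False
        then have ind: "indicator {x. \<bar>x\<bar> > 16} y = (1 :: real)"
          by simp
        show ?thesis unfolding ind mult_1_right using abs_le_D1[OF D\<delta>[of "?b - y / T"]] abs_le_D2[OF D\<delta>[of "?b - y / T"]]
          by linarith
      qed
    qed (use Fint Gint ind_int in \<open>auto intro!: Bochner_Integration.integrable_diff\<close>)
    also have "\<dots> = (?D x + E) - (?D x + E - \<delta>) * p"
      by (simp only: ind_val)
    finally have "- ?D x \<le> B + E + (\<delta> - ?D x - E) * p" by (simp add: algebra_simps)
    also have "(\<delta> - ?D x - E) * p \<le> (2 * \<delta>) * p"
      using abs_le_D1[OF D\<delta>[of x]] abs_le_D2[OF D\<delta>[of x]] p E0 by (intro mult_right_mono) linarith+
    also have "\<dots> \<le> 2 * \<delta> * (1/8)"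
      using p D\<delta>[of x] by (intro mult_left_mono) auto
    finally show ?thesis by simp
  qed
  have "\<delta> \<le> B + E + \<delta> / 4"
  proof -
    have "(SUP x. \<bar>?D x\<bar>) \<le> B + E + \<delta> / 4"
      by (rule cSUP_least) (use up lo in \<open>auto simp only: abs_le_iff UNIV_not_empty\<close>)
    then show ?thesis by (simp only: \<delta>_def[symmetric])
  qed
  \<comment> \<open>Solving gives \<delta> at most 4/3 (B + E), rounded up to 2 B + 2 E; this is
    where the constants 2 and 64 come from.\<close>
  moreover have "0 \<le> B" using B[of 0] by linarith
  ultimately have "\<delta> \<le> 2 * B + 2 * E" using E0 by linarith
  moreover have "2 * E = 64 * L / T" by (simp add: E_def)
  ultimately show ?thesis using D\<delta>[of x] by linarith
qed

section \<open>Berry-Esseen bound with truncated third moment\<close>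

lemma std_normal_cdf_diff:
  assumes "x \<le> y"
  shows "ennreal (cdf std_normal_distribution y - cdf std_normal_distribution x)
    = (\<integral>\<^sup>+t. ennreal (std_normal_density t) * indicator {x<..y} t \<partial>lborel)"
proof -
  interpret N: real_distribution std_normal_distribution by (rule real_dist_normal_dist)
  show ?thesis
  proof (cases "x = y")
    case False
    then have "cdf std_normal_distribution y - cdf std_normal_distribution x = measure std_normal_distribution {x<..y}"
      using assms by (intro N.cdf_diff_eq) simp
    also have "ennreal \<dots> = (\<integral>\<^sup>+t. ennreal (std_normal_density t) * indicator {x<..y} t \<partial>lborel)"
      unfolding N.emeasure_eq_measure[symmetric] by (subst emeasure_density) auto
    finally show ?thesis .
  qed simp
qed

lemma std_normal_cdf_lipschitz:
  assumes "x \<le> y"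
  shows "cdf std_normal_distribution y - cdf std_normal_distribution x \<le> 1 / sqrt (2 * pi) * (y - x)"
proof -
  have "ennreal (cdf std_normal_distribution y - cdf std_normal_distribution x)
      = (\<integral>\<^sup>+t. ennreal (std_normal_density t) * indicator {x<..y} t \<partial>lborel)"
    by (rule std_normal_cdf_diff[OF assms])
  also have "\<dots> \<le> (\<integral>\<^sup>+t. ennreal (1 / sqrt (2 * pi)) * indicator {x<..y} t \<partial>lborel)"
    by (intro nn_integral_mono mult_right_mono ennreal_leI)
      (auto simp: std_normal_density_def intro!: divide_right_mono)
  also have "\<dots> = ennreal (1 / sqrt (2 * pi)) * ennreal (y - x)"
    using assms by (simp add: nn_integral_cmult_indicator)
  also have "\<dots> = ennreal (1 / sqrt (2 * pi) * (y - x))"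
    using assms by (intro ennreal_mult[symmetric]) auto
  finally show ?thesis
    using assms by (subst (asm) ennreal_le_iff) auto
qed

text \<open>Dividing by c reduces to the unit disc. The gain c^(n - 1), written
  \<open>c ^ n / c\<close> to avoid subtraction on naturals, preserves Gaussian decay when both
  factors are below exp (- u / 4).\<close>

lemma norm_power_diff_le:
  fixes a b :: "'a :: real_normed_field"
  assumes "norm a \<le> c" "norm b \<le> c" "c > 0"
  shows "norm (a ^ n - b ^ n) \<le> n * c ^ n / c * norm (a - b)"
proof -
  have "norm ((a / of_real c) ^ n - (b / of_real c) ^ n) \<le> n * norm (a / of_real c - b / of_real c)"
    using assms by (intro norm_power_diff) (auto simp: norm_divide)
  also have "(a / of_real c) ^ n - (b / of_real c) ^ n = (a ^ n - b ^ n) / of_real (c ^ n)"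
    by (simp add: power_divide diff_divide_distrib)
  also have "a / of_real c - b / of_real c = (a - b) / of_real c"
    by (simp add: diff_divide_distrib)
  finally show ?thesis
    using assms by (simp add: norm_divide norm_power field_simps)
qed

lemma exp_minus_quadratic:
  assumes "u \<ge> (0 :: real)"
  shows "\<bar>exp (- u) - (1 - u)\<bar> \<le> u\<^sup>2"
proof -
  have "1 - u \<le> exp (- u)" using exp_ge_add_one_self[of "-u"] by simp
  moreover have "exp (- u) \<le> 1 / (1 + u)"
    using exp_ge_add_one_self[of u] assms by (simp add: exp_minus field_simps)
  moreover have "1 / (1 + u) \<le> 1 - u + u\<^sup>2"
    using assms by (simp add: field_simps power2_eq_square)
  ultimately show ?thesis by simp
qed

text \<open>The function g(n) of the theorem, as a functional of the law of a standardized
  observation.\<close>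

definition trunc_moment :: "real measure \<Rightarrow> nat \<Rightarrow> real" where
  "trunc_moment \<mu> n = (1 / sqrt (real n)) * (\<integral>x. x\<^sup>2 * min \<bar>x\<bar> (sqrt (real n)) \<partial>\<mu>)"

locale standardized_distribution = real_distribution \<mu> for \<mu> :: "real measure" +
  assumes sq_integrable: "integrable \<mu> (\<lambda>x. x\<^sup>2)"
    and mean0: "(\<integral>x. x \<partial>\<mu>) = 0"
    and var1: "(\<integral>x. x\<^sup>2 \<partial>\<mu>) = 1"
begin

lemma id_integrable: "integrable \<mu> (\<lambda>x. x)"
  by (rule square_integrable_imp_integrable[OF _ sq_integrable]) simp

lemma trunc_integrable: "integrable \<mu> (\<lambda>x. x\<^sup>2 * min \<bar>x\<bar> c)" if "c \<ge> 0"
proof (rule Bochner_Integration.integrable_bound)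
  show "integrable \<mu> (\<lambda>x. c * x\<^sup>2)" using sq_integrable by simp
  show "AE x in \<mu>. norm (x\<^sup>2 * min \<bar>x\<bar> c) \<le> norm (c * x\<^sup>2)"
    using that by (intro AE_I2) (auto simp: abs_mult mult.commute[of c] intro!: mult_left_mono)
qed simp

lemma trunc_moment_nonneg: "0 \<le> trunc_moment \<mu> n"
  unfolding trunc_moment_def by (intro mult_nonneg_nonneg Bochner_Integration.integral_nonneg) auto

text \<open>The pointwise minorant (x^2 - 1/4) / 2 has mean 3/8. The bound says that the rate is
  never faster than 1 / sqrt n, so that errors of order 1 / n are dominated and a frequency below 1
  / (2 g) is of order at most sqrt n.\<close>

lemma trunc_moment_ge:
  assumes "n \<ge> 1"
  shows "3 / (8 * sqrt (real n)) \<le> trunc_moment \<mu> n"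
proof -
  have "(\<integral>x. (x\<^sup>2 - 1 / 4) / 2 \<partial>\<mu>) \<le> (\<integral>x. x\<^sup>2 * min \<bar>x\<bar> (sqrt (real n)) \<partial>\<mu>)"
  proof (rule integral_mono)
    fix x :: real
    have n: "sqrt (real n) \<ge> 1" using assms by simp
    show "(x\<^sup>2 - 1 / 4) / 2 \<le> x\<^sup>2 * min \<bar>x\<bar> (sqrt (real n))"
    proof (cases "\<bar>x\<bar> \<ge> 1 / 2")
      case True
      then have "x\<^sup>2 * (1 / 2) \<le> x\<^sup>2 * min \<bar>x\<bar> (sqrt (real n))"
        using n True by (intro mult_left_mono) (linarith, simp)
      then show ?thesis by simp
    next
      case False
      then have "x\<^sup>2 \<le> (1 / 2)\<^sup>2" by (subst abs_le_square_iff[symmetric]) simp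
      then have "x\<^sup>2 \<le> 1 / 4" by (simp add: power2_eq_square)
      then have "(x\<^sup>2 - 1 / 4) / 2 \<le> 0" by simp
      also have "0 \<le> x\<^sup>2 * min \<bar>x\<bar> (sqrt (real n))" using n by (intro mult_nonneg_nonneg) auto
      finally show ?thesis .
    qed
  qed (use sq_integrable trunc_integrable in auto)
  also have "(\<integral>x. (x\<^sup>2 - 1 / 4) / 2 \<partial>\<mu>) = 3 / 8"
    using sq_integrable var1 prob_space by simp
  finally have "3 / 8 / sqrt n \<le> (\<integral>x. x\<^sup>2 * min \<bar>x\<bar> (sqrt (real n)) \<partial>\<mu>) / sqrt n"
    by (rule divide_right_mono) simp
  then show ?thesis by (simp add: trunc_moment_def)
qed

text \<open>The Taylor remainder is the smaller of a quadratic and a cubic term. Taking the cubic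
  one for |x| up to sqrt n and the quadratic one beyond produces exactly the truncated third
  moment.\<close>

lemma char_quadratic_approx:
  assumes "n \<ge> 1"
  shows "cmod (char \<mu> (t / sqrt n) - (1 - t\<^sup>2 / n / 2)) \<le> t\<^sup>2 / n * (1 + \<bar>t\<bar> / 6) * trunc_moment \<mu> n"
proof -
  let ?s = "t / sqrt (real n)"
  have n: "sqrt (real n) > 0" using assms by simp
  have "cmod (char \<mu> ?s - (1 - ?s\<^sup>2 * 1 / 2)) \<le> (?s\<^sup>2 / 6) * (\<integral>x. min (6 * x\<^sup>2) (\<bar>?s\<bar> * \<bar>x\<bar> ^ 3) \<partial>\<mu>)"
    using char_approx3[of 1 ?s] id_integrable sq_integrable mean0 var1 by simp
  also have "\<dots> \<le> (?s\<^sup>2 / 6) * ((6 + \<bar>t\<bar>) * trunc_moment \<mu> n)"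
  proof (rule mult_left_mono)
    have "(\<integral>x. min (6 * x\<^sup>2) (\<bar>?s\<bar> * \<bar>x\<bar> ^ 3) \<partial>\<mu>)
        \<le> (\<integral>x. (6 + \<bar>t\<bar>) / sqrt n * (x\<^sup>2 * min \<bar>x\<bar> (sqrt n)) \<partial>\<mu>)"
    proof (rule integral_mono)
      show "integrable \<mu> (\<lambda>x. min (6 * x\<^sup>2) (\<bar>?s\<bar> * \<bar>x\<bar> ^ 3))"
        by (rule Bochner_Integration.integrable_bound[of _ "\<lambda>x. 6 * x\<^sup>2"]) (use sq_integrable in auto)
      show "integrable \<mu> (\<lambda>x. (6 + \<bar>t\<bar>) / sqrt n * (x\<^sup>2 * min \<bar>x\<bar> (sqrt n)))"
        using trunc_integrable by simp
      fix x :: real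
      show "min (6 * x\<^sup>2) (\<bar>?s\<bar> * \<bar>x\<bar> ^ 3) \<le> (6 + \<bar>t\<bar>) / sqrt n * (x\<^sup>2 * min \<bar>x\<bar> (sqrt n))"
      proof (cases "\<bar>x\<bar> \<le> sqrt n")
        case True
        have "\<bar>?s\<bar> * \<bar>x\<bar> ^ 3 = \<bar>t\<bar> / sqrt n * (x\<^sup>2 * \<bar>x\<bar>)"
          using n by (simp add: power3_eq_cube power2_eq_square)
        also have "\<dots> \<le> (6 + \<bar>t\<bar>) / sqrt n * (x\<^sup>2 * \<bar>x\<bar>)"
          using n by (intro mult_right_mono divide_right_mono) auto
        finally have "\<bar>?s\<bar> * \<bar>x\<bar> ^ 3 \<le> (6 + \<bar>t\<bar>) / sqrt n * (x\<^sup>2 * min \<bar>x\<bar> (sqrt n))"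
          using True by (simp only: min_absorb1)
        then show ?thesis by (rule order_trans[OF min.cobounded2])
      next
        case False
        have "6 * x\<^sup>2 \<le> (6 + \<bar>t\<bar>) * x\<^sup>2" by (intro mult_right_mono) auto
        also have "\<dots> = (6 + \<bar>t\<bar>) / sqrt n * (x\<^sup>2 * sqrt n)" using n by simp
        finally have "6 * x\<^sup>2 \<le> (6 + \<bar>t\<bar>) / sqrt n * (x\<^sup>2 * min \<bar>x\<bar> (sqrt n))"
          using False by (simp add: min_absorb2)
        then show ?thesis by (rule order_trans[OF min.cobounded1])
      qed
    qed
    also have "\<dots> = (6 + \<bar>t\<bar>) * trunc_moment \<mu> n"
      by (simp add: trunc_moment_def)
    finally show "(\<integral>x. min (6 * x\<^sup>2) (\<bar>?s\<bar> * \<bar>x\<bar> ^ 3) \<partial>\<mu>) \<le> (6 + \<bar>t\<bar>) * trunc_moment \<mu> n" .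
  qed simp
  also have "\<dots> = t\<^sup>2 / n * (1 + \<bar>t\<bar> / 6) * trunc_moment \<mu> n"
    by (simp add: power_divide field_simps)
  finally show ?thesis by (simp add: power_divide)
qed

text \<open>The range of t is chosen so that the Taylor error is at most a quarter of u = t^2 / n.
  Then the characteristic function is at most exp (- u / 4), and the n-th power keeps the integrable
  factor exp (- t^2 / 4).\<close>

lemma char_power_diff_le:
  assumes n: "n \<ge> 1" and G: "trunc_moment \<mu> n \<le> 1 / 8"
    and t: "\<bar>t\<bar> \<le> 1 / (2 * trunc_moment \<mu> n)"
  shows "cmod (char \<mu> (t / sqrt n) ^ n - of_real (exp (- t\<^sup>2 / 2)))
    \<le> \<bar>t\<bar> * (trunc_moment \<mu> n * (2 * exp (- t\<^sup>2 / 4) * (\<bar>t\<bar> + \<bar>t\<bar>\<^sup>2 + \<bar>t\<bar> ^ 3)))"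
proof -
  define g where "g = trunc_moment \<mu> n"
  define u where "u = t\<^sup>2 / n"
  let ?a = "char \<mu> (t / sqrt n)" and ?b = "complex_of_real (exp (- u / 2))"
  have gge: "3 / (8 * sqrt n) \<le> g" unfolding g_def by (rule trunc_moment_ge[OF n])
  have n0: "sqrt (real n) > 0" using n by simp
  have g0: "g > 0" using gge n0 by (smt (verit) divide_pos_pos mult_pos_pos)
  have inv_g: "1 / (2 * g) \<le> 4 / 3 * sqrt n"
    using gge g0 n0 by (simp add: field_simps)
  \<comment> \<open>Absorbs the second-order error of replacing 1 - u / 2 by an exponential, which
    is of order t^4 / n after multiplication by n.\<close>
  have inv_n: "1 / real n \<le> g"
  proof -
    have "1 / sqrt n \<le> 8 / 3 * g" using gge n0 by (simp add: field_simps)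
    then have "(1 / sqrt n)\<^sup>2 \<le> (8 / 3 * g)\<^sup>2" using n0 by (intro power_mono) auto
    also have "\<dots> = (64 / 9 * g) * g" by (simp add: power2_eq_square)
    also have "\<dots> \<le> 1 * g" using G g0 by (intro mult_right_mono) (auto simp: g_def)
    finally show ?thesis by (simp add: power_divide)
  qed
  have u0: "u \<ge> 0" by (simp add: u_def)
  \<comment> \<open>Any bound below 2 makes 1 - u / 2 nonnegative, so that it equals its norm; it
    also keeps exp (u / 4) below exp (1 / 2).\<close>
  have u2: "u \<le> 16 / 9"
  proof -
    have "\<bar>t\<bar> \<le> 4 / 3 * sqrt n" using t inv_g by (simp add: g_def)
    then have "\<bar>t\<bar>\<^sup>2 \<le> (4 / 3 * sqrt n)\<^sup>2" by (intro power_mono) auto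
    then show ?thesis using n by (simp add: u_def power_mult_distrib field_simps)
  qed
  have r: "1 - complex_of_real u / 2 = of_real (1 - u / 2)" by simp
  have approx: "cmod (?a - (1 - u / 2)) \<le> u * (1 + \<bar>t\<bar> / 6) * g"
    using char_quadratic_approx[OF n, of t] by (simp add: u_def g_def)
  \<comment> \<open>The two parts are at most 1/8 and 1/12.\<close>
  have small: "(1 + \<bar>t\<bar> / 6) * g \<le> 1 / 4"
  proof -
    have "\<bar>t\<bar> * g \<le> 1 / 2" using t g0 by (simp add: g_def field_simps)
    then show ?thesis using G by (simp add: g_def algebra_simps)
  qed
  have a_le: "cmod ?a \<le> exp (- u / 4)"
  proof -
    have "cmod ?a \<le> cmod (1 - u / 2) + cmod (?a - (1 - u / 2))"
      by (rule norm_triangle_sub)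
    moreover have "cmod (1 - u / 2) = 1 - u / 2"
      using u2 unfolding r norm_of_real by simp
    moreover have "cmod (?a - (1 - u / 2)) \<le> u * (1 / 4)"
      using approx mult_left_mono[OF small u0] unfolding mult.assoc by linarith
    moreover have "1 - u / 4 \<le> exp (- u / 4)"
      using exp_ge_add_one_self[of "- u / 4"] by simp
    ultimately show ?thesis by linarith
  qed
  have b_le: "cmod ?b \<le> exp (- u / 4)" using u0 by simp
  have ab: "cmod (?a - ?b) \<le> u * (1 + \<bar>t\<bar> / 6) * g + (u / 2)\<^sup>2"
  proof -
    have "cmod ((?a - (1 - u / 2)) - (?b - (1 - u / 2))) \<le> cmod (?a - (1 - u / 2)) + cmod (?b - (1 - u / 2))"
      by (rule norm_triangle_ineq4)
    moreover have "cmod (?b - (1 - u / 2)) = \<bar>exp (- (u / 2)) - (1 - u / 2)\<bar>"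
      unfolding r of_real_diff[symmetric] norm_of_real by simp
    moreover have "\<bar>exp (- (u / 2)) - (1 - u / 2)\<bar> \<le> (u / 2)\<^sup>2"
      using u0 by (intro exp_minus_quadratic) simp
    ultimately show ?thesis using approx by simp
  qed
  have nu: "real n * u = t\<^sup>2" using n by (simp add: u_def)
  have b_pow: "?b ^ n = of_real (exp (- t\<^sup>2 / 2))"
    using nu by (simp add: exp_of_nat_mult[symmetric] flip: of_real_power)
  have c_pow: "exp (- u / 4) ^ n = exp (- t\<^sup>2 / 4)"
    using nu by (simp add: exp_of_nat_mult[symmetric])
  have "cmod (?a ^ n - ?b ^ n) \<le> n * exp (- u / 4) ^ n / exp (- u / 4) * cmod (?a - ?b)"
    by (rule norm_power_diff_le[OF a_le b_le]) simp
  \<comment> \<open>The power difference retains only n - 1 factors; restoring the missing one costs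
    exp (u / 4), which is at most 2.\<close>
  also have "\<dots> = exp (- t\<^sup>2 / 4) * exp (u / 4) * (n * cmod (?a - ?b))"
    unfolding c_pow by (simp add: exp_minus field_simps)
  also have "\<dots> \<le> exp (- t\<^sup>2 / 4) * 2 * (\<bar>t\<bar> * (g * (\<bar>t\<bar> + \<bar>t\<bar>\<^sup>2 + \<bar>t\<bar> ^ 3)))"
  proof (rule mult_mono[OF mult_left_mono])
    have "exp (u / 4) \<le> exp (1 / 2)" using u2 by simp
    also have "\<dots> \<le> (2 :: real)"
      using exp_half_le2 by simp
    finally show "exp (u / 4) \<le> 2" .
    have "n * cmod (?a - ?b) \<le> n * (u * (1 + \<bar>t\<bar> / 6) * g + (u / 2)\<^sup>2)"
      using ab by (intro mult_left_mono) auto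
    also have "\<dots> = n * u * ((1 + \<bar>t\<bar> / 6) * g) + n * u * (n * u) * (1 / 4) * (1 / n)"
      using n by (simp add: field_simps power2_eq_square)
    also have "\<dots> = t\<^sup>2 * ((1 + \<bar>t\<bar> / 6) * g) + t\<^sup>2 * t\<^sup>2 * (1 / 4) * (1 / n)"
      by (simp only: nu)
    also have "\<dots> \<le> t\<^sup>2 * ((1 + \<bar>t\<bar>) * g) + t\<^sup>2 * t\<^sup>2 * 1 * g"
      using g0 inv_n by (intro add_mono mult_mono) auto
    also have "\<dots> = \<bar>t\<bar> * (g * (\<bar>t\<bar> + \<bar>t\<bar>\<^sup>2 + \<bar>t\<bar> ^ 3))"
    proof -
      have "t\<^sup>2 = \<bar>t\<bar> * \<bar>t\<bar>" by (simp add: power2_eq_square)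
      then show ?thesis by (simp add: algebra_simps power2_eq_square power3_eq_cube)
    qed
    finally show "n * cmod (?a - ?b) \<le> \<bar>t\<bar> * (g * (\<bar>t\<bar> + \<bar>t\<bar>\<^sup>2 + \<bar>t\<bar> ^ 3))" .
  qed auto
  finally show ?thesis unfolding b_pow by (simp add: g_def mult_ac)
qed

end

lemma integrable_exp_times_powers:
  "integrable lborel (\<lambda>t::real. 2 * exp (- t\<^sup>2 / 4) * (\<bar>t\<bar> + \<bar>t\<bar>\<^sup>2 + \<bar>t\<bar> ^ 3))"
proof -
  have i: "integrable lborel (\<lambda>t::real. exp (- t\<^sup>2 / 4) * \<bar>t\<bar> ^ k)" for k
  proof -
    have "integrable lborel (\<lambda>t. sqrt (4 * pi) * (normal_density 0 (sqrt 2) t * \<bar>t - 0\<bar> ^ k))"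
      by (intro integrable_mult_right integrable_normal_moment_abs) simp
    then show ?thesis by (simp add: normal_density_def)
  qed
  have "integrable lborel (\<lambda>t::real. 2 * (exp (- t\<^sup>2 / 4) * \<bar>t\<bar> ^ 1 + exp (- t\<^sup>2 / 4) * \<bar>t\<bar> ^ 2 + exp (- t\<^sup>2 / 4) * \<bar>t\<bar> ^ 3))"
    by (intro integrable_mult_right Bochner_Integration.integrable_add i)
  then show ?thesis by (simp add: distrib_left mult.assoc)
qed

text \<open>Stated through characteristic functions, so that any representation of the normalized
  sum can be plugged in, with one constant for all standardized laws.\<close>

theorem Berry_Esseen_truncated:
  obtains C :: real where "C > 0"
    and "\<And>\<mu> \<nu> n x. \<lbrakk>standardized_distribution \<mu>; n \<ge> 1; real_distribution \<nu>;
      \<And>t. char \<nu> t = char \<mu> (t / sqrt (real n)) ^ n\<rbrakk>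
      \<Longrightarrow> \<bar>cdf \<nu> x - cdf std_normal_distribution x\<bar> \<le> C * trunc_moment \<mu> n"
proof
  let ?H = "\<lambda>t::real. 2 * exp (- t\<^sup>2 / 4) * (\<bar>t\<bar> + \<bar>t\<bar>\<^sup>2 + \<bar>t\<bar> ^ 3)"
  \<comment> \<open>The summand 8 covers g above 1/8, where a difference of distribution functions
    is trivially at most 1. The other two are twice the smoothed difference and 64 L / T with L = 1
    / sqrt (2 pi) and T = 1 / (2 g), both divided by g.\<close>
  define C where "C = 8 + 2 * (integral\<^sup>L lborel ?H / pi) + 128 / sqrt (2 * pi)"
  have H0: "integral\<^sup>L lborel ?H \<ge> 0" by (intro Bochner_Integration.integral_nonneg) simp
  then show "C > 0" unfolding C_def by (intro add_pos_nonneg) auto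
  fix \<mu> \<nu> :: "real measure" and n :: nat and x :: real
  assume \<mu>: "standardized_distribution \<mu>" and n: "n \<ge> 1" and \<nu>: "real_distribution \<nu>"
    and ch: "\<And>t. char \<nu> t = char \<mu> (t / sqrt (real n)) ^ n"
  interpret \<mu>: standardized_distribution \<mu> by fact
  interpret \<nu>: real_distribution \<nu> by fact
  interpret N: real_distribution std_normal_distribution by (rule real_dist_normal_dist)
  let ?g = "trunc_moment \<mu> n"
  have "0 < 3 / (8 * sqrt (real n))" using n by simp
  with \<mu>.trunc_moment_ge[OF n] have g0: "?g > 0" by linarith
  show "\<bar>cdf \<nu> x - cdf std_normal_distribution x\<bar> \<le> C * ?g"
  proof (cases "?g \<le> 1 / 8")
    case False
    have "\<bar>cdf \<nu> x - cdf std_normal_distribution x\<bar> \<le> 8 * (1 / 8)"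
      using \<nu>.cdf_nonneg[of x] \<nu>.cdf_bounded_prob[of x] N.cdf_nonneg[of x] N.cdf_bounded_prob[of x] by linarith
    also have "\<dots> \<le> C * ?g"
      using False H0 by (intro mult_mono) (auto simp: C_def)
    finally show ?thesis .
  next
    case True
    let ?T = "1 / (2 * ?g)"
    have smooth: "\<bar>cdf (fejer_smooth ?T \<nu>) b - cdf (fejer_smooth ?T std_normal_distribution) b\<bar>
        \<le> (\<integral>t. ?g * ?H t \<partial>lborel) / pi" for b
    proof (rule fejer_smooth_cdf_diff_le[OF \<nu> real_dist_normal_dist])
      show "integrable lborel (\<lambda>t. ?g * ?H t)"
        using integrable_exp_times_powers by (rule integrable_mult_right)
      show "cmod (char \<nu> t - char std_normal_distribution t) \<le> \<bar>t\<bar> * (?g * ?H t)" if "\<bar>t\<bar> \<le> ?T" for t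
        using \<mu>.char_power_diff_le[OF n True that] by (simp add: ch char_std_normal_distribution)
    qed (use g0 in auto)
    have "\<bar>cdf \<nu> x - cdf std_normal_distribution x\<bar>
        \<le> 2 * ((\<integral>t. ?g * ?H t \<partial>lborel) / pi) + 64 * (1 / sqrt (2 * pi)) / ?T"
      by (rule esseen_smoothing[OF \<nu> real_dist_normal_dist _ std_normal_cdf_lipschitz smooth]) (use g0 in auto)
    also have "(\<integral>t. ?g * ?H t \<partial>lborel) = ?g * integral\<^sup>L lborel ?H"
      by (rule Bochner_Integration.integral_mult_right_zero)
    also have "2 * (?g * integral\<^sup>L lborel ?H / pi) + 64 * (1 / sqrt (2 * pi)) / ?T
        = (2 * (integral\<^sup>L lborel ?H / pi) + 128 / sqrt (2 * pi)) * ?g"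
      by (simp add: algebra_simps)
    also have "\<dots> \<le> C * ?g"
      unfolding C_def using g0 by (intro mult_right_mono) auto
    finally show ?thesis .
  qed
qed

section \<open>Estimates for the normal distribution function and comparison of truncated
  moments\<close>

lemma std_normal_cdf_abs_diff_le:
  "\<bar>cdf std_normal_distribution x - cdf std_normal_distribution y\<bar> \<le> 1 / sqrt (2 * pi) * \<bar>x - y\<bar>"
proof -
  interpret N: real_distribution std_normal_distribution by (rule real_dist_normal_dist)
  show ?thesis
    using std_normal_cdf_lipschitz[of x y] std_normal_cdf_lipschitz[of y x]
      N.cdf_nondecreasing[of x y] N.cdf_nondecreasing[of y x]
    by (cases "x \<le> y") auto
qed

text \<open>A small \<eta> keeps the coefficient of the main part close to 1, so that the limiting
  constant 1 / (2 pi) is not spoilt by the cross term with the Berry-Esseen error.\<close>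

lemma power2_sum_le_weighted:
  fixes u v \<eta> :: real
  assumes "\<eta> > 0"
  shows "(u + v)\<^sup>2 \<le> (1 + \<eta>) * u\<^sup>2 + (1 + 1 / \<eta>) * v\<^sup>2"
proof -
  have "0 \<le> (\<eta> * u - v)\<^sup>2 / \<eta>" using assms by simp
  also have "\<dots> = \<eta> * u\<^sup>2 - 2 * u * v + v\<^sup>2 / \<eta>"
    using assms by (simp add: power2_eq_square field_simps)
  finally show ?thesis by (simp add: power2_sum algebra_simps)
qed

context standardized_distribution
begin

lemma trunc_moment_scaled: "trunc_moment \<mu> n = (\<integral>x. x\<^sup>2 * min (\<bar>x\<bar> / sqrt n) 1 \<partial>\<mu>)" if "n \<ge> 1"
proof -
  have "1 / sqrt n * (x\<^sup>2 * min \<bar>x\<bar> (sqrt n)) = x\<^sup>2 * min (\<bar>x\<bar> / sqrt n) 1" for x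
    using that by (auto simp: min_def field_simps)
  then show ?thesis
    unfolding trunc_moment_def Bochner_Integration.integral_mult_right_zero[symmetric] by (simp only:)
qed

lemma trunc_moment_integrable: "integrable \<mu> (\<lambda>x. x\<^sup>2 * min (\<bar>x\<bar> / sqrt (real n)) 1)"
  by (rule Bochner_Integration.integrable_bound[OF sq_integrable])
    (auto intro!: AE_I2 mult_left_le simp: abs_mult)

lemma trunc_moment_antimono:
  assumes "1 \<le> n" "n \<le> m"
  shows "trunc_moment \<mu> m \<le> trunc_moment \<mu> n"
proof -
  have "(\<integral>x. x\<^sup>2 * min (\<bar>x\<bar> / sqrt m) 1 \<partial>\<mu>) \<le> (\<integral>x. x\<^sup>2 * min (\<bar>x\<bar> / sqrt n) 1 \<partial>\<mu>)"
    using assms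
    by (intro integral_mono trunc_moment_integrable mult_left_mono min.mono divide_left_mono) auto
  then show ?thesis using assms by (simp add: trunc_moment_scaled)
qed

text \<open>\<open>trunc_moment\<close> decreases in n, so sums over fewer observations have a worse
  bound. This opposite monotonicity limits the loss to the factor sqrt (m / n).\<close>

lemma sqrt_trunc_moment_mono:
  assumes "n \<le> m"
  shows "sqrt n * trunc_moment \<mu> n \<le> sqrt m * trunc_moment \<mu> m"
proof (cases "n = 0")
  case True
  then show ?thesis using trunc_moment_nonneg by simp
next
  case False
  have "(\<integral>x. x\<^sup>2 * min \<bar>x\<bar> (sqrt n) \<partial>\<mu>) \<le> (\<integral>x. x\<^sup>2 * min \<bar>x\<bar> (sqrt m) \<partial>\<mu>)"
    using assms by (intro integral_mono trunc_integrable mult_left_mono min.mono) auto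
  then show ?thesis using False assms by (simp add: trunc_moment_def)
qed

end

lemma std_normal_cdf_diff_ge:
  assumes "x \<le> y" "0 \<le> c" and c: "\<And>t. x \<le> t \<Longrightarrow> t \<le> y \<Longrightarrow> c \<le> std_normal_density t"
  shows "c * (y - x) \<le> cdf std_normal_distribution y - cdf std_normal_distribution x"
proof -
  interpret N: real_distribution std_normal_distribution by (rule real_dist_normal_dist)
  have "ennreal (c * (y - x)) = ennreal c * ennreal (y - x)"
    using assms by (intro ennreal_mult) auto
  also have "\<dots> = (\<integral>\<^sup>+t. ennreal c * indicator {x<..y} t \<partial>lborel)"
    using assms by (simp add: nn_integral_cmult_indicator)
  also have "\<dots> \<le> (\<integral>\<^sup>+t. ennreal (std_normal_density t) * indicator {x<..y} t \<partial>lborel)"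
    using c by (intro nn_integral_mono) (auto simp: indicator_def intro!: ennreal_leI)
  also have "\<dots> = ennreal (cdf std_normal_distribution y - cdf std_normal_distribution x)"
    by (rule std_normal_cdf_diff[OF assms(1), symmetric])
  finally show ?thesis
    using N.cdf_nondecreasing[OF assms(1)] by (subst (asm) ennreal_le_iff) auto
qed

lemma isCont_std_normal_cdf: "isCont (cdf std_normal_distribution) x"
proof -
  interpret N: real_distribution std_normal_distribution by (rule real_dist_normal_dist)
  have "emeasure std_normal_distribution {x} = 0"
    using AE_lborel_singleton[of x]
    by (subst emeasure_density) (auto intro!: nn_integral_0_iff_AE[THEN iffD2] elim!: eventually_mono simp: indicator_def)
  then show ?thesis by (simp add: N.isCont_cdf measure_def)
qed

lemma std_normal_cdf_0: "cdf std_normal_distribution 0 = 1 / 2"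
proof -
  interpret N: real_distribution std_normal_distribution by (rule real_dist_normal_dist)
  have "emeasure std_normal_distribution {..0} = (\<integral>\<^sup>+t. ennreal (std_normal_density t) * indicator {..0} t \<partial>lborel)"
    by (subst emeasure_density) auto
  also have "\<dots> = (\<integral>\<^sup>+t. ennreal (std_normal_density t) * indicator {0..} t \<partial>lborel)"
    using nn_integral_real_affine[of "\<lambda>t. ennreal (std_normal_density t) * indicator {..0} t" "-1" 0]
    by (simp add: std_normal_density_def indicator_def)
  also have "\<dots> = emeasure std_normal_distribution {0..}"
    by (subst emeasure_density) auto
  finally have "measure std_normal_distribution {..0} = measure std_normal_distribution {0..}"
    by (simp add: measure_def)
  moreover have "measure std_normal_distribution ({..0} \<union> {0<..}) = measure std_normal_distribution {..0} + measure std_normal_distribution {0<..}"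
    by (intro N.finite_measure_Union) auto
  moreover have "{..0} \<union> {0<..} = (UNIV :: real set)" by auto
  moreover have "measure std_normal_distribution UNIV = 1" using N.prob_space by simp
  moreover have "measure std_normal_distribution ({0} \<union> {0<..}) = measure std_normal_distribution {0} + measure std_normal_distribution {0<..}"
    by (intro N.finite_measure_Union) auto
  moreover have "{0} \<union> {0<..} = {0::real..}" by auto
  moreover have "measure std_normal_distribution {0} = 0"
    using isCont_std_normal_cdf[of 0] by (simp add: N.isCont_cdf)
  ultimately show ?thesis by (simp add: cdf_def)
qed

text \<open>Between 0 and y the density lies between 1 - y^2 and 1 times its value at 0. The cubic
  error is what survives multiplication by sqrt k when y is of order 1 / sqrt k.\<close>

lemma std_normal_cdf_linear_approx:
  "\<bar>cdf std_normal_distribution y - 1 / 2 - 1 / sqrt (2 * pi) * y\<bar> \<le> \<bar>y\<bar> ^ 3"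
proof -
  let ?f = "1 / sqrt (2 * pi)" and ?F = "cdf std_normal_distribution"
  have f: "0 < ?f" "?f \<le> 1" using pi_gt3 by (auto simp: real_le_rsqrt)
  have low: "?f * (1 - y\<^sup>2) \<le> std_normal_density t" if "\<bar>t\<bar> \<le> \<bar>y\<bar>" for t
  proof -
    have "t\<^sup>2 \<le> y\<^sup>2" using that by (simp add: abs_le_square_iff)
    then have "1 - y\<^sup>2 \<le> 1 + (- t\<^sup>2 / 2)" using zero_le_power2[of y] by linarith
    also have "\<dots> \<le> exp (- t\<^sup>2 / 2)" by (rule exp_ge_add_one_self)
    finally show ?thesis
      using f unfolding std_normal_density_def by (intro mult_left_mono) auto
  qed
  have key: "?f * \<bar>y\<bar> - \<bar>y\<bar> ^ 3 \<le> \<bar>?F y - ?F 0\<bar> \<and> \<bar>?F y - ?F 0\<bar> \<le> ?f * \<bar>y\<bar>"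
  proof
    show "\<bar>?F y - ?F 0\<bar> \<le> ?f * \<bar>y\<bar>" using std_normal_cdf_abs_diff_le[of y 0] by simp
    show "?f * \<bar>y\<bar> - \<bar>y\<bar> ^ 3 \<le> \<bar>?F y - ?F 0\<bar>"
    proof -
      \<comment> \<open>The lower bound for the density turns negative for |y| > 1, while the
        comparison of increments asks for a nonnegative constant; hence the maximum with 0.\<close>
      define c where "c = max 0 (?f * (1 - y\<^sup>2))"
      have c: "0 \<le> c" "?f * (1 - y\<^sup>2) \<le> c" by (auto simp: c_def)
      have c_le: "c \<le> std_normal_density t" if "\<bar>t\<bar> \<le> \<bar>y\<bar>" for t
        using low[OF that] by (simp add: c_def normal_density_nonneg)
      have "c * \<bar>y\<bar> \<le> \<bar>?F y - ?F 0\<bar>"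
      proof (cases "0 \<le> y")
        case True
        then show ?thesis using std_normal_cdf_diff_ge[of 0 y c] c c_le by auto
      next
        case False
        then show ?thesis using std_normal_cdf_diff_ge[of y 0 c] c c_le by auto
      qed
      moreover have "?f * (1 - y\<^sup>2) * \<bar>y\<bar> \<le> c * \<bar>y\<bar>" using c by (intro mult_right_mono) auto
      moreover have "?f * (1 - y\<^sup>2) * \<bar>y\<bar> = ?f * \<bar>y\<bar> - ?f * \<bar>y\<bar> ^ 3"
      proof -
        have "f * (1 - y\<^sup>2) * \<bar>y\<bar> = f * \<bar>y\<bar> - f * \<bar>y\<bar> ^ 3" for f
          by (simp add: algebra_simps power2_eq_square power3_eq_cube)
        then show ?thesis .
      qed
      moreover have "?f * \<bar>y\<bar> ^ 3 \<le> 1 * \<bar>y\<bar> ^ 3" using f by (intro mult_right_mono) auto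
      ultimately show ?thesis by linarith
    qed
  qed
  interpret N: real_distribution std_normal_distribution by (rule real_dist_normal_dist)
  show ?thesis
  proof (cases "0 \<le> y")
    case True
    then show ?thesis using key N.cdf_nondecreasing[of 0 y] by (simp add: std_normal_cdf_0)
  next
    case False
    then show ?thesis using key N.cdf_nondecreasing[of y 0] by (simp add: std_normal_cdf_0)
  qed
qed

text \<open>The negative part min x 0 = (x - |x|) / 2 has mean -1 / sqrt (2 pi). Cutting it off at
  -L makes it bounded, as weak convergence demands, and costs at most x^2 / L pointwise.\<close>

lemma std_normal_truncated_negative_part:
  assumes "L > 0"
  shows "(\<integral>x. max (min x 0) (- L) \<partial>std_normal_distribution) \<le> - 1 / sqrt (2 * pi) + 1 / L"
proof -
  interpret N: real_distribution std_normal_distribution by (rule real_dist_normal_dist)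
  have i1: "integrable std_normal_distribution (\<lambda>x. x)"
    using integrable_std_normal_distribution_moment[of 1] by simp
  have i2: "integrable std_normal_distribution (\<lambda>x. x\<^sup>2)"
    by (rule integrable_std_normal_distribution_moment)
  have e1: "(\<integral>x. x \<partial>std_normal_distribution) = 0"
    using integral_std_normal_distribution_moment_odd[of 1] by simp
  have e2: "(\<integral>x. x\<^sup>2 \<partial>std_normal_distribution) = 1"
    using std_normal_distribution_even_moments(1)[of 1] by simp
  have ea: "(\<integral>x. \<bar>x\<bar> \<partial>std_normal_distribution) = sqrt (2 / pi)"
    using std_normal_distribution_odd_moments_abs[of 0] by simp
  have "(\<integral>x. max (min x 0) (- L) \<partial>std_normal_distribution) \<le> (\<integral>x. (x - \<bar>x\<bar>) / 2 + x\<^sup>2 / L \<partial>std_normal_distribution)"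
  proof (rule integral_mono)
    show "integrable std_normal_distribution (\<lambda>x. max (min x 0) (- L))"
      using assms by (intro N.integrable_const_bound[of _ L]) auto
    show "integrable std_normal_distribution (\<lambda>x. (x - \<bar>x\<bar>) / 2 + x\<^sup>2 / L)"
      using i1 i2 by auto
    fix x :: real
    show "max (min x 0) (- L) \<le> (x - \<bar>x\<bar>) / 2 + x\<^sup>2 / L"
    proof (cases "x < - L")
      case True
      then have "L * (- x) \<le> (- x) * (- x)" using assms by (intro mult_right_mono) auto
      then have "- x \<le> x\<^sup>2 / L" using assms by (simp add: field_simps power2_eq_square)
      then show ?thesis using True assms by simp
    next
      case False
      have "0 \<le> x\<^sup>2 / L" using assms by simp
      then show ?thesis using False assms by (cases "x \<le> 0") auto
    qed
  qed
  also have "\<dots> = (0 - sqrt (2 / pi)) / 2 + 1 / L"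
    using i1 i2 e1 e2 ea by simp
  also have "(0 - sqrt (2 / pi)) / 2 = - 1 / sqrt (2 * pi)"
    by (simp add: real_sqrt_divide real_sqrt_mult field_simps)
  finally show ?thesis by simp
qed

lemma cdf_normal_density:
  assumes "\<sigma> > 0"
  shows "cdf (density lborel (normal_density 0 \<sigma>)) x = cdf std_normal_distribution (x / \<sigma>)"
proof -
  interpret N: real_distribution std_normal_distribution by (rule real_dist_normal_dist)
  have "distributed std_normal_distribution lborel (\<lambda>x. x) std_normal_density"
    by (auto simp: distributed_def distr_id2 intro!: N.sets_M)
  from N.normal_density_affine[OF this, of \<sigma> 0]
  have "distributed std_normal_distribution lborel (\<lambda>x. \<sigma> * x) (normal_density 0 \<sigma>)"
    using assms by simp
  then have "density lborel (normal_density 0 \<sigma>) = distr std_normal_distribution lborel (\<lambda>x. \<sigma> * x)"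
    by (simp add: distributed_def)
  then have "cdf (density lborel (normal_density 0 \<sigma>)) x = measure std_normal_distribution ((\<lambda>x. \<sigma> * x) -` {..x} \<inter> space std_normal_distribution)"
    unfolding cdf_def by (simp only:) (subst measure_distr, auto)
  also have "(\<lambda>x. \<sigma> * x) -` {..x} \<inter> space std_normal_distribution = {..x / \<sigma>}"
    using assms by (auto simp: field_simps)
  finally show ?thesis by (simp add: cdf_def)
qed

section \<open>Block sums of i.i.d. variables\<close>

text \<open>Fubini for an independent pair, with the inner integral written over an independent copy
  in the same space M, so that variables can be integrated out one after another without product
  measures.\<close>

lemma (in prob_space) expectation_indep_pair:
  fixes f :: "'b \<Rightarrow> 'b \<Rightarrow> real"
  assumes indep: "indep_var S U T V"
    and f [measurable]: "case_prod f \<in> borel_measurable (S \<Otimes>\<^sub>M T)"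
    and bound: "\<And>u v. \<bar>f u v\<bar> \<le> B"
  shows "expectation (\<lambda>\<omega>. f (U \<omega>) (V \<omega>)) = expectation (\<lambda>\<omega>. expectation (\<lambda>\<omega>'. f (U \<omega>) (V \<omega>')))"
proof -
  have U [measurable]: "random_variable S U" and V [measurable]: "random_variable T V"
    using indep by (rule indep_var_rv1, rule indep_var_rv2)
  interpret DU: prob_space "distr M S U" by (rule prob_space_distr) (rule U)
  interpret DV: prob_space "distr M T V" by (rule prob_space_distr) (rule V)
  interpret P: pair_prob_space "distr M S U" "distr M T V" ..
  have "expectation (\<lambda>\<omega>. f (U \<omega>) (V \<omega>)) = (\<integral>z. case_prod f z \<partial>distr M (S \<Otimes>\<^sub>M T) (\<lambda>\<omega>. (U \<omega>, V \<omega>)))"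
    by (subst integral_distr) auto
  also have "\<dots> = (\<integral>z. case_prod f z \<partial>(distr M S U \<Otimes>\<^sub>M distr M T V))"
    using indep by (simp add: indep_var_distribution_eq)
  also have "\<dots> = (\<integral>u. \<integral>v. f u v \<partial>distr M T V \<partial>distr M S U)"
    by (subst P.integral_fst'[symmetric]) 
      (auto intro!: P.P.integrable_const_bound[of _ B] simp: bound split_beta)
  also have "\<dots> = expectation (\<lambda>\<omega>. \<integral>v. f (U \<omega>) v \<partial>distr M T V)"
    by (subst integral_distr) auto
  also have "\<dots> = expectation (\<lambda>\<omega>. expectation (\<lambda>\<omega>'. f (U \<omega>) (V \<omega>')))"
  proof (rule Bochner_Integration.integral_cong[OF refl])
    fix \<omega> assume "\<omega> \<in> space M"
    then have [measurable]: "U \<omega> \<in> space S" using measurable_space[OF U] by blast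
    show "(\<integral>v. f (U \<omega>) v \<partial>distr M T V) = expectation (\<lambda>\<omega>'. f (U \<omega>) (V \<omega>'))"
      by (rule integral_distr) auto
  qed
  finally show ?thesis .
qed

locale iid_standardized = prob_space M + D: standardized_distribution \<mu>
  for M :: "'a measure" and \<mu> :: "real measure" +
  fixes Y :: "nat \<Rightarrow> 'a \<Rightarrow> real"
  assumes indep: "indep_vars (\<lambda>_. borel) Y {1..}"
    and distr_Y: "\<And>i. i \<ge> 1 \<Longrightarrow> distr M borel (Y i) = \<mu>"
begin

definition block_sum :: "nat set \<Rightarrow> 'a \<Rightarrow> real" where
  "block_sum J \<omega> = (\<Sum>i\<in>J. Y i \<omega>)"

lemma measurable_Y [measurable]: "i \<ge> 1 \<Longrightarrow> Y i \<in> borel_measurable M"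
  using indep unfolding indep_vars_def2 by auto

lemma measurable_block_sum: "J \<subseteq> {1..} \<Longrightarrow> block_sum J \<in> borel_measurable M"
  unfolding block_sum_def[abs_def] by (intro borel_measurable_sum measurable_Y) auto

lemma Y_moments:
  assumes i: "i \<ge> 1"
  shows "integrable M (Y i)" "integrable M (\<lambda>\<omega>. (Y i \<omega>)\<^sup>2)" "expectation (Y i) = 0"
    "expectation (\<lambda>\<omega>. (Y i \<omega>)\<^sup>2) = 1"
proof -
  note [measurable] = measurable_Y[OF i]
  show "integrable M (Y i)"
    using D.id_integrable unfolding distr_Y[OF i, symmetric] by (simp add: integrable_distr_eq)
  show "integrable M (\<lambda>\<omega>. (Y i \<omega>)\<^sup>2)"
    using D.sq_integrable unfolding distr_Y[OF i, symmetric] by (simp add: integrable_distr_eq)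
  show "expectation (Y i) = 0"
    using D.mean0 unfolding distr_Y[OF i, symmetric] by (simp add: integral_distr)
  show "expectation (\<lambda>\<omega>. (Y i \<omega>)\<^sup>2) = 1"
    using D.var1 unfolding distr_Y[OF i, symmetric] by (simp add: integral_distr)
qed

lemma indep_block_sum:
  assumes "finite J" "finite K" "J \<inter> K = {}" "J \<subseteq> {1..}" "K \<subseteq> {1..}"
  shows "indep_var borel (block_sum J) borel (block_sum K)"
proof -
  have "indep_var borel ((\<lambda>f. \<Sum>i\<in>J. f i) \<circ> (\<lambda>\<omega>. restrict (\<lambda>i. Y i \<omega>) J))
    borel ((\<lambda>f. \<Sum>i\<in>K. f i) \<circ> (\<lambda>\<omega>. restrict (\<lambda>i. Y i \<omega>) K))"
    by (intro indep_var_compose[OF indep_var_restrict[OF indep]] assms borel_measurable_sum measurable_component_singleton)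
  also have "(\<lambda>f. \<Sum>i\<in>J. f i) \<circ> (\<lambda>\<omega>. restrict (\<lambda>i. Y i \<omega>) J) = block_sum J"
    by (auto simp: block_sum_def fun_eq_iff)
  also have "(\<lambda>f. \<Sum>i\<in>K. f i) \<circ> (\<lambda>\<omega>. restrict (\<lambda>i. Y i \<omega>) K) = block_sum K"
    by (auto simp: block_sum_def fun_eq_iff)
  finally show ?thesis .
qed

text \<open>\<open>indep_var\<close> takes both variables in one value type, so the single sum is
  padded to a pair by the constant 0.\<close>

lemma indep_block_sum_pair:
  assumes fin: "finite J" "finite K" "finite L" and disj: "J \<inter> K = {}" "J \<inter> L = {}" "K \<inter> L = {}"
    and sub: "J \<subseteq> {1..}" "K \<subseteq> {1..}" "L \<subseteq> {1..}"
  shows "indep_var (borel \<Otimes>\<^sub>M borel) (\<lambda>\<omega>. (block_sum J \<omega>, block_sum K \<omega>)) (borel \<Otimes>\<^sub>M borel) (\<lambda>\<omega>. (block_sum L \<omega>, 0))"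
proof -
  have "indep_var (borel \<Otimes>\<^sub>M borel) ((\<lambda>f. (\<Sum>i\<in>J. f i, \<Sum>i\<in>K. f i)) \<circ> (\<lambda>\<omega>. restrict (\<lambda>i. Y i \<omega>) (J \<union> K)))
    (borel \<Otimes>\<^sub>M borel) ((\<lambda>f. (\<Sum>i\<in>L. f i, 0)) \<circ> (\<lambda>\<omega>. restrict (\<lambda>i. Y i \<omega>) L))"
    by (intro indep_var_compose[OF indep_var_restrict[OF indep]] borel_measurable_sum
        measurable_component_singleton measurable_Pair measurable_const)
      (use assms in auto)
  also have "(\<lambda>f. (\<Sum>i\<in>J. f i, \<Sum>i\<in>K. f i)) \<circ> (\<lambda>\<omega>. restrict (\<lambda>i. Y i \<omega>) (J \<union> K)) = (\<lambda>\<omega>. (block_sum J \<omega>, block_sum K \<omega>))"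
    by (auto simp: block_sum_def fun_eq_iff)
  also have "(\<lambda>f. (\<Sum>i\<in>L. f i, 0)) \<circ> (\<lambda>\<omega>. restrict (\<lambda>i. Y i \<omega>) L) = (\<lambda>\<omega>. (block_sum L \<omega>, 0))"
    by (auto simp: block_sum_def fun_eq_iff)
  finally show ?thesis .
qed

lemma block_sum_union: "finite J \<Longrightarrow> finite K \<Longrightarrow> J \<inter> K = {} \<Longrightarrow> block_sum (J \<union> K) \<omega> = block_sum J \<omega> + block_sum K \<omega>"
  unfolding block_sum_def by (rule sum.union_disjoint)

lemma block_sum_moments:
  assumes "finite J" "J \<subseteq> {1..}"
  shows "integrable M (block_sum J)" "integrable M (\<lambda>\<omega>. (block_sum J \<omega>)\<^sup>2)" "expectation (block_sum J) = 0"
    "expectation (\<lambda>\<omega>. (block_sum J \<omega>)\<^sup>2) = card J"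
proof -
  have "integrable M (block_sum J) \<and> integrable M (\<lambda>\<omega>. (block_sum J \<omega>)\<^sup>2) \<and> expectation (block_sum J) = 0
    \<and> expectation (\<lambda>\<omega>. (block_sum J \<omega>)\<^sup>2) = card J"
    using assms
  proof (induction J)
    case empty
    then show ?case by (simp add: block_sum_def)
  next
    case (insert i J)
    then have i: "i \<ge> 1" and J: "J \<subseteq> {1..}" by auto
    have IH: "integrable M (block_sum J)" "integrable M (\<lambda>\<omega>. (block_sum J \<omega>)\<^sup>2)" "expectation (block_sum J) = 0"
      "expectation (\<lambda>\<omega>. (block_sum J \<omega>)\<^sup>2) = card J"
      using insert J by auto
    have block_sum_insert: "block_sum (insert i J) = (\<lambda>\<omega>. Y i \<omega> + block_sum J \<omega>)"
      using insert by (simp add: block_sum_def fun_eq_iff)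
    have ind: "indep_var borel (Y i) borel (block_sum J)"
      using indep_block_sum[of "{i}" J] insert by (simp add: block_sum_def[abs_def])
    note Yi = Y_moments[OF i]
    have prod: "integrable M (\<lambda>\<omega>. Y i \<omega> * block_sum J \<omega>)" "expectation (\<lambda>\<omega>. Y i \<omega> * block_sum J \<omega>) = 0"
      using indep_var_integrable[OF ind Yi(1) IH(1)] indep_var_lebesgue_integral[OF ind Yi(1) IH(1)] Yi IH by auto
    have sq: "(\<lambda>\<omega>. (block_sum (insert i J) \<omega>)\<^sup>2) = (\<lambda>\<omega>. (Y i \<omega>)\<^sup>2 + 2 * (Y i \<omega> * block_sum J \<omega>) + (block_sum J \<omega>)\<^sup>2)"
      by (simp add: block_sum_insert fun_eq_iff power2_sum)
    show ?case
      unfolding sq unfolding block_sum_insert using Yi IH prod insert by simp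
  qed
  then show "integrable M (block_sum J)" "integrable M (\<lambda>\<omega>. (block_sum J \<omega>)\<^sup>2)" "expectation (block_sum J) = 0"
    "expectation (\<lambda>\<omega>. (block_sum J \<omega>)\<^sup>2) = card J" by auto
qed

lemma char_block_sum:
  assumes "finite J" "J \<subseteq> {1..}"
  shows "char (distr M borel (block_sum J)) t = char \<mu> t ^ card J"
proof -
  have "char (distr M borel (block_sum J)) t = (\<Prod>i\<in>J. char (distr M borel (Y i)) t)"
    unfolding block_sum_def[abs_def] by (rule char_distr_sum[OF indep_vars_subset[OF indep assms(2)]])
  also have "\<dots> = (\<Prod>i\<in>J. char \<mu> t)"
    using assms by (intro prod.cong) (auto simp: distr_Y)
  finally show ?thesis by simp
qed

text \<open>The characteristic function depends only on the cardinality, and Levy uniqueness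
  transfers this to the law. This is the form in which exchangeability is used.\<close>

lemma distr_block_sum_eq:
  assumes "finite J" "J \<subseteq> {1..}" "finite K" "K \<subseteq> {1..}" "card J = card K"
  shows "distr M borel (block_sum J) = distr M borel (block_sum K)"
  by (rule Levy_uniqueness) (use assms in \<open>auto simp: char_block_sum fun_eq_iff intro!: real_distribution_distr measurable_block_sum\<close>)

definition Berry_Esseen_constant :: "real \<Rightarrow> bool" where
  "Berry_Esseen_constant C \<longleftrightarrow> (\<forall>J y. finite J \<longrightarrow> J \<subseteq> {1..} \<longrightarrow> J \<noteq> {} \<longrightarrow>
    \<bar>\<P>(\<omega> in M. block_sum J \<omega> \<le> y) - cdf std_normal_distribution (y / sqrt (card J))\<bar> \<le> C * trunc_moment \<mu> (card J))"

lemma Berry_Esseen_constantD: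
  assumes "Berry_Esseen_constant C" "finite J" "J \<subseteq> {1..}" "J \<noteq> {}"
  shows "\<bar>\<P>(\<omega> in M. block_sum J \<omega> \<le> y) - cdf std_normal_distribution (y / sqrt (card J))\<bar> \<le> C * trunc_moment \<mu> (card J)"
  using assms unfolding Berry_Esseen_constant_def by blast

lemma Berry_Esseen_constant_exists: obtains C where "Berry_Esseen_constant C"
proof -
  obtain C where "C > 0" and BE: "\<And>\<mu> \<nu> n x. \<lbrakk>standardized_distribution \<mu>; n \<ge> 1; real_distribution \<nu>;
      \<And>t. char \<nu> t = char \<mu> (t / sqrt (real n)) ^ n\<rbrakk>
      \<Longrightarrow> \<bar>cdf \<nu> x - cdf std_normal_distribution x\<bar> \<le> C * trunc_moment \<mu> n"
    using Berry_Esseen_truncated by blast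
  show thesis
  proof (rule that, unfold Berry_Esseen_constant_def, intro allI impI)
    fix J :: "nat set" and y :: real
    assume J: "finite J" "J \<subseteq> {1..}" "J \<noteq> {}"
    note [measurable] = measurable_block_sum[OF J(2)]
    define n where "n = card J"
    have n: "n \<ge> 1" using J by (simp add: n_def Suc_le_eq card_gt_0_iff)
    let ?\<nu> = "distr M borel (\<lambda>\<omega>. block_sum J \<omega> / sqrt n)"
    have "char ?\<nu> t = char (distr M borel (block_sum J)) (t / sqrt n)" for t
      unfolding char_def by (simp add: integral_distr)
    then have "\<bar>cdf ?\<nu> (y / sqrt n) - cdf std_normal_distribution (y / sqrt n)\<bar> \<le> C * trunc_moment \<mu> n"
      using n J by (intro BE D.standardized_distribution_axioms) (auto simp: char_block_sum n_def)
    moreover have "cdf ?\<nu> (y / sqrt n) = \<P>(\<omega> in M. block_sum J \<omega> \<le> y)"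
      unfolding cdf_def using n
      by (subst measure_distr) (auto intro!: arg_cong[of _ _ "measure M"] simp: field_simps)
    ultimately show "\<bar>\<P>(\<omega> in M. block_sum J \<omega> \<le> y) - cdf std_normal_distribution (y / sqrt (card J))\<bar> \<le> C * trunc_moment \<mu> (card J)"
      by (simp add: n_def)
  qed
qed

end

section \<open>Overlap of random blocks\<close>

lemma card_subsets_containing:
  assumes "finite S" "K \<subseteq> S" "card K \<le> m"
  shows "card {J. K \<subseteq> J \<and> J \<subseteq> S \<and> card J = m} = (card S - card K) choose (m - card K)"
proof -
  have fK: "finite K" using assms finite_subset by blast
  have "bij_betw (\<lambda>J. J - K) {J. K \<subseteq> J \<and> J \<subseteq> S \<and> card J = m} {B. B \<subseteq> S - K \<and> card B = m - card K}"
  proof (rule bij_betw_byWitness[where f' = "\<lambda>B. B \<union> K"])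
    show "(\<lambda>J. J - K) ` {J. K \<subseteq> J \<and> J \<subseteq> S \<and> card J = m} \<subseteq> {B. B \<subseteq> S - K \<and> card B = m - card K}"
      using fK by (auto simp: card_Diff_subset)
    show "(\<lambda>B. B \<union> K) ` {B. B \<subseteq> S - K \<and> card B = m - card K} \<subseteq> {J. K \<subseteq> J \<and> J \<subseteq> S \<and> card J = m}"
    proof safe
      fix B assume B: "B \<subseteq> S - K" "card B = m - card K"
      then have "finite B" using assms finite_subset by blast
      then have "card (B \<union> K) = card B + card K"
        using B fK by (intro card_Un_disjoint) auto
      then show "card (B \<union> K) = m" using B assms by simp
    qed (use assms in auto)
  qed auto
  then have "card {J. K \<subseteq> J \<and> J \<subseteq> S \<and> card J = m} = card {B. B \<subseteq> S - K \<and> card B = m - card K}"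
    by (rule bij_betw_same_card)
  also have "\<dots> = card (S - K) choose (m - card K)"
    using assms by (intro n_subsets) auto
  also have "card (S - K) = card S - card K"
    using fK assms by (intro card_Diff_subset)
  finally show ?thesis .
qed

lemma m_subsetsD: "J \<in> m_subsets N m \<Longrightarrow> finite J \<and> J \<subseteq> {1..} \<and> J \<subseteq> {1..N} \<and> card J = m"
  unfolding m_subsets_def by (auto dest: finite_subset[OF _ finite_atLeastAtMost])

lemma finite_m_subsets: "finite (m_subsets N m)"
  unfolding m_subsets_def by (rule finite_subset[of _ "Pow {1..N}"]) auto

lemma card_m_subsets: "card (m_subsets N m) = N choose m"
  unfolding m_subsets_def by (subst n_subsets) auto

lemma card_m_subsets_containing:
  assumes "i \<in> {1..N}" "1 \<le> m" "m \<le> N"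
  shows "real (card {J \<in> m_subsets N m. i \<in> J}) = m / N * card (m_subsets N m)"
proof -
  have "{J \<in> m_subsets N m. i \<in> J} = {J. {i} \<subseteq> J \<and> J \<subseteq> {1..N} \<and> card J = m}"
    by (auto simp: m_subsets_def)
  then have "card {J \<in> m_subsets N m. i \<in> J} = (N - 1) choose (m - 1)"
    using card_subsets_containing[of "{1..N}" "{i}" m] assms by simp
  moreover have "m * (N choose m) = N * ((N - 1) choose (m - 1))"
    using assms by (intro times_binomial_minus1_eq) simp
  then have "real m * real (N choose m) = real N * real ((N - 1) choose (m - 1))"
    by (simp only: of_nat_mult[symmetric])
  ultimately show ?thesis
    using assms by (simp add: card_m_subsets field_simps)
qed

text \<open>Sampling without replacement is negatively correlated: given one member, the chance of
  the second is (m - 1) / (N - 1), at most m / N.\<close>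

lemma card_m_subsets_containing_pair:
  assumes "i \<in> {1..N}" "i' \<in> {1..N}" "i \<noteq> i'" "2 \<le> m" "m \<le> N"
  shows "real (card {J \<in> m_subsets N m. i \<in> J \<and> i' \<in> J}) \<le> (m / N)\<^sup>2 * card (m_subsets N m)"
proof -
  have "{J \<in> m_subsets N m. i \<in> J \<and> i' \<in> J} = {J. {i, i'} \<subseteq> J \<and> J \<subseteq> {1..N} \<and> card J = m}"
    by (auto simp: m_subsets_def)
  then have c: "card {J \<in> m_subsets N m. i \<in> J \<and> i' \<in> J} = (N - 2) choose (m - 2)"
    using card_subsets_containing[of "{1..N}" "{i, i'}" m] assms by (simp add: numeral_2_eq_2)
  have "m * (N choose m) = N * ((N - 1) choose (m - 1))"
    using assms by (intro times_binomial_minus1_eq) simp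
  then have 1: "real m * real (N choose m) = real N * real ((N - 1) choose (m - 1))"
    by (simp only: of_nat_mult[symmetric])
  have "(m - 1) * ((N - 1) choose (m - 1)) = (N - 1) * ((N - 1 - 1) choose (m - 1 - 1))"
    using assms by (intro times_binomial_minus1_eq) simp
  then have "(m - 1) * ((N - 1) choose (m - 1)) = (N - 1) * ((N - 2) choose (m - 2))"
    by (simp add: numeral_2_eq_2)
  then have 2: "real (m - 1) * real ((N - 1) choose (m - 1)) = real (N - 1) * real ((N - 2) choose (m - 2))"
    by (simp only: of_nat_mult[symmetric])
  have "real ((N - 2) choose (m - 2)) = real (m - 1) / real (N - 1) * real ((N - 1) choose (m - 1))"
    using 2 assms by (simp add: field_simps)
  also have "\<dots> \<le> real m / real N * real ((N - 1) choose (m - 1))"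
    using assms by (intro mult_right_mono) (auto simp: field_simps of_nat_diff)
  also have "\<dots> = real m / real N * (real m / real N * real (N choose m))"
    using 1 assms by (simp add: field_simps)
  finally show ?thesis
    by (simp add: c card_m_subsets power2_eq_square)
qed

lemma card_Int_eq_sum: "finite J \<Longrightarrow> real (card (J \<inter> K)) = (\<Sum>i\<in>J. of_bool (i \<in> K))"
  by (simp add: of_bool_def sum.If_cases Int_def)

lemma card_filter_eq_sum: "finite A \<Longrightarrow> (\<Sum>K\<in>A. of_bool (P K)) = real (card {K \<in> A. P K})"
  by (simp add: of_bool_def sum.If_cases Int_def)

lemma sum_card_Int:
  assumes J: "J \<in> m_subsets N m" and m: "1 \<le> m" "m \<le> N"
  shows "(\<Sum>K\<in>m_subsets N m. real (card (J \<inter> K))) = (real m)\<^sup>2 / N * card (m_subsets N m)"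
proof -
  have fJ: "finite J" "card J = m" "J \<subseteq> {1..N}" using m_subsetsD[OF J] by auto
  have "(\<Sum>K\<in>m_subsets N m. real (card (J \<inter> K))) = (\<Sum>K\<in>m_subsets N m. \<Sum>i\<in>J. of_bool (i \<in> K))"
    by (intro sum.cong refl card_Int_eq_sum fJ)
  also have "\<dots> = (\<Sum>i\<in>J. \<Sum>K\<in>m_subsets N m. of_bool (i \<in> K))"
    by (rule sum.swap)
  also have "\<dots> = (\<Sum>i\<in>J. m / N * card (m_subsets N m))"
  proof (intro sum.cong refl)
    fix i assume "i \<in> J"
    then show "(\<Sum>K\<in>m_subsets N m. of_bool (i \<in> K)) = m / N * card (m_subsets N m)"
      unfolding card_filter_eq_sum[OF finite_m_subsets]
      using fJ m by (intro card_m_subsets_containing) auto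
  qed
  finally show ?thesis using fJ by (simp add: power2_eq_square)
qed

text \<open>Expanding the square over pairs from J, the diagonal gives the mean overlap and the
  remaining pairs at most its square. The bound controls the blocks with unusually large
  overlap.\<close>

lemma sum_card_Int_square:
  assumes J: "J \<in> m_subsets N m" and m: "2 \<le> m" "m \<le> N"
  shows "(\<Sum>K\<in>m_subsets N m. (real (card (J \<inter> K)))\<^sup>2) \<le> ((real m)\<^sup>2 / N + ((real m)\<^sup>2 / N)\<^sup>2) * card (m_subsets N m)"
proof -
  have fJ: "finite J" "card J = m" "J \<subseteq> {1..N}" using m_subsetsD[OF J] by auto
  let ?c = "real (card (m_subsets N m))"
  have "(\<Sum>K\<in>m_subsets N m. (real (card (J \<inter> K)))\<^sup>2)
      = (\<Sum>K\<in>m_subsets N m. \<Sum>i\<in>J. \<Sum>i'\<in>J. of_bool (i \<in> K \<and> i' \<in> K))"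
    by (intro sum.cong refl, subst card_Int_eq_sum[OF fJ(1)])
      (simp only: power2_eq_square sum_product of_bool_conj)
  also have "\<dots> = (\<Sum>i\<in>J. \<Sum>K\<in>m_subsets N m. \<Sum>i'\<in>J. of_bool (i \<in> K \<and> i' \<in> K))"
    by (rule sum.swap)
  also have "\<dots> = (\<Sum>i\<in>J. \<Sum>i'\<in>J. \<Sum>K\<in>m_subsets N m. of_bool (i \<in> K \<and> i' \<in> K))"
    by (intro sum.cong refl sum.swap)
  also have "\<dots> \<le> (\<Sum>i\<in>J. \<Sum>i'\<in>J. of_bool (i' = i) * (m / N * ?c) + (m / N)\<^sup>2 * ?c)"
  proof (intro sum_mono)
    fix i i' assume "i \<in> J" "i' \<in> J"
    then have i: "i \<in> {1..N}" "i' \<in> {1..N}" using fJ by auto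
    show "(\<Sum>K\<in>m_subsets N m. of_bool (i \<in> K \<and> i' \<in> K)) \<le> of_bool (i' = i) * (m / N * ?c) + (m / N)\<^sup>2 * ?c"
      unfolding card_filter_eq_sum[OF finite_m_subsets]
      using card_m_subsets_containing[OF i(1), of m] card_m_subsets_containing_pair[OF i _ m] m
      by (cases "i' = i") auto
  qed
  also have "\<dots> = (\<Sum>i\<in>J. (m / N * ?c) + m * ((m / N)\<^sup>2 * ?c))"
  proof (intro sum.cong refl)
    fix i assume "i \<in> J"
    then have "(\<Sum>i'\<in>J. of_bool (i' = i) * (m / N * ?c)) = m / N * ?c"
      using fJ by (subst sum.remove[of _ i]) (auto intro!: sum.neutral)
    then show "(\<Sum>i'\<in>J. of_bool (i' = i) * (m / N * ?c) + (m / N)\<^sup>2 * ?c) = (m / N * ?c) + m * ((m / N)\<^sup>2 * ?c)"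
      using fJ by (simp only: sum.distrib sum_constant)
  qed
  also have "\<dots> = m * ((m / N * ?c) + m * ((m / N)\<^sup>2 * ?c))"
    using fJ by (simp only: sum_constant)
  also have "\<dots> = ((real m)\<^sup>2 / N + ((real m)\<^sup>2 / N)\<^sup>2) * ?c"
    by (simp add: power2_eq_square field_simps)
  finally show ?thesis .
qed

section \<open>Covariances of block indicators and the linearization of the empirical
  fraction\<close>

context iid_standardized
begin

text \<open>Given the shared sum over I, the two remainders are independent, and equal cardinality
  gives them the same distribution function P; the conditional joint probability is therefore a
  square.\<close>

lemma joint_prob_shared_sum:
  assumes fin: "finite I" "finite K" "finite K'" and disj: "I \<inter> K = {}" "I \<inter> K' = {}" "K \<inter> K' = {}"
    and sub: "I \<subseteq> {1..}" "K \<subseteq> {1..}" "K' \<subseteq> {1..}" and card: "card K = card K'"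
  defines "P \<equiv> cdf (distr M borel (block_sum K))"
  shows "\<P>(\<omega> in M. block_sum I \<omega> + block_sum K \<omega> \<le> \<theta> \<and> block_sum I \<omega> + block_sum K' \<omega> \<le> \<theta>) = expectation (\<lambda>\<omega>. (P (\<theta> - block_sum I \<omega>))\<^sup>2)"
    and "\<P>(\<omega> in M. block_sum I \<omega> + block_sum K \<omega> \<le> \<theta>) = expectation (\<lambda>\<omega>. P (\<theta> - block_sum I \<omega>))"
proof -
  note [measurable] = measurable_block_sum[OF sub(1)] measurable_block_sum[OF sub(2)] measurable_block_sum[OF sub(3)]
  interpret DK: real_distribution "distr M borel (block_sum K)" by simp
  have [measurable]: "P \<in> borel_measurable borel"
    unfolding P_def by (intro borel_measurable_mono monoI DK.cdf_nondecreasing)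
  have P01: "0 \<le> P x" "P x \<le> 1" for x
    unfolding P_def using DK.cdf_nonneg DK.cdf_bounded_prob by auto
  have P: "P x = expectation (\<lambda>\<omega>. of_bool (block_sum K \<omega> \<le> x))" for x
  proof -
    have "P x = \<P>(\<omega> in M. block_sum K \<omega> \<le> x)"
      unfolding P_def cdf_def by (subst measure_distr) (auto intro!: arg_cong[of _ _ prob])
    also have "\<dots> = expectation (indicator {\<omega> \<in> space M. block_sum K \<omega> \<le> x})" by simp
    also have "\<dots> = expectation (\<lambda>\<omega>. of_bool (block_sum K \<omega> \<le> x))"
      by (intro Bochner_Integration.integral_cong) (auto simp: indicator_def)
    finally show ?thesis .
  qed
  have P': "P x = expectation (\<lambda>\<omega>. of_bool (block_sum K' \<omega> \<le> x))" for x
  proof -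
    have "P x = (\<integral>y. of_bool (y \<le> x) \<partial>distr M borel (block_sum K))"
      unfolding P by (subst integral_distr) auto
    also have "\<dots> = (\<integral>y. of_bool (y \<le> x) \<partial>distr M borel (block_sum K'))"
      using distr_block_sum_eq[of K K'] fin sub card by simp
    also have "\<dots> = expectation (\<lambda>\<omega>. of_bool (block_sum K' \<omega> \<le> x))"
      by (subst integral_distr) auto
    finally show ?thesis .
  qed
  have indI: "indep_var borel (block_sum I) borel (block_sum K)"
    by (rule indep_block_sum) (use assms in auto)
  have indIK: "indep_var (borel \<Otimes>\<^sub>M borel) (\<lambda>\<omega>. (block_sum I \<omega>, block_sum K \<omega>)) (borel \<Otimes>\<^sub>M borel) (\<lambda>\<omega>. (block_sum K' \<omega>, 0))"
    by (rule indep_block_sum_pair) (use assms in auto)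
  have "\<P>(\<omega> in M. block_sum I \<omega> + block_sum K \<omega> \<le> \<theta> \<and> block_sum I \<omega> + block_sum K' \<omega> \<le> \<theta>)
      = expectation (indicator {\<omega> \<in> space M. block_sum I \<omega> + block_sum K \<omega> \<le> \<theta> \<and> block_sum I \<omega> + block_sum K' \<omega> \<le> \<theta>})" by simp
  also have "\<dots> = expectation (\<lambda>\<omega>. of_bool (block_sum I \<omega> + block_sum K \<omega> \<le> \<theta>) * of_bool (block_sum I \<omega> + block_sum K' \<omega> \<le> \<theta>))"
    by (intro Bochner_Integration.integral_cong) (auto simp: indicator_def)
  \<comment> \<open>The sum over K' is integrated out first, given the pair of sums over I and K;
    afterwards the sum over K is integrated out given the sum over I.\<close>
  also have "\<dots> = expectation (\<lambda>\<omega>. expectation (\<lambda>\<omega>'. of_bool (block_sum I \<omega> + block_sum K \<omega> \<le> \<theta>) * of_bool (block_sum I \<omega> + block_sum K' \<omega>' \<le> \<theta>)))"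
    using expectation_indep_pair[OF indIK, of "\<lambda>ab c. of_bool (fst ab + snd ab \<le> \<theta>) * of_bool (fst ab + fst c \<le> \<theta>)" 1]
    by simp
  also have "\<dots> = expectation (\<lambda>\<omega>. of_bool (block_sum I \<omega> + block_sum K \<omega> \<le> \<theta>) * P (\<theta> - block_sum I \<omega>))"
    unfolding P' by (simp add: le_diff_eq add.commute)
  also have "\<dots> = expectation (\<lambda>\<omega>. expectation (\<lambda>\<omega>'. of_bool (block_sum I \<omega> + block_sum K \<omega>' \<le> \<theta>) * P (\<theta> - block_sum I \<omega>)))"
    using P01 by (intro expectation_indep_pair[OF indI, of "\<lambda>a b. of_bool (a + b \<le> \<theta>) * P (\<theta> - a)" 1]) auto
  also have "\<dots> = expectation (\<lambda>\<omega>. (P (\<theta> - block_sum I \<omega>))\<^sup>2)"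
    by (simp add: P le_diff_eq add.commute power2_eq_square)
  finally show "\<P>(\<omega> in M. block_sum I \<omega> + block_sum K \<omega> \<le> \<theta> \<and> block_sum I \<omega> + block_sum K' \<omega> \<le> \<theta>) = expectation (\<lambda>\<omega>. (P (\<theta> - block_sum I \<omega>))\<^sup>2)" .
  have "\<P>(\<omega> in M. block_sum I \<omega> + block_sum K \<omega> \<le> \<theta>)
      = expectation (indicator {\<omega> \<in> space M. block_sum I \<omega> + block_sum K \<omega> \<le> \<theta>})" by simp
  also have "\<dots> = expectation (\<lambda>\<omega>. of_bool (block_sum I \<omega> + block_sum K \<omega> \<le> \<theta>))"
    by (intro Bochner_Integration.integral_cong) (auto simp: indicator_def)
  also have "\<dots> = expectation (\<lambda>\<omega>. expectation (\<lambda>\<omega>'. of_bool (block_sum I \<omega> + block_sum K \<omega>' \<le> \<theta>)))"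
    by (intro expectation_indep_pair[OF indI, of "\<lambda>a b. of_bool (a + b \<le> \<theta>)" 1]) auto
  also have "\<dots> = expectation (\<lambda>\<omega>. P (\<theta> - block_sum I \<omega>))"
    by (simp add: P le_diff_eq add.commute)
  finally show "\<P>(\<omega> in M. block_sum I \<omega> + block_sum K \<omega> \<le> \<theta>) = expectation (\<lambda>\<omega>. P (\<theta> - block_sum I \<omega>))" .
qed

text \<open>
  Two blocks are conditionally independent given the sum over their overlap, and given that sum
  the probability of being small is Lipschitz up to the Berry-Esseen error.
\<close>

lemma pair_covariance_le:
  fixes C \<eta> \<theta> :: real
  assumes BE: "Berry_Esseen_constant C"
    and J: "finite J" "J \<subseteq> {1..}" "card J = m" and J': "finite J'" "J' \<subseteq> {1..}" "card J' = m"
    and lt: "card (J \<inter> J') < m" and \<eta>: "\<eta> > 0"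
  defines "n \<equiv> m - card (J \<inter> J')"
  shows "\<P>(\<omega> in M. block_sum J \<omega> \<le> \<theta> \<and> block_sum J' \<omega> \<le> \<theta>) - (\<P>(\<omega> in M. block_sum J \<omega> \<le> \<theta>))\<^sup>2
    \<le> (1 + \<eta>) * (1 / (2 * pi)) * (card (J \<inter> J') / n) + (1 + 1 / \<eta>) * (C * trunc_moment \<mu> n)\<^sup>2"
proof -
  define I K K' where "I = J \<inter> J'" and "K = J - J'" and "K' = J' - J"
  have fin: "finite I" "finite K" "finite K'" and sub: "I \<subseteq> {1..}" "K \<subseteq> {1..}" "K' \<subseteq> {1..}"
    and disj: "I \<inter> K = {}" "I \<inter> K' = {}" "K \<inter> K' = {}"
    using J J' by (auto simp: I_def K_def K'_def)
  have card: "card K = n" "card K' = n"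
    using J J' by (simp_all add: K_def K'_def n_def card_Diff_subset_Int Int_commute)
  have n: "n \<ge> 1" using lt by (simp add: n_def)
  have K0: "K \<noteq> {}" using card n by auto
  have J_eq: "J = I \<union> K" "J' = I \<union> K'" by (auto simp: I_def K_def K'_def)
  note [measurable] = measurable_block_sum[OF sub(1)] measurable_block_sum[OF sub(2)] measurable_block_sum[OF sub(3)]
  interpret DK: real_distribution "distr M borel (block_sum K)" by simp
  define P where "P = cdf (distr M borel (block_sum K))"
  have [measurable]: "P \<in> borel_measurable borel"
    unfolding P_def by (intro borel_measurable_mono monoI DK.cdf_nondecreasing)
  have P01: "0 \<le> P x" "P x \<le> 1" for x
    unfolding P_def using DK.cdf_nonneg DK.cdf_bounded_prob by auto
  have P_prob: "P x = \<P>(\<omega> in M. block_sum K \<omega> \<le> x)" for x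
    unfolding P_def cdf_def by (subst measure_distr) (auto intro!: arg_cong[of _ _ prob])
  have TJ: "block_sum J \<omega> = block_sum I \<omega> + block_sum K \<omega>" "block_sum J' \<omega> = block_sum I \<omega> + block_sum K' \<omega>" for \<omega>
    unfolding J_eq using fin disj by (simp_all add: block_sum_union)
  define q where "q = cdf std_normal_distribution (\<theta> / sqrt n)"
  let ?P = "\<lambda>\<omega>. P (\<theta> - block_sum I \<omega>)"
  have iP: "integrable M ?P" "integrable M (\<lambda>\<omega>. (?P \<omega>)\<^sup>2)"
    using P01 by (auto intro!: integrable_const_bound[of _ 1] simp: power_le_one)
  have lhs: "\<P>(\<omega> in M. block_sum J \<omega> \<le> \<theta> \<and> block_sum J' \<omega> \<le> \<theta>) = expectation (\<lambda>\<omega>. (?P \<omega>)\<^sup>2)"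
    "\<P>(\<omega> in M. block_sum J \<omega> \<le> \<theta>) = expectation ?P"
    unfolding TJ P_def using joint_prob_shared_sum[OF fin disj sub, of \<theta>] card by auto
  \<comment> \<open>The variance is the second moment about q minus a square. The constant q is the
    normal value with the shared sum set to 0, so only the displacement by that sum and the
    Berry-Esseen error remain.\<close>
  have "expectation (\<lambda>\<omega>. (?P \<omega>)\<^sup>2) - (expectation ?P)\<^sup>2
      = expectation (\<lambda>\<omega>. (?P \<omega> - q)\<^sup>2) - (expectation ?P - q)\<^sup>2"
  proof -
    have "expectation (\<lambda>\<omega>. (?P \<omega> - q)\<^sup>2) = expectation (\<lambda>\<omega>. (?P \<omega>)\<^sup>2 - 2 * q * ?P \<omega> + q\<^sup>2)"
      by (simp add: power2_diff algebra_simps)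
    also have "\<dots> = expectation (\<lambda>\<omega>. (?P \<omega>)\<^sup>2) - 2 * q * expectation ?P + q\<^sup>2"
      using iP by (simp add: prob_space)
    finally show ?thesis by (simp add: power2_diff algebra_simps)
  qed
  also have "\<dots> \<le> expectation (\<lambda>\<omega>. (?P \<omega> - q)\<^sup>2)" by simp
  also have "\<dots> \<le> expectation (\<lambda>\<omega>. (1 + \<eta>) * (1 / (2 * pi)) * ((block_sum I \<omega>)\<^sup>2 / n)
      + (1 + 1 / \<eta>) * (C * trunc_moment \<mu> n)\<^sup>2)"
  proof (rule integral_mono)
    show "integrable M (\<lambda>\<omega>. (?P \<omega> - q)\<^sup>2)"
      unfolding power2_diff using iP by auto
    show "integrable M (\<lambda>\<omega>. (1 + \<eta>) * (1 / (2 * pi)) * ((block_sum I \<omega>)\<^sup>2 / n)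
      + (1 + 1 / \<eta>) * (C * trunc_moment \<mu> n)\<^sup>2)"
      using block_sum_moments[OF fin(1) sub(1)] by simp
    fix \<omega>
    let ?a = "1 / sqrt (2 * pi) * (\<bar>block_sum I \<omega>\<bar> / sqrt n)" and ?c = "C * trunc_moment \<mu> n"
    have "\<bar>?P \<omega> - cdf std_normal_distribution ((\<theta> - block_sum I \<omega>) / sqrt n)\<bar> \<le> ?c"
      unfolding P_prob using Berry_Esseen_constantD[OF BE fin(2) sub(2) K0] card by simp
    moreover have "\<bar>cdf std_normal_distribution ((\<theta> - block_sum I \<omega>) / sqrt n) - q\<bar> \<le> ?a"
    proof -
      have "\<bar>(\<theta> - block_sum I \<omega>) / sqrt n - \<theta> / sqrt n\<bar> = \<bar>block_sum I \<omega>\<bar> / sqrt n"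
        by (simp add: diff_divide_distrib)
      then show ?thesis
        unfolding q_def using std_normal_cdf_abs_diff_le[of "(\<theta> - block_sum I \<omega>) / sqrt n" "\<theta> / sqrt n"] by simp
    qed
    ultimately have "\<bar>?P \<omega> - q\<bar> \<le> ?a + ?c" by linarith
    then have "(?P \<omega> - q)\<^sup>2 \<le> (?a + ?c)\<^sup>2"
      using power_mono[of "\<bar>?P \<omega> - q\<bar>" _ 2] by simp
    also have "\<dots> \<le> (1 + \<eta>) * ?a\<^sup>2 + (1 + 1 / \<eta>) * ?c\<^sup>2"
      by (rule power2_sum_le_weighted[OF \<eta>])
    also have "?a\<^sup>2 = 1 / (2 * pi) * ((block_sum I \<omega>)\<^sup>2 / n)"
      by (simp add: power_mult_distrib power_divide)
    finally show "(?P \<omega> - q)\<^sup>2 \<le> (1 + \<eta>) * (1 / (2 * pi)) * ((block_sum I \<omega>)\<^sup>2 / n) + (1 + 1 / \<eta>) * ?c\<^sup>2"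
      by (simp only: mult.assoc)
  qed
  also have "\<dots> = (1 + \<eta>) * (1 / (2 * pi)) * (card I / n) + (1 + 1 / \<eta>) * (C * trunc_moment \<mu> n)\<^sup>2"
    using block_sum_moments[OF fin(1) sub(1)] by (simp add: prob_space)
  finally show ?thesis unfolding lhs I_def .
qed

text \<open>
  The median lies below a level as soon as more than half of the block averages do, so its
  distribution is read off the fraction \<open>block_ecdf\<close> of small blocks.
\<close>

definition block_ecdf :: "nat \<Rightarrow> nat \<Rightarrow> real \<Rightarrow> 'a \<Rightarrow> real" where
  "block_ecdf N m \<theta> \<omega> = (\<Sum>J\<in>m_subsets N m. of_bool (block_sum J \<omega> \<le> \<theta>)) / card (m_subsets N m)"

text \<open>The block \<open>{1..m}\<close> represents all blocks of size m, whose sums are equally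
  distributed.\<close>

definition block_cdf :: "nat \<Rightarrow> real \<Rightarrow> real" where
  "block_cdf m \<theta> = \<P>(\<omega> in M. block_sum {1..m} \<omega> \<le> \<theta>)"

lemma prob_eq_expectation_of_bool:
  assumes "{\<omega> \<in> space M. P \<omega>} \<in> events"
  shows "expectation (\<lambda>\<omega>. of_bool (P \<omega>)) = \<P>(\<omega> in M. P \<omega>)" "integrable M (\<lambda>\<omega>. of_bool (P \<omega>) :: real)"
proof -
  have eq: "indicator {\<omega> \<in> space M. P \<omega>} \<omega> = (of_bool (P \<omega>) :: real)" if "\<omega> \<in> space M" for \<omega>
    using that by (auto simp: indicator_def)
  have "expectation (indicator {\<omega> \<in> space M. P \<omega>}) = \<P>(\<omega> in M. P \<omega>)"
    using assms by simp
  then show "expectation (\<lambda>\<omega>. of_bool (P \<omega>)) = \<P>(\<omega> in M. P \<omega>)"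
    by (simp add: eq cong: Bochner_Integration.integral_cong)
  have "integrable M (indicator {\<omega> \<in> space M. P \<omega>} :: _ \<Rightarrow> real)"
    using assms by (simp add: integrable_real_indicator emeasure_eq_measure)
  moreover have "integrable M (indicator {\<omega> \<in> space M. P \<omega>} :: _ \<Rightarrow> real) \<longleftrightarrow> integrable M (\<lambda>\<omega>. of_bool (P \<omega>) :: real)"
    by (rule Bochner_Integration.integrable_cong[OF refl eq])
  ultimately show "integrable M (\<lambda>\<omega>. of_bool (P \<omega>) :: real)" by blast
qed

lemma block_sum_events:
  assumes "J \<subseteq> {1..}"
  shows "{\<omega> \<in> space M. block_sum J \<omega> \<le> \<theta>} \<in> events"
  using measurable_block_sum[OF assms] by measurable

lemma expectation_of_bool_block_sum:
  assumes "J \<in> m_subsets N m"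
  shows "expectation (\<lambda>\<omega>. of_bool (block_sum J \<omega> \<le> \<theta>)) = block_cdf m \<theta>"
    and "expectation (\<lambda>\<omega>. of_bool (block_sum J \<omega> \<le> \<theta>) * block_sum J \<omega>) = expectation (\<lambda>\<omega>. of_bool (block_sum {1..m} \<omega> \<le> \<theta>) * block_sum {1..m} \<omega>)"
proof -
  have J: "finite J" "J \<subseteq> {1..}" "card J = m" using m_subsetsD[OF assms] by auto
  note [measurable] = measurable_block_sum[OF J(2)]
  have K: "finite {1..m}" "{1..m} \<subseteq> {1..}" "card {1..m} = m" by auto
  note [measurable] = measurable_block_sum[OF K(2)]
  have eq: "distr M borel (block_sum J) = distr M borel (block_sum {1..m})"
    by (rule distr_block_sum_eq) (use J K in auto)
  have *: "expectation (\<lambda>\<omega>. f (block_sum J \<omega>)) = expectation (\<lambda>\<omega>. f (block_sum {1..m} \<omega>))"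
    if f: "f \<in> borel_measurable borel" for f :: "real \<Rightarrow> real"
  proof -
    have "(\<integral>x. f x \<partial>distr M borel (block_sum J)) = (\<integral>x. f x \<partial>distr M borel (block_sum {1..m}))" by (simp only: eq)
    then show ?thesis
      by (simp only: integral_distr[OF measurable_block_sum[OF J(2)] f] integral_distr[OF measurable_block_sum[OF K(2)] f])
  qed
  have "expectation (\<lambda>\<omega>. of_bool (block_sum J \<omega> \<le> \<theta>) :: real) = expectation (\<lambda>\<omega>. of_bool (block_sum {1..m} \<omega> \<le> \<theta>))"
    by (rule *[of "\<lambda>x. of_bool (x \<le> \<theta>)"]) measurable
  also have "\<dots> = block_cdf m \<theta>"
    unfolding block_cdf_def by (rule prob_eq_expectation_of_bool) (rule block_sum_events[OF K(2)])
  finally show "expectation (\<lambda>\<omega>. of_bool (block_sum J \<omega> \<le> \<theta>)) = block_cdf m \<theta>" .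
  show "expectation (\<lambda>\<omega>. of_bool (block_sum J \<omega> \<le> \<theta>) * block_sum J \<omega>) = expectation (\<lambda>\<omega>. of_bool (block_sum {1..m} \<omega> \<le> \<theta>) * block_sum {1..m} \<omega>)"
    by (rule *[of "\<lambda>x. of_bool (x \<le> \<theta>) * x"]) measurable
qed

lemma integrable_of_bool_block_sum:
  assumes "J \<in> m_subsets N m"
  shows "integrable M (\<lambda>\<omega>. of_bool (block_sum J \<omega> \<le> \<theta>) :: real)"
  by (rule prob_eq_expectation_of_bool) (use m_subsetsD[OF assms] block_sum_events in auto)

lemma block_cdf_bounds: "0 \<le> block_cdf m \<theta>" "block_cdf m \<theta> \<le> 1"
  unfolding block_cdf_def by auto

text \<open>A quadratic polynomial in the overlap j, so that averaging over blocks calls only for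
  the first two moments of j. The parameter \<delta> separates small overlaps, where the remainders
  are long enough for normal approximation, from large ones.\<close>

lemma covariance_le_card_Int:
  fixes C \<eta> \<theta> :: real
  assumes BE: "Berry_Esseen_constant C"
    and JK: "J \<in> m_subsets N m" "K \<in> m_subsets N m" and m: "1 \<le> m"
    and \<eta>: "\<eta> > 0" and \<delta>: "0 < \<delta>" "\<delta> \<le> 1 / 2"
  defines "j \<equiv> real (card (J \<inter> K))"
  shows "expectation (\<lambda>\<omega>. (of_bool (block_sum J \<omega> \<le> \<theta>) - block_cdf m \<theta>) * (of_bool (block_sum K \<omega> \<le> \<theta>) - block_cdf m \<theta>))
    \<le> (1 + \<eta>) / (2 * pi) / ((1 - \<delta>) * m) * j + (1 + 1 / \<eta>) * (2 * (C * trunc_moment \<mu> m)\<^sup>2) + 1 / (\<delta> * m)\<^sup>2 * j\<^sup>2"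
    (is "?lhs \<le> ?a * j + ?b + ?c * j\<^sup>2")
proof -
  have J: "finite J" "J \<subseteq> {1..}" "card J = m" and K: "finite K" "K \<subseteq> {1..}" "card K = m"
    using m_subsetsD[OF JK(1)] m_subsetsD[OF JK(2)] by auto
  note [measurable] = measurable_block_sum[OF J(2)] measurable_block_sum[OF K(2)]
  have i: "integrable M (\<lambda>\<omega>. of_bool (block_sum J \<omega> \<le> \<theta>) :: real)" "integrable M (\<lambda>\<omega>. of_bool (block_sum K \<omega> \<le> \<theta>) :: real)"
    "integrable M (\<lambda>\<omega>. of_bool (block_sum J \<omega> \<le> \<theta> \<and> block_sum K \<omega> \<le> \<theta>) :: real)"
    by (rule prob_eq_expectation_of_bool; measurable)+
  have pJ: "\<P>(\<omega> in M. block_sum J \<omega> \<le> \<theta>) = block_cdf m \<theta>"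
    using expectation_of_bool_block_sum(1)[OF JK(1)] prob_eq_expectation_of_bool(1)[OF block_sum_events[OF J(2)]] by metis
  have "?lhs = expectation (\<lambda>\<omega>. of_bool (block_sum J \<omega> \<le> \<theta> \<and> block_sum K \<omega> \<le> \<theta>) - block_cdf m \<theta> * of_bool (block_sum J \<omega> \<le> \<theta>)
      - block_cdf m \<theta> * of_bool (block_sum K \<omega> \<le> \<theta>) + (block_cdf m \<theta>)\<^sup>2)"
    by (intro Bochner_Integration.integral_cong) (auto simp: algebra_simps power2_eq_square)
  also have "\<dots> = expectation (\<lambda>\<omega>. of_bool (block_sum J \<omega> \<le> \<theta> \<and> block_sum K \<omega> \<le> \<theta>)) - (block_cdf m \<theta>)\<^sup>2"
    using i by (simp add: expectation_of_bool_block_sum(1)[OF JK(1)] expectation_of_bool_block_sum(1)[OF JK(2)] prob_space power2_eq_square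
        del: of_bool_conj)
  also have "expectation (\<lambda>\<omega>. of_bool (block_sum J \<omega> \<le> \<theta> \<and> block_sum K \<omega> \<le> \<theta>)) = \<P>(\<omega> in M. block_sum J \<omega> \<le> \<theta> \<and> block_sum K \<omega> \<le> \<theta>)"
    by (rule prob_eq_expectation_of_bool) measurable
  finally have lhs: "?lhs = \<P>(\<omega> in M. block_sum J \<omega> \<le> \<theta> \<and> block_sum K \<omega> \<le> \<theta>) - (block_cdf m \<theta>)\<^sup>2" .
  have abc: "0 \<le> ?a" "0 \<le> ?b" "0 \<le> ?c" and j0: "0 \<le> j"
    using \<eta> \<delta> by (auto simp: j_def)
  show ?thesis
  \<comment> \<open>For large overlap the trivial bound 1 is at most (j / (\<delta> m))^2, as in
    Chebyshev's inequality.\<close>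
  proof (cases "j \<le> \<delta> * m")
    case False
    have "?lhs \<le> 1"
      unfolding lhs using prob_le_1[of "{\<omega> \<in> space M. block_sum J \<omega> \<le> \<theta> \<and> block_sum K \<omega> \<le> \<theta>}"] zero_le_power2[of "block_cdf m \<theta>"]
      by linarith
    also have "\<dots> \<le> (j / (\<delta> * m))\<^sup>2"
      using False \<delta> m by (simp add: one_le_power)
    also have "\<dots> = ?c * j\<^sup>2" by (simp add: power_divide)
    finally show ?thesis using mult_nonneg_nonneg[OF abc(1) j0] abc(2) by linarith
  next
    case True
    define n where "n = m - card (J \<inter> K)"
    have "\<delta> * m \<le> 1 / 2 * m" using \<delta> m by (intro mult_right_mono) auto
    then have half: "j \<le> m / 2" using True by simp
    then have lt: "card (J \<inter> K) < m" using m by (simp add: j_def)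
    have n_eq: "real n = m - j" using lt by (simp add: n_def j_def of_nat_diff)
    have n_ge: "(1 - \<delta>) * m \<le> n" using True by (simp add: n_eq algebra_simps)
    have n_pos: "0 < (1 - \<delta>) * m" using \<delta> m by simp
    have "?lhs \<le> (1 + \<eta>) * (1 / (2 * pi)) * (j / n) + (1 + 1 / \<eta>) * (C * trunc_moment \<mu> n)\<^sup>2"
      unfolding lhs n_def j_def
      by (rule pair_covariance_le[OF BE J K lt \<eta>, where \<theta> = \<theta>, unfolded pJ])
    also have "\<dots> \<le> (1 + \<eta>) * (1 / (2 * pi)) * (j / ((1 - \<delta>) * m)) + (1 + 1 / \<eta>) * (2 * (C * trunc_moment \<mu> m)\<^sup>2)"
    proof (intro add_mono mult_left_mono)
      show "j / n \<le> j / ((1 - \<delta>) * m)"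
        by (rule divide_left_mono[OF n_ge j0 mult_pos_pos[OF _ n_pos]]) (use n_ge n_pos in linarith)
      \<comment> \<open>Since n is at least m / 2, passing from n to m costs a factor 2 on the
        squares.\<close>
      have "(sqrt n * trunc_moment \<mu> n)\<^sup>2 \<le> (sqrt m * trunc_moment \<mu> m)\<^sup>2"
        using D.trunc_moment_nonneg by (intro power_mono D.sqrt_trunc_moment_mono) (auto simp: n_def)
      then have "n * (trunc_moment \<mu> n)\<^sup>2 \<le> m * (trunc_moment \<mu> m)\<^sup>2"
        by (simp add: power_mult_distrib)
      moreover have "m / 2 * (trunc_moment \<mu> n)\<^sup>2 \<le> n * (trunc_moment \<mu> n)\<^sup>2"
        using half by (intro mult_right_mono) (auto simp: n_eq)
      ultimately have "m * (trunc_moment \<mu> n)\<^sup>2 \<le> m * (2 * (trunc_moment \<mu> m)\<^sup>2)" by simp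
      then have "(trunc_moment \<mu> n)\<^sup>2 \<le> 2 * (trunc_moment \<mu> m)\<^sup>2" using m by simp
      then have "C\<^sup>2 * (trunc_moment \<mu> n)\<^sup>2 \<le> C\<^sup>2 * (2 * (trunc_moment \<mu> m)\<^sup>2)"
        by (rule mult_left_mono) simp
      then show "(C * trunc_moment \<mu> n)\<^sup>2 \<le> 2 * (C * trunc_moment \<mu> m)\<^sup>2"
        by (simp add: power_mult_distrib)
    qed (use \<eta> in auto)
    also have "\<dots> = ?a * j + ?b" by simp
    also have "\<dots> \<le> ?a * j + ?b + ?c * j\<^sup>2" using abc by simp
    finally show ?thesis .
  qed
qed

text \<open>The mean overlap m^2 / N, divided by m, gives the main order m / N. The large-overlap
  penalty is of order 1 / N + (m / N)^2, which is o(m / N) when m and N / m are large.\<close>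

lemma block_ecdf_variance_le:
  fixes C \<eta> \<theta> :: real
  assumes BE: "Berry_Esseen_constant C"
    and m: "2 \<le> m" "m < N" and \<eta>: "\<eta> > 0" and \<delta>: "0 < \<delta>" "\<delta> \<le> 1 / 2"
  shows "expectation (\<lambda>\<omega>. (block_ecdf N m \<theta> \<omega> - block_cdf m \<theta>)\<^sup>2)
    \<le> (1 + \<eta>) / (2 * pi) / (1 - \<delta>) * (m / N) + (1 + 1 / \<eta>) * (2 * (C * trunc_moment \<mu> m)\<^sup>2)
      + 1 / \<delta>\<^sup>2 * (1 / N + (m / N)\<^sup>2)"
    and "integrable M (\<lambda>\<omega>. (block_ecdf N m \<theta> \<omega> - block_cdf m \<theta>)\<^sup>2)"
proof -
  let ?A = "m_subsets N m" and ?p = "block_cdf m \<theta>"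
  define c where "c = real (card ?A)"
  have c: "c > 0" using m by (simp add: c_def card_m_subsets)
  let ?I = "\<lambda>J \<omega>. of_bool (block_sum J \<omega> \<le> \<theta>) - ?p"
  let ?cov = "\<lambda>J K. expectation (\<lambda>\<omega>. ?I J \<omega> * ?I K \<omega>)"
  let ?a = "(1 + \<eta>) / (2 * pi) / ((1 - \<delta>) * m)" and ?b = "(1 + 1 / \<eta>) * (2 * (C * trunc_moment \<mu> m)\<^sup>2)"
    and ?g = "1 / (\<delta> * m)\<^sup>2"
  have int: "integrable M (\<lambda>\<omega>. ?I J \<omega> * ?I K \<omega>)" if "J \<in> ?A" "K \<in> ?A" for J K
  proof -
    note [measurable] = measurable_block_sum[of J] measurable_block_sum[of K]
    have [measurable]: "block_sum J \<in> borel_measurable M" "block_sum K \<in> borel_measurable M"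
      using m_subsetsD[OF that(1)] m_subsetsD[OF that(2)] by (auto intro: measurable_block_sum)
    have "\<bar>?I J \<omega>\<bar> \<le> 1" "\<bar>?I K \<omega>\<bar> \<le> 1" for \<omega> using block_cdf_bounds[of m \<theta>] by (auto simp: abs_if of_bool_def)
    then have "\<bar>?I J \<omega> * ?I K \<omega>\<bar> \<le> 1 * 1" for \<omega> unfolding abs_mult by (intro mult_mono) auto
    then show ?thesis by (intro integrable_const_bound[of _ 1]) auto
  qed
  have sq: "(block_ecdf N m \<theta> \<omega> - ?p)\<^sup>2 = (\<Sum>J\<in>?A. \<Sum>K\<in>?A. ?I J \<omega> * ?I K \<omega>) / c\<^sup>2" for \<omega>
  proof -
    have "block_ecdf N m \<theta> \<omega> - ?p = (\<Sum>J\<in>?A. ?I J \<omega>) / c"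
      using c by (simp add: block_ecdf_def sum_subtractf c_def field_simps)
    then show ?thesis by (simp add: power_divide power2_eq_square sum_product)
  qed
  show "integrable M (\<lambda>\<omega>. (block_ecdf N m \<theta> \<omega> - ?p)\<^sup>2)"
    unfolding sq using int by (intro integrable_divide Bochner_Integration.integrable_sum)
  have "expectation (\<lambda>\<omega>. (block_ecdf N m \<theta> \<omega> - ?p)\<^sup>2) = (\<Sum>J\<in>?A. \<Sum>K\<in>?A. ?cov J K) / c\<^sup>2"
    unfolding sq using int by (simp add: Bochner_Integration.integral_sum Bochner_Integration.integrable_sum)
  also have "\<dots> \<le> (\<Sum>J\<in>?A. (?a * (m\<^sup>2 / N) + ?b + ?g * (m\<^sup>2 / N + (m\<^sup>2 / N)\<^sup>2)) * c) / c\<^sup>2"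
  proof (intro divide_right_mono sum_mono)
    fix J assume J: "J \<in> ?A"
    have "(\<Sum>K\<in>?A. ?cov J K) \<le> (\<Sum>K\<in>?A. ?a * real (card (J \<inter> K)) + ?b + ?g * (real (card (J \<inter> K)))\<^sup>2)"
      using m by (intro sum_mono covariance_le_card_Int[OF BE J _ _ \<eta> \<delta>]) auto
    also have "\<dots> = ?a * (\<Sum>K\<in>?A. real (card (J \<inter> K))) + ?b * c + ?g * (\<Sum>K\<in>?A. (real (card (J \<inter> K)))\<^sup>2)"
      by (simp add: sum.distrib sum_distrib_left c_def)
    also have "\<dots> \<le> ?a * ((real m)\<^sup>2 / N * c) + ?b * c + ?g * (((real m)\<^sup>2 / N + ((real m)\<^sup>2 / N)\<^sup>2) * c)"
      unfolding c_def using m by (intro add_mono mult_left_mono sum_card_Int_square[OF J] order_refl)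
        (use \<eta> \<delta> in \<open>auto simp: sum_card_Int[OF J]\<close>)
    also have "\<dots> = (?a * (m\<^sup>2 / N) + ?b + ?g * (m\<^sup>2 / N + (m\<^sup>2 / N)\<^sup>2)) * c"
      by (simp only: distrib_right mult.assoc of_nat_power)
    finally show "(\<Sum>K\<in>?A. ?cov J K) \<le> (?a * (m\<^sup>2 / N) + ?b + ?g * (m\<^sup>2 / N + (m\<^sup>2 / N)\<^sup>2)) * c" .
  qed simp
  also have "\<dots> = ?a * (m\<^sup>2 / N) + ?b + ?g * (m\<^sup>2 / N + (m\<^sup>2 / N)\<^sup>2)"
  proof -
    have "(\<Sum>J\<in>?A. x * c) / c\<^sup>2 = x" for x
      using c by (simp add: c_def[symmetric] power2_eq_square)
    then show ?thesis .
  qed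
  also have "?a * (m\<^sup>2 / N) = (1 + \<eta>) / (2 * pi) / (1 - \<delta>) * (m / N)"
    using m by (simp add: power2_eq_square)
  also have "?g * (m\<^sup>2 / N + (m\<^sup>2 / N)\<^sup>2) = 1 / \<delta>\<^sup>2 * (1 / N + (m / N)\<^sup>2)"
    using m \<delta> by (simp add: power2_eq_square field_simps)
  finally show "expectation (\<lambda>\<omega>. (block_ecdf N m \<theta> \<omega> - ?p)\<^sup>2)
    \<le> (1 + \<eta>) / (2 * pi) / (1 - \<delta>) * (m / N) + ?b + 1 / \<delta>\<^sup>2 * (1 / N + (m / N)\<^sup>2)" .
qed

text \<open>
  Exchangeability: summing over all observations in the block turns the covariance with the full
  sum into a truncated mean of a single block sum, for which the central limit theorem suffices.
  Computing the Hajek projection directly would need a local limit theorem instead.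
\<close>

lemma block_ecdf_covariance:
  assumes m: "1 \<le> m" "m \<le> N"
  shows "expectation (\<lambda>\<omega>. (block_ecdf N m \<theta> \<omega> - block_cdf m \<theta>) * block_sum {1..N} \<omega>)
      = expectation (\<lambda>\<omega>. of_bool (block_sum {1..m} \<omega> \<le> \<theta>) * block_sum {1..m} \<omega>)" (is "_ = ?e")
    and "integrable M (\<lambda>\<omega>. (block_ecdf N m \<theta> \<omega> - block_cdf m \<theta>) * block_sum {1..N} \<omega>)"
proof -
  let ?A = "m_subsets N m"
  define c where "c = real (card ?A)"
  have c: "c > 0" using m by (simp add: c_def card_m_subsets)
  have N: "finite {1..N}" "{1..N} \<subseteq> {1..}" by auto
  note TN = block_sum_moments[OF N]
  have *: "integrable M (\<lambda>\<omega>. of_bool (block_sum J \<omega> \<le> \<theta>) * block_sum {1..N} \<omega>) \<and>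
      expectation (\<lambda>\<omega>. of_bool (block_sum J \<omega> \<le> \<theta>) * block_sum {1..N} \<omega>) = ?e" if A: "J \<in> ?A" for J
  proof -
    have J: "finite J" "J \<subseteq> {1..}" "card J = m" "J \<subseteq> {1..N}" using m_subsetsD[OF A] by auto
    let ?K = "{1..N} - J"
    have K: "finite ?K" "?K \<subseteq> {1..}" by auto
    note [measurable] = measurable_block_sum[OF J(2)] measurable_block_sum[OF K(2)]
    \<comment> \<open>The full sum is the block sum plus the sum over the complement, which is
      independent of the block and centered and hence contributes nothing.\<close>
    have eq: "of_bool (block_sum J \<omega> \<le> \<theta>) * block_sum {1..N} \<omega> = of_bool (block_sum J \<omega> \<le> \<theta>) * block_sum J \<omega> + of_bool (block_sum J \<omega> \<le> \<theta>) * block_sum ?K \<omega>" for \<omega>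
    proof -
      have "J \<union> ?K = {1..N}" using J by auto
      then have "block_sum {1..N} \<omega> = block_sum J \<omega> + block_sum ?K \<omega>"
        using block_sum_union[of J ?K \<omega>] J(1) by simp
      then show ?thesis by (simp add: distrib_left)
    qed
    have ind: "indep_var borel (block_sum J) borel (block_sum ?K)"
      by (rule indep_block_sum) (use J in auto)
    then have ind': "indep_var borel ((\<lambda>x. of_bool (x \<le> \<theta>)) \<circ> block_sum J) borel ((\<lambda>x. x) \<circ> block_sum ?K)"
      by (rule indep_var_compose) auto
    have ind'': "indep_var borel (\<lambda>\<omega>. of_bool (block_sum J \<omega> \<le> \<theta>) :: real) borel (block_sum ?K)"
      using ind' by (simp add: comp_def)
    note 1 = integrable_of_bool_block_sum[OF A, of \<theta>] and 2 = block_sum_moments[OF K]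
    have "integrable M (\<lambda>\<omega>. of_bool (block_sum J \<omega> \<le> \<theta>) * block_sum J \<omega>)"
      by (rule Bochner_Integration.integrable_bound[OF block_sum_moments(1)[OF J(1,2)]]) (auto simp: abs_mult)
    then show ?thesis
      unfolding eq
      using indep_var_integrable[OF ind'' 1 2(1)] indep_var_lebesgue_integral[OF ind'' 1 2(1)] 2(3)
        expectation_of_bool_block_sum(2)[OF A] by simp
  qed
  have eq: "(block_ecdf N m \<theta> \<omega> - block_cdf m \<theta>) * block_sum {1..N} \<omega>
      = (\<Sum>J\<in>?A. of_bool (block_sum J \<omega> \<le> \<theta>) * block_sum {1..N} \<omega>) / c - block_cdf m \<theta> * block_sum {1..N} \<omega>" for \<omega>
    by (simp add: block_ecdf_def c_def left_diff_distrib sum_distrib_right)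
  have int: "integrable M (\<lambda>\<omega>. (\<Sum>J\<in>?A. of_bool (block_sum J \<omega> \<le> \<theta>) * block_sum {1..N} \<omega>) / c)"
    using * by (intro integrable_divide Bochner_Integration.integrable_sum) auto
  show "integrable M (\<lambda>\<omega>. (block_ecdf N m \<theta> \<omega> - block_cdf m \<theta>) * block_sum {1..N} \<omega>)"
    unfolding eq using int TN by auto
  have "expectation (\<lambda>\<omega>. (block_ecdf N m \<theta> \<omega> - block_cdf m \<theta>) * block_sum {1..N} \<omega>)
      = expectation (\<lambda>\<omega>. (\<Sum>J\<in>?A. of_bool (block_sum J \<omega> \<le> \<theta>) * block_sum {1..N} \<omega>) / c) - expectation (\<lambda>\<omega>. block_cdf m \<theta> * block_sum {1..N} \<omega>)"
    unfolding eq using int TN by (intro Bochner_Integration.integral_diff) auto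
  also have "expectation (\<lambda>\<omega>. (\<Sum>J\<in>?A. of_bool (block_sum J \<omega> \<le> \<theta>) * block_sum {1..N} \<omega>) / c) = (\<Sum>J\<in>?A. ?e) / c"
    using * by (simp add: Bochner_Integration.integral_sum)
  also have "\<dots> = ?e" using c by (simp add: c_def)
  also have "expectation (\<lambda>\<omega>. block_cdf m \<theta> * block_sum {1..N} \<omega>) = 0" using TN by simp
  finally show "expectation (\<lambda>\<omega>. (block_ecdf N m \<theta> \<omega> - block_cdf m \<theta>) * block_sum {1..N} \<omega>) = ?e" by simp
qed

text \<open>The terms are added because a larger total sum means fewer blocks below the level: the
  fluctuation of \<open>block_ecdf\<close> is close to a negative multiple of the normalized full
  sum.\<close>

definition linearization_error :: "nat \<Rightarrow> nat \<Rightarrow> real \<Rightarrow> 'a \<Rightarrow> real" where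
  "linearization_error N m \<theta> \<omega> = sqrt (N / m) * (block_ecdf N m \<theta> \<omega> - block_cdf m \<theta>) + 1 / sqrt (2 * pi) * (block_sum {1..N} \<omega> / sqrt N)"

text \<open>The square is expanded with E[Z^2] = 1 for the normalized full sum Z. The constants
  \<eta> and \<delta> stay free, to be made small before N tends to infinity.\<close>

lemma linearization_error_second_moment:
  fixes C \<eta> \<theta> :: real
  assumes BE: "Berry_Esseen_constant C"
    and m: "2 \<le> m" "m < N" and \<eta>: "\<eta> > 0" and \<delta>: "0 < \<delta>" "\<delta> \<le> 1 / 2"
  shows "expectation (\<lambda>\<omega>. (linearization_error N m \<theta> \<omega>)\<^sup>2)
    \<le> (1 + \<eta>) / (2 * pi) / (1 - \<delta>) + (1 + 1 / \<eta>) * (2 * C\<^sup>2 * (sqrt (N / m) * trunc_moment \<mu> m)\<^sup>2)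
      + 1 / \<delta>\<^sup>2 * (1 / m + m / N)
      + 2 / sqrt (2 * pi) * (expectation (\<lambda>\<omega>. of_bool (block_sum {1..m} \<omega> \<le> \<theta>) * block_sum {1..m} \<omega>) / sqrt m) + 1 / (2 * pi)"
    and "integrable M (\<lambda>\<omega>. (linearization_error N m \<theta> \<omega>)\<^sup>2)"
proof -
  have N: "finite {1..N}" "{1..N} \<subseteq> {1..}" by auto
  note TN = block_sum_moments[OF N]
  let ?V = "\<lambda>\<omega>. block_ecdf N m \<theta> \<omega> - block_cdf m \<theta>" and ?f = "1 / sqrt (2 * pi)"
  let ?e = "expectation (\<lambda>\<omega>. of_bool (block_sum {1..m} \<omega> \<le> \<theta>) * block_sum {1..m} \<omega>)"
  note V = block_ecdf_variance_le[OF BE m \<eta> \<delta>, of \<theta>]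
  note W = block_ecdf_covariance[of m N \<theta>]
  have sm: "sqrt (N / m) / sqrt N = 1 / sqrt m" using m by (simp add: real_sqrt_divide)
  have eq: "(linearization_error N m \<theta> \<omega>)\<^sup>2 = N / m * (?V \<omega>)\<^sup>2 + 2 * ?f / sqrt m * (?V \<omega> * block_sum {1..N} \<omega>) + 1 / (2 * pi) * ((block_sum {1..N} \<omega>)\<^sup>2 / N)" for \<omega>
  proof -
    have "(linearization_error N m \<theta> \<omega>)\<^sup>2 = (sqrt (N / m))\<^sup>2 * (?V \<omega>)\<^sup>2 + 2 * ?f * (sqrt (N / m) / sqrt N) * (?V \<omega> * block_sum {1..N} \<omega>)
       + ?f\<^sup>2 * ((block_sum {1..N} \<omega>)\<^sup>2 / (sqrt N)\<^sup>2)"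
      unfolding linearization_error_def power2_sum power_mult_distrib power_divide by (simp add: mult_ac)
    also have "?f\<^sup>2 = 1 / (2 * pi)" by (simp add: power_divide)
    finally show ?thesis unfolding sm by simp
  qed
  show "integrable M (\<lambda>\<omega>. (linearization_error N m \<theta> \<omega>)\<^sup>2)"
    unfolding eq using V(2) W(2) TN m by auto
  have "expectation (\<lambda>\<omega>. (linearization_error N m \<theta> \<omega>)\<^sup>2) = N / m * expectation (\<lambda>\<omega>. (?V \<omega>)\<^sup>2)
      + 2 * ?f / sqrt m * expectation (\<lambda>\<omega>. ?V \<omega> * block_sum {1..N} \<omega>) + 1 / (2 * pi) * (expectation (\<lambda>\<omega>. (block_sum {1..N} \<omega>)\<^sup>2) / N)"
    unfolding eq using V(2) W(2) TN m by simp
  also have "\<dots> = N / m * expectation (\<lambda>\<omega>. (?V \<omega>)\<^sup>2) + 2 * ?f * (?e / sqrt m) + 1 / (2 * pi)"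
    using W(1) TN m by simp
  also have "N / m * expectation (\<lambda>\<omega>. (?V \<omega>)\<^sup>2) \<le> N / m * ((1 + \<eta>) / (2 * pi) / (1 - \<delta>) * (m / N)
      + (1 + 1 / \<eta>) * (2 * (C * trunc_moment \<mu> m)\<^sup>2) + 1 / \<delta>\<^sup>2 * (1 / N + (m / N)\<^sup>2))"
    by (rule mult_left_mono[OF V(1) divide_nonneg_nonneg]) simp_all
  also have "\<dots> = (1 + \<eta>) / (2 * pi) / (1 - \<delta>) + (1 + 1 / \<eta>) * (2 * C\<^sup>2 * (N / m * (trunc_moment \<mu> m)\<^sup>2))
      + 1 / \<delta>\<^sup>2 * (1 / m + m / N)"
  proof -
    have "N / m * (A * (m / N) + E * (2 * (C * g)\<^sup>2) + F * (1 / N + (m / N)\<^sup>2))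
        = A + E * (2 * C\<^sup>2 * (N / m * g\<^sup>2)) + F * (1 / m + m / N)" for A E F g :: real
      using m by (simp add: distrib_left power_mult_distrib power2_eq_square field_simps)
    then show ?thesis .
  qed
  also have "N / m * (trunc_moment \<mu> m)\<^sup>2 = (sqrt (N / m) * trunc_moment \<mu> m)\<^sup>2"
    by (simp add: power_mult_distrib)
  finally show "expectation (\<lambda>\<omega>. (linearization_error N m \<theta> \<omega>)\<^sup>2)
    \<le> (1 + \<eta>) / (2 * pi) / (1 - \<delta>) + (1 + 1 / \<eta>) * (2 * C\<^sup>2 * (sqrt (N / m) * trunc_moment \<mu> m)\<^sup>2)
      + 1 / \<delta>\<^sup>2 * (1 / m + m / N) + 2 / sqrt (2 * pi) * (?e / sqrt m) + 1 / (2 * pi)" by simp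
qed

text \<open>A central limit theorem along an arbitrary sequence of sizes, read off the Berry-Esseen
  bound; it serves both the blocks and the whole sample.\<close>

lemma normalized_sum_weak_conv:
  assumes n: "\<forall>\<^sub>F N in sequentially. 1 \<le> n N" and g: "(\<lambda>N. trunc_moment \<mu> (n N)) \<longlonglongrightarrow> 0"
  shows "weak_conv_m (\<lambda>N. distr M borel (\<lambda>\<omega>. block_sum {1..n N} \<omega> / sqrt (n N))) std_normal_distribution"
  unfolding weak_conv_m_def weak_conv_def
proof (intro allI impI)
  fix x :: real
  obtain C where BE: "Berry_Esseen_constant C"
    using Berry_Esseen_constant_exists by blast
  have "(\<lambda>N. cdf (distr M borel (\<lambda>\<omega>. block_sum {1..n N} \<omega> / sqrt (n N))) x - cdf std_normal_distribution x) \<longlonglongrightarrow> 0"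
  proof (rule Lim_null_comparison)
    show "(\<lambda>N. C * trunc_moment \<mu> (n N)) \<longlonglongrightarrow> 0"
      using tendsto_mult_right_zero[OF g] by simp
    show "\<forall>\<^sub>F N in sequentially. norm (cdf (distr M borel (\<lambda>\<omega>. block_sum {1..n N} \<omega> / sqrt (n N))) x
        - cdf std_normal_distribution x) \<le> C * trunc_moment \<mu> (n N)"
      using n
    proof eventually_elim
      case (elim N)
      have [measurable]: "block_sum {Suc 0..n N} \<in> borel_measurable M" by (rule measurable_block_sum) auto
      have pos: "sqrt (n N) > 0" using elim by simp
      have "cdf (distr M borel (\<lambda>\<omega>. block_sum {1..n N} \<omega> / sqrt (n N))) x = \<P>(\<omega> in M. block_sum {1..n N} \<omega> \<le> x * sqrt (n N))"
        unfolding cdf_def using pos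
        by (subst measure_distr) (auto intro!: arg_cong[of _ _ prob] simp: pos_divide_le_eq)
      moreover have "{1..n N} \<noteq> {}" using elim by auto
      ultimately show ?case
        using Berry_Esseen_constantD[OF BE, of "{1..n N}" "x * sqrt (n N)"] pos by auto
    qed
  qed
  then show "(\<lambda>N. cdf (distr M borel (\<lambda>\<omega>. block_sum {1..n N} \<omega> / sqrt (n N))) x) \<longlonglongrightarrow> cdf std_normal_distribution x"
    by (rule LIM_zero_cancel)
qed

end

section \<open>Medians\<close>

text \<open>Moving z to the next larger value, at distance d, gains d for every value above z and
  loses d for every other one.\<close>

lemma sum_abs_shift_lt:
  fixes a :: "'i \<Rightarrow> real"
  assumes fin: "finite A" and lt: "card {J \<in> A. a J \<le> z} < card {J \<in> A. z < a J}"
  shows "\<exists>y. (\<Sum>J\<in>A. \<bar>a J - y\<bar>) < (\<Sum>J\<in>A. \<bar>a J - z\<bar>)"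
proof -
  let ?L = "{J \<in> A. a J \<le> z}" and ?G = "{J \<in> A. z < a J}"
  define d where "d = Min ((\<lambda>J. a J - z) ` ?G)"
  have "0 < card ?G" using lt by linarith
  then have fG: "finite ?G" "?G \<noteq> {}" by (simp_all add: card_gt_0_iff)
  have d_le: "d \<le> a J - z" if "J \<in> ?G" for J
    unfolding d_def using fG that by (intro Min_le) auto
  have d0: "d > 0"
    unfolding d_def using fG by (subst Min_gr_iff) auto
  have split: "(\<Sum>J\<in>A. f J) = (\<Sum>J\<in>?L. f J) + (\<Sum>J\<in>?G. f J)" for f :: "'i \<Rightarrow> real"
  proof -
    have "A = ?L \<union> ?G" by auto
    then show ?thesis using fin by (metis (no_types, lifting) sum.union_disjoint[of ?L ?G f] finite_Un disjoint_iff mem_Collect_eq not_less)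
  qed
  have "(\<Sum>J\<in>?L. \<bar>a J - (z + d)\<bar>) = (\<Sum>J\<in>?L. \<bar>a J - z\<bar> + d)"
    using d0 by (intro sum.cong) auto
  moreover have "(\<Sum>J\<in>?G. \<bar>a J - (z + d)\<bar>) = (\<Sum>J\<in>?G. \<bar>a J - z\<bar> - d)"
    using d_le by (intro sum.cong) fastforce+
  ultimately have "(\<Sum>J\<in>A. \<bar>a J - (z + d)\<bar>) = (\<Sum>J\<in>A. \<bar>a J - z\<bar>) + d * (real (card ?L) - real (card ?G))"
    unfolding split by (simp add: sum.distrib sum_subtractf algebra_simps)
  also have "d * (real (card ?L) - real (card ?G)) < 0"
    using lt d0 by (simp add: mult_pos_neg)
  finally show ?thesis by (intro exI[of _ "z + d"]) simp
qed

lemma is_median_half_le: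
  assumes fin: "finite A" and med: "is_median A a z"
  shows "card A \<le> 2 * card {J \<in> A. a J \<le> z}"
proof -
  have "\<not> card {J \<in> A. a J \<le> z} < card {J \<in> A. z < a J}"
    using sum_abs_shift_lt[OF fin, of a z] med unfolding is_median_def is_arg_min_def by blast
  moreover have "card A = card {J \<in> A. a J \<le> z} + card {J \<in> A. z < a J}"
  proof -
    have "A = {J \<in> A. a J \<le> z} \<union> {J \<in> A. z < a J}" by auto
    moreover have "card ({J \<in> A. a J \<le> z} \<union> {J \<in> A. z < a J}) = card {J \<in> A. a J \<le> z} + card {J \<in> A. z < a J}"
      using fin by (intro card_Un_disjoint) auto
    ultimately show ?thesis by simp
  qed
  ultimately show ?thesis by linarith
qed

text \<open>Reflection turns the count of values at or below a median into the count of values at or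
  above it.\<close>

lemma is_median_uminus:
  assumes "is_median A a z"
  shows "is_median A (\<lambda>J. - a J) (- z)"
proof -
  have "\<bar>- a J - y\<bar> = \<bar>a J - (- y)\<bar>" for J y by linarith
  then show ?thesis using assms unfolding is_median_def is_arg_min_def by (simp only: minus_minus) blast
qed

text \<open>If z exceeded x, the strict majority at or below x and the at least half at or above z
  would be disjoint. Strictness makes this hold for every choice of median.\<close>

lemma is_median_le:
  assumes fin: "finite A" and med: "is_median A a z" and x: "card A < 2 * card {J \<in> A. a J \<le> x}"
  shows "z \<le> x"
proof (rule ccontr)
  assume "\<not> z \<le> x"
  then have disj: "{J \<in> A. a J \<le> x} \<inter> {J \<in> A. z \<le> a J} = {}" by auto
  have "card A \<le> 2 * card {J \<in> A. z \<le> a J}"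
    using is_median_half_le[OF fin is_median_uminus[OF med]] by simp
  moreover have "card {J \<in> A. a J \<le> x} + card {J \<in> A. z \<le> a J} = card ({J \<in> A. a J \<le> x} \<union> {J \<in> A. z \<le> a J})"
    using fin disj by (subst card_Un_disjoint) auto
  moreover have "\<dots> \<le> card A" using fin by (intro card_mono) auto
  ultimately show False using x by linarith
qed

lemma is_median_leD:
  assumes fin: "finite A" and med: "is_median A a z" and x: "z \<le> x"
  shows "card A \<le> 2 * card {J \<in> A. a J \<le> x}"
proof -
  have "card {J \<in> A. a J \<le> z} \<le> card {J \<in> A. a J \<le> x}"
    using fin x by (intro card_mono) auto
  then show ?thesis using is_median_half_le[OF fin med] by linarith
qed

section \<open>Asymptotic normality\<close>

locale pi_mom_asymptotics = iid_standardized M \<mu> Y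
  for M :: "'a measure" and \<mu> and Y :: "nat \<Rightarrow> 'a \<Rightarrow> real" +
  fixes m :: "nat \<Rightarrow> nat" and \<tau> :: real
  assumes m_bounds: "\<forall>\<^sub>F N in sequentially. 2 \<le> m N \<and> m N < N"
    and blocks: "filterlim (\<lambda>N. real N / real (m N)) at_top sequentially"
    and size: "filterlim m at_top sequentially"
    and bias: "(\<lambda>N. sqrt (real N / real (m N)) * trunc_moment \<mu> (m N)) \<longlonglongrightarrow> 0"
begin

text \<open>A block average of standardized observations at the level \<tau> / sqrt N, multiplied by
  m. Divided by the scale sqrt m of a block sum it becomes \<tau> sqrt (m / N), which tends to 0, so
  only the normal distribution near 0 matters.\<close>

definition threshold :: "nat \<Rightarrow> real" where
  "threshold N = \<tau> * m N / sqrt N"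

lemma inv_blocks: "(\<lambda>N. real (m N) / real N) \<longlonglongrightarrow> 0"
  using tendsto_inverse_0_at_top[OF blocks] by simp

lemma inv_size: "(\<lambda>N. 1 / real (m N)) \<longlonglongrightarrow> 0"
  using tendsto_inverse_0_at_top[OF filterlim_compose[OF filterlim_real_sequentially size]]
  by (simp add: inverse_eq_divide)

lemma trunc_moment_tendsto_0: "(\<lambda>N. trunc_moment \<mu> (m N)) \<longlonglongrightarrow> 0"
proof (rule tendsto_sandwich[OF _ _ tendsto_const bias])
  show "\<forall>\<^sub>F N in sequentially. 0 \<le> trunc_moment \<mu> (m N)"
    by (simp add: D.trunc_moment_nonneg)
  show "\<forall>\<^sub>F N in sequentially. trunc_moment \<mu> (m N) \<le> sqrt (real N / real (m N)) * trunc_moment \<mu> (m N)"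
    using m_bounds
  proof eventually_elim
    case (elim N)
    then have "1 \<le> sqrt (real N / real (m N))" by simp
    then show ?case using D.trunc_moment_nonneg[of "m N"] by (simp add: mult_le_cancel_right1)
  qed
qed

lemma block_sum_weak_conv:
  "weak_conv_m (\<lambda>N. distr M borel (\<lambda>\<omega>. block_sum {1..m N} \<omega> / sqrt (m N))) std_normal_distribution"
  using m_bounds by (intro normalized_sum_weak_conv trunc_moment_tendsto_0) (auto elim: eventually_mono)

text \<open>The assumption speaks of sizes \<open>m N\<close> only; it reaches the full sample
  because \<open>trunc_moment\<close> decreases and \<open>m N\<close> is below N.\<close>

lemma full_sum_weak_conv:
  "weak_conv_m (\<lambda>N. distr M borel (\<lambda>\<omega>. block_sum {1..N} \<omega> / sqrt N)) std_normal_distribution"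
proof (rule normalized_sum_weak_conv)
  show "\<forall>\<^sub>F N in sequentially. 1 \<le> N" by (rule eventually_ge_at_top)
  show "(\<lambda>N. trunc_moment \<mu> N) \<longlonglongrightarrow> 0"
  proof (rule tendsto_sandwich[OF _ _ tendsto_const trunc_moment_tendsto_0])
    show "\<forall>\<^sub>F N in sequentially. trunc_moment \<mu> N \<le> trunc_moment \<mu> (m N)"
      using m_bounds by eventually_elim (auto intro: D.trunc_moment_antimono)
  qed (simp add: D.trunc_moment_nonneg)
qed

lemma threshold_scaled:
  assumes "m N \<ge> 1" "N \<ge> 1"
  shows "threshold N / sqrt (m N) = \<tau> * sqrt (m N / N)"
  using assms by (simp add: threshold_def real_sqrt_divide field_simps)

text \<open>The integrand is unbounded and discontinuous, so it is majorized by a bounded continuous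
  function plus the vanishing level, which is enough for an upper bound by weak convergence.\<close>

lemma truncated_mean_limsup:
  assumes e: "e > 0"
  shows "\<forall>\<^sub>F N in sequentially.
    expectation (\<lambda>\<omega>. of_bool (block_sum {1..m N} \<omega> \<le> threshold N) * block_sum {1..m N} \<omega>) / sqrt (m N) \<le> - 1 / sqrt (2 * pi) + e"
proof -
  \<comment> \<open>One third of e each is reserved for the truncation at -L, for the weak limit and
    for the shift of the level away from 0.\<close>
  define L where "L = 3 / e"
  have L: "L > 0" "1 / L = e / 3" using e by (auto simp: L_def)
  let ?h = "\<lambda>x::real. max (min x 0) (- L)"
  let ?D = "\<lambda>N. distr M borel (\<lambda>\<omega>. block_sum {1..m N} \<omega> / sqrt (m N))"
  have Tm [measurable]: "block_sum {1..k} \<in> borel_measurable M" "block_sum {Suc 0..k} \<in> borel_measurable M" for k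
    by (rule measurable_block_sum; auto)+
  have "(\<lambda>N. integral\<^sup>L (?D N) ?h) \<longlonglongrightarrow> integral\<^sup>L std_normal_distribution ?h"
  proof (rule weak_conv_imp_integral_bdd_continuous_conv[OF _ real_dist_normal_dist block_sum_weak_conv, of _ L])
    show "real_distribution (?D N)" for N by (rule real_distribution_distr) measurable
    show "isCont ?h x" for x by (intro continuous_intros)
    show "norm (?h x) \<le> L" for x using L by auto
  qed
  moreover have "integral\<^sup>L std_normal_distribution ?h < - 1 / sqrt (2 * pi) + 2 * e / 3"
    using std_normal_truncated_negative_part[OF L(1)] L(2) e by linarith
  ultimately have ev1: "\<forall>\<^sub>F N in sequentially. integral\<^sup>L (?D N) ?h < - 1 / sqrt (2 * pi) + 2 * e / 3"
    by (rule order_tendstoD)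
  have "(\<lambda>N. \<bar>\<tau> * sqrt (m N / N)\<bar>) \<longlonglongrightarrow> \<bar>\<tau> * sqrt 0\<bar>"
    by (intro tendsto_rabs tendsto_mult tendsto_const tendsto_real_sqrt inv_blocks)
  then have ev2: "\<forall>\<^sub>F N in sequentially. \<bar>\<tau> * sqrt (m N / N)\<bar> < e / 3"
    using e by (intro order_tendstoD) auto
  show ?thesis
    using ev1 ev2 m_bounds
  proof eventually_elim
    case (elim N)
    let ?S = "\<lambda>\<omega>. block_sum {1..m N} \<omega> / sqrt (m N)" and ?x = "\<tau> * sqrt (m N / N)"
    have pos: "sqrt (m N) > 0" using elim by simp
    have x: "threshold N / sqrt (m N) = ?x" using elim by (intro threshold_scaled) auto
    have TS: "integrable M (block_sum {1..m N})" by (rule block_sum_moments) auto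
    have "expectation (\<lambda>\<omega>. of_bool (block_sum {1..m N} \<omega> \<le> threshold N) * block_sum {1..m N} \<omega>) / sqrt (m N)
        = expectation (\<lambda>\<omega>. of_bool (block_sum {1..m N} \<omega> \<le> threshold N) * block_sum {1..m N} \<omega> / sqrt (m N))" by simp
    also have "\<dots> \<le> expectation (\<lambda>\<omega>. ?h (?S \<omega>) + \<bar>?x\<bar>)"
    proof (rule integral_mono)
      have "integrable M (\<lambda>\<omega>. of_bool (block_sum {1..m N} \<omega> \<le> threshold N) * block_sum {1..m N} \<omega>)"
        by (rule Bochner_Integration.integrable_bound[OF TS]) (auto simp: abs_mult)
      then show "integrable M (\<lambda>\<omega>. of_bool (block_sum {1..m N} \<omega> \<le> threshold N) * block_sum {1..m N} \<omega> / sqrt (m N))"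
        by (rule integrable_divide)
      show "integrable M (\<lambda>\<omega>. ?h (?S \<omega>) + \<bar>?x\<bar>)"
        using L by (intro integrable_const_bound[of _ "L + \<bar>?x\<bar>"]) auto
      fix \<omega>
      have iff: "block_sum {1..m N} \<omega> \<le> threshold N \<longleftrightarrow> ?S \<omega> \<le> ?x"
        unfolding x[symmetric] using pos by (simp add: divide_le_cancel)
      \<comment> \<open>Truncating from below only increases the negative part. Between 0 and the
        level both sides differ by at most |?x|, whichever sign the level has.\<close>
      have "of_bool (s \<le> ?x) * s \<le> ?h s + \<bar>?x\<bar>" for s
        by (cases "s \<le> ?x"; cases "s \<le> 0") auto
      from this[of "?S \<omega>"]
      show "of_bool (block_sum {1..m N} \<omega> \<le> threshold N) * block_sum {1..m N} \<omega> / sqrt (m N) \<le> ?h (?S \<omega>) + \<bar>?x\<bar>"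
        unfolding iff by simp
    qed
    also have "\<dots> = integral\<^sup>L (?D N) ?h + \<bar>?x\<bar>"
    proof -
      have "integrable M (\<lambda>\<omega>. ?h (?S \<omega>))"
        using L by (intro integrable_const_bound[of _ L]) auto
      moreover have "integral\<^sup>L (?D N) ?h = expectation (\<lambda>\<omega>. ?h (?S \<omega>))"
        by (rule integral_distr) measurable
      ultimately show ?thesis by (simp add: prob_space)
    qed
    finally show ?case using elim by linarith
  qed
qed

text \<open>The limiting coefficients 1, -2 and 1 of 1 / (2 pi) cancel, so only the errors
  remain.\<close>

lemma linearization_error_second_moment_tendsto_0:
  assumes e: "e > 0"
  shows "\<forall>\<^sub>F N in sequentially. integrable M (\<lambda>\<omega>. (linearization_error N (m N) (threshold N) \<omega>)\<^sup>2) \<and>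
    expectation (\<lambda>\<omega>. (linearization_error N (m N) (threshold N) \<omega>)\<^sup>2) \<le> e"
proof -
  obtain C where BE: "Berry_Esseen_constant C"
    using Berry_Esseen_constant_exists by blast
  \<comment> \<open>The same small number serves as \<eta> and as \<delta> in the variance bound.
    Being at most 1/2, it satisfies (1 + \<eta>) / (1 - \<eta>) \<le> 1 + 4 \<eta>.\<close>
  define \<eta> where "\<eta> = min (1 / 2) (e / 4)"
  have \<eta>: "0 < \<eta>" "\<eta> \<le> 1 / 2" "\<eta> \<le> e / 4" using e by (auto simp: \<eta>_def)
  let ?f = "1 / sqrt (2 * pi)"
  have f: "0 < ?f" "2 * ?f \<le> 1" "?f * ?f = 1 / (2 * pi)"
  proof -
    have "2 \<le> sqrt (2 * pi)" using pi_gt3 by (intro real_le_rsqrt) simp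
    then show "2 * ?f \<le> 1" by simp
  qed auto
  have main: "(1 + \<eta>) / (2 * pi) / (1 - \<eta>) \<le> 1 / (2 * pi) + \<eta>"
  proof -
    have "(1 + \<eta>) / (1 - \<eta>) \<le> 1 + 4 * \<eta>"
    proof -
      have "\<eta> * \<eta> \<le> 1 / 2 * \<eta>" using \<eta> by (intro mult_right_mono) auto
      then show ?thesis using \<eta> by (simp add: pos_divide_le_eq algebra_simps)
    qed
    then have "1 / (2 * pi) * ((1 + \<eta>) / (1 - \<eta>)) \<le> 1 / (2 * pi) * (1 + 4 * \<eta>)"
      by (rule mult_left_mono) simp
    also have "\<dots> = 1 / (2 * pi) + 4 / (2 * pi) * \<eta>" by (simp add: distrib_left)
    also have "4 / (2 * pi) * \<eta> \<le> 1 * \<eta>"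
      using pi_gt3 \<eta> by (intro mult_right_mono) auto
    finally show ?thesis by simp
  qed
  let ?rest = "\<lambda>N. (1 + 1 / \<eta>) * (2 * C\<^sup>2 * (sqrt (N / m N) * trunc_moment \<mu> (m N))\<^sup>2) + 1 / \<eta>\<^sup>2 * (1 / m N + m N / N)"
  have "?rest \<longlonglongrightarrow> (1 + 1 / \<eta>) * (2 * C\<^sup>2 * 0\<^sup>2) + 1 / \<eta>\<^sup>2 * (0 + 0)"
    by (intro tendsto_add tendsto_mult tendsto_const tendsto_power bias inv_size inv_blocks)
  then have ev1: "\<forall>\<^sub>F N in sequentially. ?rest N < e / 4"
    using e by (intro order_tendstoD) auto
  have ev2: "\<forall>\<^sub>F N in sequentially. expectation (\<lambda>\<omega>. of_bool (block_sum {1..m N} \<omega> \<le> threshold N) * block_sum {1..m N} \<omega>) / sqrt (m N)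
      \<le> - ?f + e / 4"
    using truncated_mean_limsup[of "e / 4"] e by simp
  show ?thesis
    using ev1 ev2 m_bounds
  proof eventually_elim
    case (elim N)
    let ?E = "expectation (\<lambda>\<omega>. of_bool (block_sum {1..m N} \<omega> \<le> threshold N) * block_sum {1..m N} \<omega>) / sqrt (m N)"
    have m: "2 \<le> m N" "m N < N" using elim by auto
    have int: "integrable M (\<lambda>\<omega>. (linearization_error N (m N) (threshold N) \<omega>)\<^sup>2)"
      by (rule linearization_error_second_moment(2)[OF BE m \<eta>(1) \<eta>(1) \<eta>(2)])
    have bound: "expectation (\<lambda>\<omega>. (linearization_error N (m N) (threshold N) \<omega>)\<^sup>2)
        \<le> (1 + \<eta>) / (2 * pi) / (1 - \<eta>) + ?rest N + 2 / sqrt (2 * pi) * ?E + 1 / (2 * pi)"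
      using linearization_error_second_moment(1)[OF BE m \<eta>(1) \<eta>(1) \<eta>(2), of "threshold N"] by (simp only: add.assoc)
    have "2 * ?f * ?E \<le> 2 * ?f * (- ?f + e / 4)"
      using elim f by (intro mult_left_mono) auto
    also have "\<dots> = - 2 * (?f * ?f) + 2 * ?f * (e / 4)"
      by (simp only: distrib_left mult_minus_right mult_minus_left mult.assoc)
    also have "\<dots> \<le> - 2 * (1 / (2 * pi)) + 1 * (e / 4)"
      unfolding f(3) using f e by (intro add_mono mult_right_mono) auto
    finally have "2 / sqrt (2 * pi) * ?E \<le> - 2 * (1 / (2 * pi)) + e / 4" by simp
    moreover have "?rest N < e / 4" using elim by blast
    ultimately have "expectation (\<lambda>\<omega>. (linearization_error N (m N) (threshold N) \<omega>)\<^sup>2) \<le> e"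
      using bound main \<eta>(3) e by linarith
    then show ?case using int by blast
  qed
qed

text \<open>With k = N / m the level is \<tau> / sqrt k, so sqrt k times the linear term is
  constant, and sqrt k times the cubic error is of order 1 / k. The Berry-Esseen error, multiplied
  by sqrt k, vanishes by \<open>bias\<close>.\<close>

lemma centering_tendsto:
  "(\<lambda>N. sqrt (N / m N) * (block_cdf (m N) (threshold N) - 1 / 2)) \<longlonglongrightarrow> 1 / sqrt (2 * pi) * \<tau>"
proof -
  obtain C where BE: "Berry_Esseen_constant C"
    using Berry_Esseen_constant_exists by blast
  have "(\<lambda>N. sqrt (N / m N) * (block_cdf (m N) (threshold N) - 1 / 2) - 1 / sqrt (2 * pi) * \<tau>) \<longlonglongrightarrow> 0"
  proof (rule Lim_null_comparison)
    have "(\<lambda>N. C * (sqrt (N / m N) * trunc_moment \<mu> (m N)) + \<bar>\<tau>\<bar> ^ 3 * (m N / N)) \<longlonglongrightarrow> C * 0 + \<bar>\<tau>\<bar> ^ 3 * 0"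
      by (intro tendsto_add tendsto_mult tendsto_const bias inv_blocks)
    then show "(\<lambda>N. C * (sqrt (N / m N) * trunc_moment \<mu> (m N)) + \<bar>\<tau>\<bar> ^ 3 * (m N / N)) \<longlonglongrightarrow> 0" by simp
    show "\<forall>\<^sub>F N in sequentially. norm (sqrt (N / m N) * (block_cdf (m N) (threshold N) - 1 / 2) - 1 / sqrt (2 * pi) * \<tau>)
      \<le> C * (sqrt (N / m N) * trunc_moment \<mu> (m N)) + \<bar>\<tau>\<bar> ^ 3 * (m N / N)"
      using m_bounds
    proof eventually_elim
      case (elim N)
      let ?k = "sqrt (N / m N)" and ?x = "\<tau> * sqrt (m N / N)" and ?f = "1 / sqrt (2 * pi)"
      have x: "threshold N / sqrt (m N) = ?x" using elim by (intro threshold_scaled) auto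
      have ne: "{1..m N} \<noteq> {}" using elim by auto
      have 1: "\<bar>block_cdf (m N) (threshold N) - cdf std_normal_distribution ?x\<bar> \<le> C * trunc_moment \<mu> (m N)"
        using Berry_Esseen_constantD[OF BE _ _ ne, of "threshold N"] unfolding block_cdf_def x[symmetric] by simp
      have 2: "\<bar>cdf std_normal_distribution ?x - 1 / 2 - ?f * ?x\<bar> \<le> \<bar>?x\<bar> ^ 3"
        by (rule std_normal_cdf_linear_approx)
      have k0: "?k \<ge> 0" by simp
      have kk: "?k * sqrt (m N / N) = 1" using elim by (simp add: real_sqrt_mult[symmetric])
      have kx: "?k * (?f * ?x) = ?f * \<tau>"
      proof -
        have "?k * (?f * ?x) = ?f * \<tau> * (?k * sqrt (m N / N))" by (simp only: mult_ac)
        then show ?thesis by (simp only: kk mult_1_right)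
      qed
      have k3: "?k * \<bar>?x\<bar> ^ 3 = \<bar>\<tau>\<bar> ^ 3 * (m N / N)"
      proof -
        have "?k * \<bar>?x\<bar> ^ 3 = \<bar>\<tau>\<bar> ^ 3 * (?k * sqrt (m N / N)) * (sqrt (m N / N))\<^sup>2"
        proof -
          have "\<bar>?x\<bar> = \<bar>\<tau>\<bar> * sqrt (m N / N)" by (simp add: abs_mult)
          then show ?thesis by (simp only: power_mult_distrib power3_eq_cube power2_eq_square mult_ac)
        qed
        then show ?thesis unfolding kk by simp
      qed
      have "\<bar>block_cdf (m N) (threshold N) - 1 / 2 - ?f * ?x\<bar> \<le> C * trunc_moment \<mu> (m N) + \<bar>?x\<bar> ^ 3"
        using 1 2 by linarith
      then have "?k * \<bar>block_cdf (m N) (threshold N) - 1 / 2 - ?f * ?x\<bar> \<le> ?k * (C * trunc_moment \<mu> (m N) + \<bar>?x\<bar> ^ 3)"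
        using k0 by (rule mult_left_mono)
      also have "\<dots> = C * (?k * trunc_moment \<mu> (m N)) + \<bar>\<tau>\<bar> ^ 3 * (m N / N)"
        unfolding distrib_left k3 by (simp only: mult_ac)
      finally have "?k * \<bar>block_cdf (m N) (threshold N) - 1 / 2 - ?f * ?x\<bar> \<le> C * (?k * trunc_moment \<mu> (m N)) + \<bar>\<tau>\<bar> ^ 3 * (m N / N)" .
      moreover have "?k * \<bar>block_cdf (m N) (threshold N) - 1 / 2 - ?f * ?x\<bar> = \<bar>?k * (block_cdf (m N) (threshold N) - 1 / 2) - ?f * \<tau>\<bar>"
        unfolding kx[symmetric] right_diff_distrib[symmetric] abs_mult abs_of_nonneg[OF k0] ..
      ultimately show ?case by simp
    qed
  qed
  then show ?thesis by (rule LIM_zero_cancel)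
qed

text \<open>Off the event of a large linearization error, A N lies between the events that the
  normalized full sum is at most \<tau> - \<epsilon> and at most \<tau> + \<epsilon>. A strict
  inequality in \<open>lo\<close> and a weak one in \<open>up\<close> accommodate ties and
  non-unique medians.\<close>

lemma median_cdf_tendsto:
  assumes ev: "\<And>N. 2 \<le> m N \<Longrightarrow> m N < N \<Longrightarrow> A N \<in> events"
    and lo: "\<And>N \<omega>. 2 \<le> m N \<Longrightarrow> m N < N \<Longrightarrow> \<omega> \<in> space M \<Longrightarrow> 1 / 2 < block_ecdf N (m N) (threshold N) \<omega> \<Longrightarrow> \<omega> \<in> A N"
    and up: "\<And>N \<omega>. 2 \<le> m N \<Longrightarrow> m N < N \<Longrightarrow> \<omega> \<in> A N \<Longrightarrow> 1 / 2 \<le> block_ecdf N (m N) (threshold N) \<omega>"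
  shows "(\<lambda>N. prob (A N)) \<longlonglongrightarrow> cdf std_normal_distribution \<tau>"
proof (rule LIMSEQ_I)
  fix r :: real assume r: "r > 0"
  define \<epsilon> where "\<epsilon> = r / 4"
  have \<epsilon>: "\<epsilon> > 0" using r by (simp add: \<epsilon>_def)
  let ?f = "1 / sqrt (2 * pi)" and ?F = "cdf std_normal_distribution"
  have f: "0 < ?f" "?f \<le> 1"
  proof -
    have "1 \<le> sqrt (2 * pi)" using pi_gt3 by simp
    then show "?f \<le> 1" by simp
  qed simp
  let ?Z = "\<lambda>N \<omega>. block_sum {1..N} \<omega> / sqrt N"
  let ?linearization_error = "\<lambda>N \<omega>. linearization_error N (m N) (threshold N) \<omega>"
  let ?b = "\<lambda>N. sqrt (N / m N) * (block_cdf (m N) (threshold N) - 1 / 2)"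
  \<comment> \<open>Shifting the full sum by \<epsilon> moves the linear term by 2 c, which
    outweighs the linearization error and the centering error, each below c.\<close>
  define c where "c = ?f * \<epsilon> / 2"
  have c: "c > 0" using f \<epsilon> by (simp add: c_def)
  have Tm [measurable]: "block_sum {1..k} \<in> borel_measurable M" "block_sum {Suc 0..k} \<in> borel_measurable M" for k
    by (rule measurable_block_sum; auto)+
  have U_meas [measurable]: "block_ecdf N k t \<in> borel_measurable M" for N k t
    unfolding block_ecdf_def[abs_def]
    by (intro borel_measurable_divide borel_measurable_sum borel_measurable_const)
      (use integrable_of_bool_block_sum in \<open>auto dest: borel_measurable_integrable\<close>)
  have R_meas [measurable]: "?linearization_error N \<in> borel_measurable M" for N
    unfolding linearization_error_def[abs_def] by measurable
  have Z_lim: "(\<lambda>N. \<P>(\<omega> in M. ?Z N \<omega> \<le> x)) \<longlonglongrightarrow> ?F x" for x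
  proof -
    have "(\<lambda>N. cdf (distr M borel (?Z N)) x) \<longlonglongrightarrow> ?F x"
      using full_sum_weak_conv isCont_std_normal_cdf unfolding weak_conv_m_def weak_conv_def by blast
    moreover have "cdf (distr M borel (?Z N)) x = \<P>(\<omega> in M. ?Z N \<omega> \<le> x)" for N
      unfolding cdf_def by (subst measure_distr) (auto intro!: arg_cong[of _ _ prob])
    ultimately show ?thesis by simp
  qed
  have Zev: "\<forall>\<^sub>F N in sequentially. \<bar>\<P>(\<omega> in M. ?Z N \<omega> \<le> x) - ?F x\<bar> < \<epsilon>" for x
    using tendstoD[OF Z_lim[of x] \<epsilon>] by (simp add: dist_real_def)
  have bev: "\<forall>\<^sub>F N in sequentially. \<bar>?b N - ?f * \<tau>\<bar> < c"
    using tendstoD[OF centering_tendsto c] by (simp add: dist_real_def)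
  \<comment> \<open>Calibrated so that Chebyshev at level c leaves probability at most
    \<epsilon>.\<close>
  have Rev: "\<forall>\<^sub>F N in sequentially. integrable M (\<lambda>\<omega>. (?linearization_error N \<omega>)\<^sup>2) \<and> expectation (\<lambda>\<omega>. (?linearization_error N \<omega>)\<^sup>2) \<le> \<epsilon> * c\<^sup>2"
    using \<epsilon> c by (intro linearization_error_second_moment_tendsto_0) simp
  have "\<forall>\<^sub>F N in sequentially. \<bar>prob (A N) - ?F \<tau>\<bar> < r"
    using Zev[of "\<tau> - \<epsilon>"] Zev[of "\<tau> + \<epsilon>"] bev Rev m_bounds
  proof eventually_elim
    case (elim N)
    let ?B = "{\<omega> \<in> space M. c \<le> \<bar>?linearization_error N \<omega>\<bar>}"
    have m: "2 \<le> m N" "m N < N" using elim by auto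
    have AN: "A N \<in> events" by (rule ev[OF m])
    have B: "prob ?B \<le> \<epsilon>"
    proof -
      have "prob {\<omega> \<in> space M. c\<^sup>2 \<le> (?linearization_error N \<omega>)\<^sup>2} \<le> expectation (\<lambda>\<omega>. (?linearization_error N \<omega>)\<^sup>2) / c\<^sup>2"
        using elim c by (intro integral_Markov_inequality_measure[where A = "{}"]) auto
      also have "\<dots> \<le> \<epsilon> * c\<^sup>2 / c\<^sup>2" using elim by (intro divide_right_mono) auto
      also have "\<dots> = \<epsilon>" using c by simp
      also have "{\<omega> \<in> space M. c\<^sup>2 \<le> (?linearization_error N \<omega>)\<^sup>2} = ?B"
        using c by (auto simp: abs_le_square_iff[symmetric])
      finally show ?thesis .
    qed
    have k: "sqrt (N / m N) > 0" using m by simp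
    have U_eq: "sqrt (N / m N) * (block_ecdf N (m N) (threshold N) \<omega> - 1 / 2) = ?linearization_error N \<omega> - ?f * ?Z N \<omega> + ?b N" for \<omega>
      by (simp add: linearization_error_def algebra_simps)
    have fe: "?f * \<epsilon> = c + c" by (simp add: c_def)
    have low: "{\<omega> \<in> space M. ?Z N \<omega> \<le> \<tau> - \<epsilon>} \<subseteq> A N \<union> ?B"
    proof (intro subsetI)
      fix \<omega> assume w: "\<omega> \<in> {\<omega> \<in> space M. ?Z N \<omega> \<le> \<tau> - \<epsilon>}"
      show "\<omega> \<in> A N \<union> ?B"
      proof (cases "c \<le> \<bar>?linearization_error N \<omega>\<bar>")
        case False
        have "?f * ?Z N \<omega> \<le> ?f * (\<tau> - \<epsilon>)" using w f by (intro mult_left_mono) auto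
        then have "?f * ?Z N \<omega> \<le> ?f * \<tau> - (c + c)" unfolding right_diff_distrib fe .
        then have "0 < ?linearization_error N \<omega> - ?f * ?Z N \<omega> + ?b N" using False elim by linarith
        then have "1 / 2 < block_ecdf N (m N) (threshold N) \<omega>"
          unfolding U_eq[symmetric] using k by (simp add: zero_less_mult_iff)
        then show ?thesis using lo[OF m] w by auto
      qed (use w in auto)
    qed
    have high: "A N \<subseteq> {\<omega> \<in> space M. ?Z N \<omega> \<le> \<tau> + \<epsilon>} \<union> ?B"
    proof (intro subsetI)
      fix \<omega> assume w: "\<omega> \<in> A N"
      then have sp: "\<omega> \<in> space M" using sets.sets_into_space[OF AN] by auto
      show "\<omega> \<in> {\<omega> \<in> space M. ?Z N \<omega> \<le> \<tau> + \<epsilon>} \<union> ?B"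
      proof (cases "c \<le> \<bar>?linearization_error N \<omega>\<bar>")
        case False
        have "0 \<le> sqrt (N / m N) * (block_ecdf N (m N) (threshold N) \<omega> - 1 / 2)"
          using up[OF m w] k by (intro mult_nonneg_nonneg) auto
        then have "?f * ?Z N \<omega> \<le> ?f * \<tau> + (c + c)" unfolding U_eq using False elim by linarith
        then have "?f * ?Z N \<omega> \<le> ?f * (\<tau> + \<epsilon>)" unfolding distrib_left fe .
        then have "?Z N \<omega> \<le> \<tau> + \<epsilon>" using f(1) by (rule mult_left_le_imp_le)
        then show ?thesis using sp by auto
      qed (use sp in auto)
    qed
    have "\<P>(\<omega> in M. ?Z N \<omega> \<le> \<tau> - \<epsilon>) \<le> prob (A N) + prob ?B"
      using low AN by (intro order_trans[OF finite_measure_mono measure_Un_le]) auto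
    moreover have "prob (A N) \<le> \<P>(\<omega> in M. ?Z N \<omega> \<le> \<tau> + \<epsilon>) + prob ?B"
      using high by (intro order_trans[OF finite_measure_mono measure_Un_le]) auto
    moreover have "?F \<tau> - ?F (\<tau> - \<epsilon>) \<le> \<epsilon>" "?F (\<tau> + \<epsilon>) - ?F \<tau> \<le> \<epsilon>"
    proof -
      have "?f * \<epsilon> \<le> 1 * \<epsilon>" using f \<epsilon> by (intro mult_right_mono) auto
      then show "?F \<tau> - ?F (\<tau> - \<epsilon>) \<le> \<epsilon>" "?F (\<tau> + \<epsilon>) - ?F \<tau> \<le> \<epsilon>"
        using std_normal_cdf_abs_diff_le[of \<tau> "\<tau> - \<epsilon>"] std_normal_cdf_abs_diff_le[of "\<tau> + \<epsilon>" \<tau>] \<epsilon>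
        by (auto simp: abs_le_iff)
    qed
    ultimately show ?case using elim B \<epsilon> unfolding \<epsilon>_def by linarith
  qed
  then show "\<exists>no. \<forall>n\<ge>no. norm (prob (A n) - ?F \<tau>) < r"
    by (simp add: eventually_sequentially)
qed

end

theorem corollary3p1:
  fixes M :: "'a measure"
    and X :: "nat \<Rightarrow> 'a \<Rightarrow> real"
    and \<mu> \<sigma> :: real
    and m :: "nat \<Rightarrow> nat"
    and \<mu>hat :: "nat \<Rightarrow> 'a \<Rightarrow> real"
  assumes "prob_space M"
    and "prob_space.indep_vars M (\<lambda>_. borel) X {1..}"
    and "\<And>i. i \<ge> 1 \<Longrightarrow> distr M borel (X i) = distr M borel (X 1)"
    and "integrable M (X 1)"
    and "integrable M (\<lambda>\<omega>. (X 1 \<omega>)\<^sup>2)"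
    and "prob_space.expectation M (X 1) = \<mu>"
    and "prob_space.variance M (X 1) = \<sigma>\<^sup>2"
    and "\<sigma> > 0"
    and "\<forall>\<^sub>F N in sequentially. 2 \<le> m N \<and> m N < N"
    and "\<And>N. \<mu>hat N \<in> borel_measurable M"
    and "\<And>N \<omega>. 2 \<le> m N \<Longrightarrow> m N < N \<Longrightarrow> \<omega> \<in> space M \<Longrightarrow>
           is_pi_mom N (m N) (\<lambda>j. X j \<omega>) (\<mu>hat N \<omega>)"
    and "filterlim (\<lambda>N. real N / real (m N)) at_top sequentially"
    and "filterlim m at_top sequentially"
    and "(\<lambda>N. sqrt (real N / real (m N)) * g_fun M (X 1) \<mu> \<sigma> (m N)) \<longlonglongrightarrow> 0"
  shows "weak_conv_m (\<lambda>N. distr M borel (\<lambda>\<omega>. sqrt (real N) * (\<mu>hat N \<omega> - \<mu>)))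
           (density lborel (normal_density 0 \<sigma>))"
proof -
  interpret prob_space M by (rule assms(1))
  note [measurable] = assms(10)
  define Y where "Y i \<omega> = (X i \<omega> - \<mu>) / \<sigma>" for i \<omega>
  define \<nu> where "\<nu> = distr M borel (Y 1)"
  have X_meas [measurable]: "X i \<in> borel_measurable M" if "i \<ge> 1" for i
    using assms(2) that unfolding indep_vars_def2 by auto
  have X1 [measurable]: "X 1 \<in> borel_measurable M" "X (Suc 0) \<in> borel_measurable M"
    by (rule X_meas, simp)+
  have Y1 [measurable]: "Y 1 \<in> borel_measurable M" "Y (Suc 0) \<in> borel_measurable M"
    unfolding Y_def[abs_def] by measurable
  have Y_indep: "indep_vars (\<lambda>_. borel) Y {1..}"
    using indep_vars_compose2[OF assms(2), of "\<lambda>_ x. (x - \<mu>) / \<sigma>" "\<lambda>_. borel"]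
    by (simp add: Y_def[abs_def])
  have Y_distr: "distr M borel (Y i) = \<nu>" if "i \<ge> 1" for i
  proof -
    have "distr M borel (Y i) = distr (distr M borel (X i)) borel (\<lambda>x. (x - \<mu>) / \<sigma>)"
      using X_meas[OF that] by (subst distr_distr) (auto simp: Y_def[abs_def] comp_def)
    also have "\<dots> = distr (distr M borel (X 1)) borel (\<lambda>x. (x - \<mu>) / \<sigma>)"
      by (simp only: assms(3)[OF that])
    also have "\<dots> = \<nu>"
      unfolding \<nu>_def by (subst distr_distr) (auto simp: Y_def[abs_def] comp_def)
    finally show ?thesis .
  qed
  have sq_int: "integrable M (\<lambda>\<omega>. (X 1 \<omega> - \<mu>)\<^sup>2)"
    unfolding power2_diff using assms(4,5) by auto
  interpret std: standardized_distribution \<nu>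
  proof (intro standardized_distribution.intro standardized_distribution_axioms.intro)
    show "real_distribution \<nu>" unfolding \<nu>_def by (rule real_distribution_distr) (rule Y1)
    show "integrable \<nu> (\<lambda>x. x\<^sup>2)"
      unfolding \<nu>_def using sq_int
      by (subst integrable_distr_eq) (auto simp: Y_def power_divide)
    show "(\<integral>x. x \<partial>\<nu>) = 0"
      unfolding \<nu>_def using assms(4,6) by (subst integral_distr) (auto simp: Y_def[abs_def] prob_space)
    show "(\<integral>x. x\<^sup>2 \<partial>\<nu>) = 1"
      unfolding \<nu>_def using assms(6,7,8)
      by (subst integral_distr) (auto simp: Y_def power_divide)
  qed
  interpret iid_standardized M \<nu> Y
    by (intro iid_standardized.intro iid_standardized_axioms.intro prob_space_axioms
        std.standardized_distribution_axioms Y_indep Y_distr)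
  \<comment> \<open>Change of variables to the law of the standardized observation; this carries the
    rate assumption over to \<open>trunc_moment\<close>.\<close>
  have g: "g_fun M (X 1) \<mu> \<sigma> k = trunc_moment \<nu> k" for k
    unfolding g_fun_def trunc_moment_def \<nu>_def by (subst integral_distr) (auto simp: Y_def)
  show ?thesis
    unfolding weak_conv_m_def weak_conv_def
  proof (intro allI impI)
    fix t :: real
    \<comment> \<open>The point t at which the limit is tested becomes t / \<sigma> in standardized
      units; the asymptotic locale is interpreted anew for each such point.\<close>
    define \<tau> where "\<tau> = t / \<sigma>"
    interpret pi_mom_asymptotics M \<nu> Y m \<tau>
      by (intro pi_mom_asymptotics.intro pi_mom_asymptotics_axioms.intro iid_standardized_axioms
          assms(9,12,13) assms(14)[unfolded g])
    let ?A = "\<lambda>N. {\<omega> \<in> space M. sqrt (real N) * (\<mu>hat N \<omega> - \<mu>) \<le> t}"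
    \<comment> \<open>An exact equivalence: a block average is an increasing affine function of the
      standardized block sum, and it sends \<open>threshold N\<close> to the level \<mu> + t / sqrt
      N.\<close>
    have thr: "block_mean (m N) (\<lambda>j. X j \<omega>) J \<le> \<mu> + t / sqrt N \<longleftrightarrow> block_sum J \<omega> \<le> threshold N"
      if m: "2 \<le> m N" "m N < N" and J: "J \<in> m_subsets N (m N)" for N J \<omega>
    proof -
      have "(\<Sum>j\<in>J. X j \<omega>) = m N * \<mu> + \<sigma> * block_sum J \<omega>"
      proof -
        have "(\<Sum>j\<in>J. X j \<omega>) = (\<Sum>j\<in>J. \<mu> + \<sigma> * Y j \<omega>)"
          using assms(8) by (intro sum.cong) (auto simp: Y_def)
        then show ?thesis
          using m_subsetsD[OF J] by (simp add: sum.distrib block_sum_def sum_distrib_left)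
      qed
      then have "block_mean (m N) (\<lambda>j. X j \<omega>) J = \<mu> + \<sigma> / m N * block_sum J \<omega>"
        using m by (simp add: block_mean_def field_simps)
      moreover have "\<mu> + t / sqrt N = \<mu> + \<sigma> / m N * threshold N"
        using m assms(8) unfolding threshold_def by (simp add: \<tau>_def)
      moreover have "0 < \<sigma> / m N" using m assms(8) by simp
      ultimately show ?thesis by (simp add: mult_le_cancel_left_pos del: times_divide_eq_left)
    qed
    have U_eq: "block_ecdf N (m N) (threshold N) \<omega> = card {J \<in> m_subsets N (m N). block_mean (m N) (\<lambda>j. X j \<omega>) J \<le> \<mu> + t / sqrt N}
        / card (m_subsets N (m N))" if m: "2 \<le> m N" "m N < N" for N \<omega>
    proof -
      have "{J \<in> m_subsets N (m N). block_sum J \<omega> \<le> threshold N} = {J \<in> m_subsets N (m N). block_mean (m N) (\<lambda>j. X j \<omega>) J \<le> \<mu> + t / sqrt N}"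
        using thr[OF m] by auto
      then show ?thesis
        unfolding block_ecdf_def card_filter_eq_sum[OF finite_m_subsets] by simp
    qed
    have A_iff: "sqrt (real N) * (\<mu>hat N \<omega> - \<mu>) \<le> t \<longleftrightarrow> \<mu>hat N \<omega> \<le> \<mu> + t / sqrt N" if "2 \<le> m N" "m N < N" for N \<omega>
    proof -
      have "sqrt N > 0" using that by simp
      then show ?thesis by (simp add: field_simps)
    qed
    have c0: "0 < card (m_subsets N (m N))" if "2 \<le> m N" "m N < N" for N
      using that by (simp add: card_m_subsets)
    have "(\<lambda>N. prob (?A N)) \<longlonglongrightarrow> cdf std_normal_distribution \<tau>"
    proof (rule median_cdf_tendsto)
      show "?A N \<in> events" for N by measurable
    next
      fix N \<omega> assume m: "2 \<le> m N" "m N < N" and sp: "\<omega> \<in> space M" and half: "1 / 2 < block_ecdf N (m N) (threshold N) \<omega>"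
      have med: "is_median (m_subsets N (m N)) (block_mean (m N) (\<lambda>j. X j \<omega>)) (\<mu>hat N \<omega>)"
        using assms(11)[OF m sp] by (simp add: is_pi_mom_def)
      have "\<mu>hat N \<omega> \<le> \<mu> + t / sqrt N"
      proof (rule is_median_le[OF finite_m_subsets med])
        show "card (m_subsets N (m N)) < 2 * card {J \<in> m_subsets N (m N). block_mean (m N) (\<lambda>j. X j \<omega>) J \<le> \<mu> + t / sqrt N}"
          using half c0[OF m] unfolding U_eq[OF m] by (simp add: field_simps)
      qed
      then show "\<omega> \<in> ?A N" using sp by (simp add: A_iff[OF m])
    next
      fix N \<omega> assume m: "2 \<le> m N" "m N < N" and A: "\<omega> \<in> ?A N"
      have med: "is_median (m_subsets N (m N)) (block_mean (m N) (\<lambda>j. X j \<omega>)) (\<mu>hat N \<omega>)"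
        using assms(11)[OF m] A by (simp add: is_pi_mom_def)
      have le: "\<mu>hat N \<omega> \<le> \<mu> + t / sqrt N" using A by (simp add: A_iff[OF m])
      show "1 / 2 \<le> block_ecdf N (m N) (threshold N) \<omega>"
        using is_median_leD[OF finite_m_subsets med le] c0[OF m] unfolding U_eq[OF m] by (simp add: field_simps)
    qed
    moreover have "cdf (distr M borel (\<lambda>\<omega>. sqrt (real N) * (\<mu>hat N \<omega> - \<mu>))) t = prob (?A N)" for N
      unfolding cdf_def by (subst measure_distr) (auto intro!: arg_cong[of _ _ prob])
    ultimately show "(\<lambda>N. cdf (distr M borel (\<lambda>\<omega>. sqrt (real N) * (\<mu>hat N \<omega> - \<mu>))) t)
        \<longlonglongrightarrow> cdf (density lborel (normal_density 0 \<sigma>)) t"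
      by (simp add: cdf_normal_density[OF assms(8)] \<tau>_def)
  qed
qed

end
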